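(* Let $f_1,g_1$ be fixed spectral densities, $\varepsilon_1,\varepsilon_2>0$, and $$D_{\varepsilon_1}^2=\Big\{f:\tfrac1{2\pi}\int_{-\infty}^\infty|f(\lambda)-f_1(\lambda)|^2d\lambda\le\varepsilon_1\Big\},\qquad D_{\varepsilon_2}^2=\Big\{g:\tfrac1{2\pi}\int_{-\infty}^\infty|g(\lambda)-g_1(\lambda)|^2d\lambda\le\varepsilon_2\Big\}.$$ Let the spectral densities $f_0\in D_{\varepsilon_1}^2$, $g_0\in D_{\varepsilon_2}^2$ satisfy the minimality condition, let the operator $\mathbf{B}^0$ be invertible, and let the functions $$h_f(f_0,g_0)=\frac{|A(e^{i\lambda})g_0(\lambda)+C^0(e^{i\lambda})|^2}{(f_0(\lambda)+g_0(\lambda))^2},\qquad h_g(f_0,g_0)=\frac{|A(e^{i\lambda})f_0(\lambda)-C^0(e^{i\lambda})|^2}{(f_0(\lambda)+g_0(\lambda))^2}$$ be bounded. Suppose that for some constants $\alpha_1\ge0$, $\alpha_2\ge0$ $$|A(e^{i\lambda})g_0(\lambda)+C^0(e^{i\lambda})|^2=(f_0(\lambda)+g_0(\lambda))^2(f_0(\lambda)-f_1(\lambda))\alpha_1,$$ $$|A(e^{i\lambda})f_0(\lambda)-C^0(e^{i\lambda})|^2=(f_0(\lambda)+g_0(\lambda))^2(g_0(\lambda)-g_1(\lambda))\alpha_2,$$ that the pair $(f_0,g_0)$ determines a solution to the optimization problem $$\max_{(f,g)\in D_{\varepsilon_1}^2\times D_{\varepsilon_2}^2}\big(\langle\mathbf{R}\mathbf{a},\mathbf{B}^{-1}\mathbf{R}\mathbf{a}\rangle+\langle\mathbf{Q}\mathbf{a},\mathbf{a}\rangle\big)=\langle\mathbf{R}^0\mathbf{a},(\mathbf{B}^0)^{-1}\mathbf{R}^0\mathbf{a}\rangle+\langle\mathbf{Q}^0\mathbf{a},\mathbf{a}\rangle,$$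 and that $$\frac1{2\pi}\int_{-\infty}^\infty|f_0(\lambda)-f_1(\lambda)|^2d\lambda=\varepsilon_1,\qquad\frac1{2\pi}\int_{-\infty}^\infty|g_0(\lambda)-g_1(\lambda)|^2d\lambda=\varepsilon_2.$$ Then $f_0,g_0$ are the least favorable spectral densities in the class $D=D_{\varepsilon_1}^2\times D_{\varepsilon_2}^2$ for the optimal linear filtering of the functional $A\xi=\int_{R^s}a(t)\xi(-t)dt$, and the function $$h^0(e^{i\lambda})=A(e^{i\lambda})\frac{f_0(\lambda)}{f_0(\lambda)+g_0(\lambda)}-\frac{C^0(e^{i\lambda})}{f_0(\lambda)+g_0(\lambda)}$$ is the minimax-robust spectral characteristic of the estimate of $A\xi$.
   Context: Sets. Let $s\ge1$, $N_0=K_0=0$, $N_1,\dots,N_s,K_1,\dots,K_s>0$, $M_l=\sum_{k=0}^l(N_k+K_k)$, with the intervals $[M_l,M_l+N_l]$, $l=1,\dots,s$, pairwise disjoint. Put $S=\bigcup_{l=1}^s[-M_l-N_l,-M_l]$, $S^+=\bigcup_{l=1}^s[M_l,M_l+N_l]$, $R^s=[0,\infty)\setminus S^+$, $\mathbb{R}^-=(-\infty,0)$, $T=S\cup[0,\infty)$. In $L_2(T)$ the inner product is $\langle x,y\rangle=\int_T x(t)\overline{y(t)}\,dt$. Functional. $a:R^s\to\mathbb{C}$ satisfies $\int_{R^s}|a(t)|dt<\infty$, $\int_{R^s}t|a(t)|^2dt<\infty$; $\mathbf{a}$ is the function on $T$ equal to $a$ on $R^s$ and $0$ on $S\cup S^+$,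 taken to be an element of $L_2(T)$. $A(e^{i\lambda})=\int_{R^s}a(t)e^{-it\lambda}dt$ (notations such as $A(e^{i\lambda})$, $h(e^{i\lambda})$, $C^0(e^{i\lambda})$ simply denote functions of $\lambda\in\mathbb{R}$). $\xi,\eta$ are uncorrelated zero-mean stationary processes on $\mathbb{R}$ with spectral densities $f,g$ (nonnegative integrable functions on $\mathbb{R}$; covariance $\frac1{2\pi}\int e^{it\lambda}f(\lambda)d\lambda$, resp. with $g$); $A\xi$ is estimated from observations of $\xi(t)+\eta(t)$, $t\in\mathbb{R}^-\setminus S$. Minimality condition for $(f,g)$: there is a nontrivial function of exponential type $\gamma(\lambda)=\int_0^\infty\alpha(t)e^{it\lambda}dt$ with $\int_{-\infty}^\infty\frac{|\gamma(\lambda)|^2}{f(\lambda)+g(\lambda)}d\lambda<\infty$. Estimates. $L_2^s(f+g)$ is the closed linear subspace of $L_2((f+g)d\lambda)$ generated by $\{e^{it\lambda}:t\in\mathbb{R}^-\setminus S\}$. The estimate with spectral characteristic $h\in L_2^s(f+g)$ has mean-square error $\Delta(h;f,g)=\frac1{2\pi}\int|A-h|^2f\,d\lambda+\frac1{2\pi}\int|h|^2g\,d\lambda$. $h(f,g)$ denotes the minimizer of $\Delta(\cdot;f,g)$ over $L_2^s(f+g)$ (the spectral characteristic of the optimal estimate) and $\Delta(f,g)=\Delta(h(f,g);f,g)$. Operators in $L_2(T)$ attached to $(f,g)$, for $t\in T$: $(\mathbf{B}x)(t)=\frac1{2\pi}\int_T x(u)\int_{-\infty}^\infty e^{i\lambda(u-t)}\frac{1}{f+g}\,d\lambda\,du$,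 $(\mathbf{R}x)(t)=\frac1{2\pi}\int_T x(u)\int_{-\infty}^\infty e^{-i\lambda(u+t)}\frac{f}{f+g}\,d\lambda\,du$, $(\mathbf{Q}x)(t)=\frac1{2\pi}\int_T x(u)\int_{-\infty}^\infty e^{-i\lambda(u-t)}\frac{fg}{f+g}\,d\lambda\,du$. The kernels are understood in the sense of Fourier transforms. With $\hat x(\lambda)=\int_T x(u)e^{iu\lambda}du$: $\mathbf{R}x$ is the restriction to $T$ of $\frac1{2\pi}\int e^{-it\lambda}\hat x(-\lambda)\frac{f}{f+g}d\lambda$ ($L_2$-Fourier transform). $\mathbf{B}$ may be unbounded: let $\mathcal D=\{x\in L_2(T):\int|\hat x|^2/(f+g)\,d\lambda<\infty\}$; $\mathbf{B}x=y$ means $x\in\mathcal D$, $y\in L_2(T)$ and $\frac1{2\pi}\int\hat x\,\overline{\hat k}/(f+g)\,d\lambda=\langle y,k\rangle$ for all $k\in\mathcal D$. "Invertible" means that $\mathcal D$ is dense in $L_2(T)$ and $\mathbf{B}$ is a bijection from its domain onto $L_2(T)$. The expression $\langle\mathbf{R}\mathbf{a},\mathbf{B}^{-1}\mathbf{R}\mathbf{a}\rangle+\langle\mathbf{Q}\mathbf{a},\mathbf{a}\rangle$ is the value of the optimal error $\Delta(f,g)$; for pairs $(f,g)$ for which $\mathbf{B}$ is not invertible it is understood to mean $\Delta(f,g)$. $\mathbf{B}^0,\mathbf{R}^0,\mathbf{Q}^0$ are the operators attached to $(f_0,g_0)$, and $C^0(e^{i\lambda})=\int_T((\mathbf{B}^0)^{-1}\mathbf{R}^0\mathbf{a})(t)e^{it\lambda}dt$.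 Definitions. For a class $D=D_f\times D_g$ of pairs of spectral densities: $(f_0,g_0)\in D$ is least favorable in $D$ for the optimal linear filtering of $A\xi$ if $\Delta(f_0,g_0)=\max_{(f,g)\in D}\Delta(f,g)$. A spectral characteristic $h^0$ is minimax-robust if $h^0\in H_D=\bigcap_{(f,g)\in D}L_2^s(f+g)$ and $\min_{h\in H_D}\max_{(f,g)\in D}\Delta(h;f,g)=\max_{(f,g)\in D}\Delta(h^0;f,g)$ (max read as supremum where necessary). *)

theory Defs
  imports "HOL-Analysis.Analysis"
begin

section \<open>Square-integrable functions and the Fourier transform\<close>

text \<open>
  Elements of L2 spaces are represented by measurable functions; whatever is meant as an identity
  of L2 elements is stated almost everywhere.
\<close>

definition L2 :: "'a measure \<Rightarrow> ('a \<Rightarrow> complex) set" where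
  "L2 M = {x \<in> borel_measurable M. integrable M (\<lambda>t. (cmod (x t))\<^sup>2)}"

definition L2_inner :: "'a measure \<Rightarrow> ('a \<Rightarrow> complex) \<Rightarrow> ('a \<Rightarrow> complex) \<Rightarrow> complex" where
  "L2_inner M x y = (\<integral>t. x t * cnj (y t) \<partial>M)"

text \<open>
  The transform of \<open>x \<in> L2(T)\<close> with kernel \<open>cis (u\<omega>)\<close>, as the limit in mean of the transforms of the
  truncations of \<open>x\<close>; it is determined up to a null set.
\<close>

definition is_fourier :: "real set \<Rightarrow> (real \<Rightarrow> complex) \<Rightarrow> (real \<Rightarrow> complex) \<Rightarrow> bool" where
  "is_fourier T x X \<longleftrightarrow> X \<in> L2 lborel \<and>
     (\<lambda>n. \<integral>\<^sup>+\<omega>. ennreal ((cmod (X \<omega> -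
            (LINT u:T \<inter> {- real n..real n}|lborel. x u * cis (u * \<omega>))))\<^sup>2) \<partial>lborel)
       \<longlonglongrightarrow> 0"

definition fourier :: "real set \<Rightarrow> (real \<Rightarrow> complex) \<Rightarrow> real \<Rightarrow> complex" where
  "fourier T x = (SOME X. is_fourier T x X)"


section \<open>The sets\<close>

definition M_pt :: "(nat \<Rightarrow> real) \<Rightarrow> (nat \<Rightarrow> real) \<Rightarrow> nat \<Rightarrow> real" where
  "M_pt N K l = (\<Sum>k\<le>l. N k + K k)"

definition S_set :: "nat \<Rightarrow> (nat \<Rightarrow> real) \<Rightarrow> (nat \<Rightarrow> real) \<Rightarrow> real set" where
  "S_set s N K = (\<Union>l\<in>{1..s}. {- M_pt N K l - N l..- M_pt N K l})"

definition S_plus :: "nat \<Rightarrow> (nat \<Rightarrow> real) \<Rightarrow> (nat \<Rightarrow> real) \<Rightarrow> real set" where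
  "S_plus s N K = (\<Union>l\<in>{1..s}. {M_pt N K l..M_pt N K l + N l})"

definition R_set :: "nat \<Rightarrow> (nat \<Rightarrow> real) \<Rightarrow> (nat \<Rightarrow> real) \<Rightarrow> real set" where
  "R_set s N K = {0..} - S_plus s N K"

definition T_set :: "nat \<Rightarrow> (nat \<Rightarrow> real) \<Rightarrow> (nat \<Rightarrow> real) \<Rightarrow> real set" where
  "T_set s N K = S_set s N K \<union> {0..}"

definition obs_set :: "nat \<Rightarrow> (nat \<Rightarrow> real) \<Rightarrow> (nat \<Rightarrow> real) \<Rightarrow> real set" where
  "obs_set s N K = {..<0} - S_set s N K"

definition admissible_intervals :: "nat \<Rightarrow> (nat \<Rightarrow> real) \<Rightarrow> (nat \<Rightarrow> real) \<Rightarrow> bool" where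
  "admissible_intervals s N K \<longleftrightarrow>
     1 \<le> s \<and> N 0 = 0 \<and> K 0 = 0 \<and> (\<forall>l\<in>{1..s}. 0 < N l \<and> 0 < K l) \<and>
     disjoint_family_on (\<lambda>l. {M_pt N K l..M_pt N K l + N l}) {1..s}"


section \<open>The functional and the spectral densities\<close>

definition ext_by_zero :: "real set \<Rightarrow> (real \<Rightarrow> complex) \<Rightarrow> real \<Rightarrow> complex" where
  "ext_by_zero R a t = (if t \<in> R then a t else 0)"

definition admissible_weight :: "real set \<Rightarrow> real set \<Rightarrow> (real \<Rightarrow> complex) \<Rightarrow> bool" where
  "admissible_weight T R a \<longleftrightarrow>
     set_integrable lborel R a \<and>
     set_integrable lborel R (\<lambda>t. t * (cmod (a t))\<^sup>2) \<and>
     ext_by_zero R a \<in> L2 (restrict_space lborel T)"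

text \<open>
  The kernel is \<open>cis (-t\<omega>)\<close> because the functional is the integral of \<open>a(t) \<xi>(-t)\<close>.
\<close>

definition A_fun :: "real set \<Rightarrow> (real \<Rightarrow> complex) \<Rightarrow> real \<Rightarrow> complex" where
  "A_fun R a \<omega> = (LINT t:R|lborel. a t * cis (- t * \<omega>))"

definition spectral_density :: "(real \<Rightarrow> real) \<Rightarrow> bool" where
  "spectral_density f \<longleftrightarrow> integrable lborel f \<and> (\<forall>\<omega>. 0 \<le> f \<omega>)"

definition exponential_type :: "(complex \<Rightarrow> complex) \<Rightarrow> bool" where
  "exponential_type F \<longleftrightarrow>
     F holomorphic_on UNIV \<and> (\<exists>C \<tau>. \<forall>z. cmod (F z) \<le> C * exp (\<tau> * cmod z))"

text \<open>
  The quotient is taken in \<^typ>\<open>ennreal\<close>, where \<open>c / 0 = \<infinity>\<close> for \<open>c > 0\<close>, so the zeros of \<open>f + g\<close>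
  count; the same applies to \<open>B_form_domain\<close> below.
\<close>

definition minimality :: "(real \<Rightarrow> real) \<Rightarrow> (real \<Rightarrow> real) \<Rightarrow> bool" where
  "minimality f g \<longleftrightarrow> (\<exists>\<gamma> \<alpha>.
     exponential_type \<gamma> \<and> set_integrable lborel {0..} \<alpha> \<and>
     (\<forall>\<omega>::real. \<gamma> (complex_of_real \<omega>) = (LINT t:{0..}|lborel. \<alpha> t * cis (t * \<omega>))) \<and>
     (\<exists>\<omega>::real. \<gamma> (complex_of_real \<omega>) \<noteq> 0) \<and>
     (\<integral>\<^sup>+\<omega>. ennreal ((cmod (\<gamma> (complex_of_real \<omega>)))\<^sup>2) / ennreal (f \<omega> + g \<omega>) \<partial>lborel) < \<infinity>)"


section \<open>Estimates and their mean-square errors\<close>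

definition spectral_measure :: "(real \<Rightarrow> real) \<Rightarrow> (real \<Rightarrow> real) \<Rightarrow> real measure" where
  "spectral_measure f g = density lborel (\<lambda>\<omega>. ennreal (f \<omega> + g \<omega>))"

text \<open>
  The closed linear span of \<open>cis (t\<omega>)\<close>, \<open>t \<in> U\<close>, in \<open>L2((f+g) d\<omega>)\<close>.
\<close>

definition L2s :: "real set \<Rightarrow> (real \<Rightarrow> real) \<Rightarrow> (real \<Rightarrow> real) \<Rightarrow> (real \<Rightarrow> complex) set" where
  "L2s U f g = {h \<in> L2 (spectral_measure f g).
     \<forall>e>0. \<exists>F c. finite F \<and> F \<subseteq> U \<and>
       (\<integral>\<omega>. (cmod (h \<omega> - (\<Sum>t\<in>F. c t * cis (t * \<omega>))))\<^sup>2 \<partial>spectral_measure f g) < e}"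

text \<open>
  Both integrands are integrable whenever \<open>h \<in> L2((f+g) d\<omega>)\<close>, since \<open>A_fun R a\<close> is bounded.
\<close>

definition mse :: "real set \<Rightarrow> (real \<Rightarrow> complex) \<Rightarrow> (real \<Rightarrow> real) \<Rightarrow> (real \<Rightarrow> real) \<Rightarrow>
    (real \<Rightarrow> complex) \<Rightarrow> real" where
  "mse R a f g h =
     1 / (2 * pi) * (\<integral>\<omega>. (cmod (A_fun R a \<omega> - h \<omega>))\<^sup>2 * f \<omega> \<partial>lborel) +
     1 / (2 * pi) * (\<integral>\<omega>. (cmod (h \<omega>))\<^sup>2 * g \<omega> \<partial>lborel)"

definition opt_char :: "real set \<Rightarrow> real set \<Rightarrow> (real \<Rightarrow> complex) \<Rightarrow> (real \<Rightarrow> real) \<Rightarrow>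
    (real \<Rightarrow> real) \<Rightarrow> real \<Rightarrow> complex" where
  "opt_char U R a f g = arg_min_on (mse R a f g) (L2s U f g)"

definition opt_mse :: "real set \<Rightarrow> real set \<Rightarrow> (real \<Rightarrow> complex) \<Rightarrow> (real \<Rightarrow> real) \<Rightarrow>
    (real \<Rightarrow> real) \<Rightarrow> real" where
  "opt_mse U R a f g = mse R a f g (opt_char U R a f g)"


section \<open>The operators\<close>

definition B_form_domain :: "real set \<Rightarrow> (real \<Rightarrow> real) \<Rightarrow> (real \<Rightarrow> real) \<Rightarrow>
    (real \<Rightarrow> complex) set" where
  "B_form_domain T f g = {x \<in> L2 (restrict_space lborel T).
     (\<integral>\<^sup>+\<omega>. ennreal ((cmod (fourier T x \<omega>))\<^sup>2) / ennreal (f \<omega> + g \<omega>) \<partial>lborel) < \<infinity>}"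

text \<open>
  \<open>B_graph T f g x y\<close> says that \<open>Bx = y\<close>.
\<close>

definition B_graph :: "real set \<Rightarrow> (real \<Rightarrow> real) \<Rightarrow> (real \<Rightarrow> real) \<Rightarrow>
    (real \<Rightarrow> complex) \<Rightarrow> (real \<Rightarrow> complex) \<Rightarrow> bool" where
  "B_graph T f g x y \<longleftrightarrow>
     x \<in> B_form_domain T f g \<and> y \<in> L2 (restrict_space lborel T) \<and>
     (\<forall>k\<in>B_form_domain T f g.
        1 / (2 * complex_of_real pi) *
          (\<integral>\<omega>. fourier T x \<omega> * cnj (fourier T k \<omega>) / complex_of_real (f \<omega> + g \<omega>) \<partial>lborel)
        = L2_inner (restrict_space lborel T) y k)"

definition B_invertible :: "real set \<Rightarrow> (real \<Rightarrow> real) \<Rightarrow> (real \<Rightarrow> real) \<Rightarrow> bool" where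
  "B_invertible T f g \<longleftrightarrow>
     (\<forall>y\<in>L2 (restrict_space lborel T). \<forall>e>0. \<exists>x\<in>B_form_domain T f g.
        (\<integral>t. (cmod (y t - x t))\<^sup>2 \<partial>restrict_space lborel T) < e) \<and>
     (\<forall>y\<in>L2 (restrict_space lborel T). \<exists>x. B_graph T f g x y) \<and>
     (\<forall>x x' y. B_graph T f g x y \<longrightarrow> B_graph T f g x' y \<longrightarrow>
        (AE t in restrict_space lborel T. x t = x' t))"

definition B_inv :: "real set \<Rightarrow> (real \<Rightarrow> real) \<Rightarrow> (real \<Rightarrow> real) \<Rightarrow>
    (real \<Rightarrow> complex) \<Rightarrow> real \<Rightarrow> complex" where
  "B_inv T f g y = (SOME x. B_graph T f g x y)"

text \<open>
  The outer transform has kernel \<open>cis (-t\<omega>)\<close>, hence the evaluation at \<open>-t\<close>.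
\<close>

definition R_op :: "real set \<Rightarrow> (real \<Rightarrow> real) \<Rightarrow> (real \<Rightarrow> real) \<Rightarrow>
    (real \<Rightarrow> complex) \<Rightarrow> real \<Rightarrow> complex" where
  "R_op T f g x t = 1 / (2 * complex_of_real pi) *
     fourier UNIV (\<lambda>\<omega>. fourier T x (- \<omega>) * complex_of_real (f \<omega> / (f \<omega> + g \<omega>))) (- t)"

text \<open>
  Here \<open>fg/(f+g)\<close> is integrable, so the kernel is a bounded function and, for integrable \<open>x\<close>, the
  defining integrals exist in the ordinary sense.
\<close>

definition Q_op :: "real set \<Rightarrow> (real \<Rightarrow> real) \<Rightarrow> (real \<Rightarrow> real) \<Rightarrow>
    (real \<Rightarrow> complex) \<Rightarrow> real \<Rightarrow> complex" where
  "Q_op T f g x t = 1 / (2 * complex_of_real pi) *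
     (LINT u:T|lborel. x u *
        (\<integral>\<omega>. cis (- \<omega> * (u - t)) * complex_of_real (f \<omega> * g \<omega> / (f \<omega> + g \<omega>)) \<partial>lborel))"

definition operator_value :: "real set \<Rightarrow> real set \<Rightarrow> (real \<Rightarrow> complex) \<Rightarrow> (real \<Rightarrow> real) \<Rightarrow>
    (real \<Rightarrow> real) \<Rightarrow> complex" where
  "operator_value T R a f g =
     (let b = ext_by_zero R a; y = R_op T f g b; M = restrict_space lborel T
      in L2_inner M y (B_inv T f g y) + L2_inner M (Q_op T f g b) b)"

text \<open>
  The objective of the optimization problem; \<open>operator_value\<close> is real when \<open>B\<close> is invertible.
\<close>

definition error_value :: "real set \<Rightarrow> real set \<Rightarrow> real set \<Rightarrow> (real \<Rightarrow> complex) \<Rightarrow>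
    (real \<Rightarrow> real) \<Rightarrow> (real \<Rightarrow> real) \<Rightarrow> real" where
  "error_value T U R a f g =
     (if B_invertible T f g then Re (operator_value T R a f g) else opt_mse U R a f g)"

definition C_fun :: "real set \<Rightarrow> real set \<Rightarrow> (real \<Rightarrow> complex) \<Rightarrow> (real \<Rightarrow> real) \<Rightarrow>
    (real \<Rightarrow> real) \<Rightarrow> real \<Rightarrow> complex" where
  "C_fun T R a f g = fourier T (B_inv T f g (R_op T f g (ext_by_zero R a)))"


section \<open>Least favorable densities and minimax-robust characteristics\<close>

definition L2_neighbourhood :: "(real \<Rightarrow> real) \<Rightarrow> real \<Rightarrow> (real \<Rightarrow> real) set" where
  "L2_neighbourhood f1 \<epsilon> = {f. spectral_density f \<and>
     integrable lborel (\<lambda>\<omega>. \<bar>f \<omega> - f1 \<omega>\<bar>\<^sup>2) \<and>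
     1 / (2 * pi) * (\<integral>\<omega>. \<bar>f \<omega> - f1 \<omega>\<bar>\<^sup>2 \<partial>lborel) \<le> \<epsilon>}"

definition least_favorable :: "real set \<Rightarrow> real set \<Rightarrow> (real \<Rightarrow> complex) \<Rightarrow>
    ((real \<Rightarrow> real) \<times> (real \<Rightarrow> real)) set \<Rightarrow> (real \<Rightarrow> real) \<Rightarrow> (real \<Rightarrow> real) \<Rightarrow> bool" where
  "least_favorable U R a D f0 g0 \<longleftrightarrow>
     (f0, g0) \<in> D \<and> (\<forall>(f, g)\<in>D. opt_mse U R a f g \<le> opt_mse U R a f0 g0)"

definition H_class :: "real set \<Rightarrow> ((real \<Rightarrow> real) \<times> (real \<Rightarrow> real)) set \<Rightarrow>
    (real \<Rightarrow> complex) set" where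
  "H_class U D = (\<Inter>(f, g)\<in>D. L2s U f g)"

definition max_mse :: "real set \<Rightarrow> (real \<Rightarrow> complex) \<Rightarrow>
    ((real \<Rightarrow> real) \<times> (real \<Rightarrow> real)) set \<Rightarrow> (real \<Rightarrow> complex) \<Rightarrow> ereal" where
  "max_mse R a D h = (SUP (f, g)\<in>D. ereal (mse R a f g h))"

definition minimax_robust :: "real set \<Rightarrow> real set \<Rightarrow> (real \<Rightarrow> complex) \<Rightarrow>
    ((real \<Rightarrow> real) \<times> (real \<Rightarrow> real)) set \<Rightarrow> (real \<Rightarrow> complex) \<Rightarrow> bool" where
  "minimax_robust U R a D h0 \<longleftrightarrow>
     h0 \<in> H_class U D \<and> (\<forall>h\<in>H_class U D. max_mse R a D h0 \<le> max_mse R a D h)"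

end

theory Submission
  imports Defs "HOL-Probability.Probability" "HOL-Complex_Analysis.Complex_Analysis"
begin

text \<open>
  Since \<open>f1\<close> and \<open>g1\<close> are nonnegative, the two equations give \<open>|h0|\<^sup>2 = \<alpha>2 (g0 - g1) \<le> \<alpha>2 g0\<close> and
  \<open>|A - h0|\<^sup>2 = \<alpha>1 (f0 - f1)\<close>; in particular \<open>h0\<close> is not only bounded but square integrable. The
  equation \<open>B x = R a\<close> says that \<open>h0\<close> annihilates the transforms of the form domain of \<open>B\<close>; being
  square integrable, it annihilates by density the transforms of all of \<open>L2(T)\<close>. Now let \<open>(f, g)\<close> be
  any pair of densities and let \<open>\<phi> \<in> L2(f + g)\<close> be orthogonal to \<open>cis (t\<omega>)\<close> for all \<open>t \<notin> T\<close>. The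
  transform of \<open>(f + g) \<phi>\<close> vanishes off \<open>T\<close>; multiplied by a Gaussian it lies in \<open>L2(T)\<close>, and in the
  limit of a flat Gaussian one finds that \<open>h0\<close> is orthogonal to \<open>\<phi>\<close>. Hence \<open>h0 \<in> L2s U f g\<close> for
  every pair. For \<open>(f0, g0)\<close> the function \<open>A f0 - (f0 + g0) h0 = C0\<close> is the transform of a function
  supported in \<open>T\<close>, so \<open>h0\<close> satisfies the normal equations and is the optimal characteristic.
  Finally \<open>(f0, g0)\<close> maximizes \<open>mse R a f g h0\<close>, which is linear in \<open>(f, g)\<close> with gradient
  proportional to \<open>(f0 - f1, g0 - g1)\<close>, over the product of the two balls. So \<open>h0\<close> and \<open>(f0, g0)\<close>
  form a saddle point.
\<close>


section \<open>Square-integrable functions\<close>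

text \<open>The obstacle is that \<open>h0\<close> must lie in \<open>L2s U f g\<close> for every
  pair at once, while invertibility of B concerns \<open>(f0, g0)\<close> alone and yields
  orthogonality only against its form domain, whose extent depends on \<open>1 / (f0 + g0)\<close>.
  Once orthogonality holds against the transforms of all of L2(T), the condition refers to Lebesgue
  measure and to no pair. Boundedness of \<open>h0\<close> puts it into L2(f + g) for arbitrary
  densities; square integrability makes its pairing with transforms continuous. The Gaussian is
  there because the transform of the merely integrable \<open>(f + g) \<phi>\<close> is bounded but
  need not be square integrable; the factor keeps the zeros of that transform and acts on the
  frequency side as convolution with a narrow normal density. Of the Fourier theory in L2, the
  inequality half of Plancherel's theorem, with constant \<open>sqrt (2 * pi)\<close>, and the
  multiplication formula suffice. The normal equations rest on T being closed: each point of U has a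
  neighbourhood free of the support, so the inverse transform of the integrable \<open>C0\<close>
  vanishes there pointwise.\<close>

definition L2_norm :: "'a measure \<Rightarrow> ('a \<Rightarrow> complex) \<Rightarrow> real" where
  "L2_norm M x = sqrt (\<integral>t. (cmod (x t))\<^sup>2 \<partial>M)"

lemma borel_measurable_cnj [measurable (raw)]:
  "f \<in> borel_measurable M \<Longrightarrow> (\<lambda>x. cnj (f x)) \<in> borel_measurable M"
  by (intro borel_measurable_continuous_on[where f=cnj] continuous_intros)

lemma L2_measurable [measurable_dest]: "x \<in> L2 M \<Longrightarrow> x \<in> borel_measurable M"
  by (simp add: L2_def)

lemma L2_integrable: "x \<in> L2 M \<Longrightarrow> integrable M (\<lambda>t. (cmod (x t))\<^sup>2)"
  by (simp add: L2_def)

lemma L2_norm_nonneg [simp]: "0 \<le> L2_norm M x"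
  by (simp add: L2_norm_def)

lemma L2_norm_square: "(L2_norm M x)\<^sup>2 = (\<integral>t. (cmod (x t))\<^sup>2 \<partial>M)"
  by (simp add: L2_norm_def)

lemma cmod_add_square_le: "(cmod (a + b))\<^sup>2 \<le> 2 * (cmod a)\<^sup>2 + 2 * (cmod b)\<^sup>2"
proof -
  have "(cmod (a + b))\<^sup>2 \<le> (cmod a + cmod b)\<^sup>2"
    by (intro power_mono norm_triangle_ineq) auto
  also have "\<dots> \<le> 2 * (cmod a)\<^sup>2 + 2 * (cmod b)\<^sup>2"
    using sum_squares_bound[of "cmod a" "cmod b"] by (simp add: power2_sum)
  finally show ?thesis .
qed

lemma L2_add:
  assumes "x \<in> L2 M" "y \<in> L2 M"
  shows "(\<lambda>t. x t + y t) \<in> L2 M"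
proof -
  note [measurable] = L2_measurable[OF assms(1)] L2_measurable[OF assms(2)]
  have "integrable M (\<lambda>t. (cmod (x t + y t))\<^sup>2)"
    by (rule Bochner_Integration.integrable_bound[where f="\<lambda>t. 2 * (cmod (x t))\<^sup>2 + 2 * (cmod (y t))\<^sup>2"])
       (auto intro!: Bochner_Integration.integrable_add integrable_mult_right L2_integrable assms cmod_add_square_le)
  then show ?thesis by (simp add: L2_def)
qed

lemma L2_cmult:
  assumes "x \<in> L2 M"
  shows "(\<lambda>t. c * x t) \<in> L2 M"
  using assms by (auto simp: L2_def norm_mult power_mult_distrib)

lemma L2_uminus: "x \<in> L2 M \<Longrightarrow> (\<lambda>t. - x t) \<in> L2 M"
  using L2_cmult[of x M "-1"] by simp

lemma L2_diff:
  assumes "x \<in> L2 M" "y \<in> L2 M"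
  shows "(\<lambda>t. x t - y t) \<in> L2 M"
  using L2_add[OF assms(1) L2_uminus[OF assms(2)]] by simp

lemma L2_sum: "(\<And>i. i \<in> F \<Longrightarrow> x i \<in> L2 M) \<Longrightarrow> (\<lambda>t. \<Sum>i\<in>F. x i t) \<in> L2 M"
proof (induction F rule: infinite_finite_induct)
  case (insert i F)
  then show ?case by (simp add: L2_add)
qed (simp_all add: L2_def)

lemma L2_bounded_mult:
  assumes "x \<in> L2 M" "m \<in> borel_measurable M" "AE t in M. cmod (m t) \<le> c"
  shows "(\<lambda>t. m t * x t) \<in> L2 M"
proof -
  note [measurable] = L2_measurable[OF assms(1)] assms(2)
  have "integrable M (\<lambda>t. (cmod (m t * x t))\<^sup>2)"
  proof (rule Bochner_Integration.integrable_bound[where f="\<lambda>t. c\<^sup>2 * (cmod (x t))\<^sup>2"])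
    show "AE t in M. norm ((cmod (m t * x t))\<^sup>2) \<le> norm (c\<^sup>2 * (cmod (x t))\<^sup>2)"
      using assms(3) by eventually_elim (auto simp: norm_mult power_mult_distrib intro!: mult_right_mono power_mono)
  qed (use assms in \<open>auto simp: L2_integrable\<close>)
  then show ?thesis by (simp add: L2_def)
qed

lemma L2_mult_integrable:
  assumes "x \<in> L2 M" "y \<in> L2 M"
  shows "integrable M (\<lambda>t. x t * y t)" and "integrable M (\<lambda>t. x t * cnj (y t))"
    and "integrable M (\<lambda>t. cmod (x t) * cmod (y t))"
proof -
  note [measurable] = L2_measurable[OF assms(1)] L2_measurable[OF assms(2)]
  show 1: "integrable M (\<lambda>t. cmod (x t) * cmod (y t))"
  proof (rule Bochner_Integration.integrable_bound[where f="\<lambda>t. (cmod (x t))\<^sup>2 + (cmod (y t))\<^sup>2"])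
    have "cmod a * cmod b \<le> (cmod a)\<^sup>2 + (cmod b)\<^sup>2" for a b
      using sum_squares_bound[of "cmod a" "cmod b"] mult_nonneg_nonneg[OF norm_ge_zero[of a] norm_ge_zero[of b]] by linarith
    then show "AE t in M. norm (cmod (x t) * cmod (y t)) \<le> norm ((cmod (x t))\<^sup>2 + (cmod (y t))\<^sup>2)"
      by auto
  qed (use assms in \<open>auto simp: L2_integrable\<close>)
  show "integrable M (\<lambda>t. x t * y t)"
    by (rule Bochner_Integration.integrable_bound[OF 1]) (auto simp: norm_mult)
  show "integrable M (\<lambda>t. x t * cnj (y t))"
    by (rule Bochner_Integration.integrable_bound[OF 1]) (auto simp: norm_mult)
qed

lemma L2_Cauchy_Schwarz_abs:
  assumes "x \<in> L2 M" "y \<in> L2 M"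
  shows "(\<integral>t. cmod (x t) * cmod (y t) \<partial>M) \<le> L2_norm M x * L2_norm M y"
proof -
  note [measurable] = L2_measurable[OF assms(1)] L2_measurable[OF assms(2)]
  define I where "I = (\<integral>t. cmod (x t) * cmod (y t) \<partial>M)"
  have I0: "0 \<le> I" by (simp add: I_def)
  have sq: "(\<integral>\<^sup>+t. (ennreal (cmod (z t)))\<^sup>2 \<partial>M) = ennreal ((L2_norm M z)\<^sup>2)" if "z \<in> L2 M" for z
    using L2_integrable[OF that] by (simp add: ennreal_power nn_integral_eq_integral L2_norm_square)
  have "ennreal (I\<^sup>2) = (\<integral>\<^sup>+t. ennreal (cmod (x t)) * ennreal (cmod (y t)) \<partial>M)\<^sup>2"
    using L2_mult_integrable(3)[OF assms] I0
    by (simp add: ennreal_mult[symmetric] nn_integral_eq_integral I_def ennreal_power)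
  also have "\<dots> \<le> (\<integral>\<^sup>+t. (ennreal (cmod (x t)))\<^sup>2 \<partial>M) * (\<integral>\<^sup>+t. (ennreal (cmod (y t)))\<^sup>2 \<partial>M)"
    by (rule Cauchy_Schwarz_nn_integral) auto
  also have "\<dots> = ennreal ((L2_norm M x * L2_norm M y)\<^sup>2)"
    using assms by (simp add: sq ennreal_mult[symmetric] power_mult_distrib)
  finally have "I\<^sup>2 \<le> (L2_norm M x * L2_norm M y)\<^sup>2"
    by (simp add: ennreal_le_iff)
  then show ?thesis
    unfolding I_def[symmetric] by (rule power2_le_imp_le) simp
qed

lemma L2_Cauchy_Schwarz:
  assumes "x \<in> L2 M" "y \<in> L2 M"
  shows "cmod (\<integral>t. x t * cnj (y t) \<partial>M) \<le> L2_norm M x * L2_norm M y"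
proof -
  have "cmod (\<integral>t. x t * cnj (y t) \<partial>M) \<le> (\<integral>t. cmod (x t * cnj (y t)) \<partial>M)"
    by (rule integral_norm_bound)
  then show ?thesis
    using L2_Cauchy_Schwarz_abs[OF assms] by (simp add: norm_mult)
qed

lemma L2_norm_triangle:
  assumes "x \<in> L2 M" "y \<in> L2 M"
  shows "L2_norm M (\<lambda>t. x t + y t) \<le> L2_norm M x + L2_norm M y"
proof (rule power2_le_imp_le)
  have "(L2_norm M (\<lambda>t. x t + y t))\<^sup>2 \<le>
      (\<integral>t. (cmod (x t))\<^sup>2 + (cmod (y t))\<^sup>2 + 2 * (cmod (x t) * cmod (y t)) \<partial>M)"
    unfolding L2_norm_square
  proof (rule integral_mono)
    fix t
    have "(cmod (x t + y t))\<^sup>2 \<le> (cmod (x t) + cmod (y t))\<^sup>2"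
      by (intro power_mono norm_triangle_ineq) auto
    then show "(cmod (x t + y t))\<^sup>2 \<le> (cmod (x t))\<^sup>2 + (cmod (y t))\<^sup>2 + 2 * (cmod (x t) * cmod (y t))"
      by (simp add: power2_sum mult.assoc)
  qed (intro Bochner_Integration.integrable_add integrable_mult_right L2_integrable L2_mult_integrable L2_add assms)+
  also have "\<dots> = (L2_norm M x)\<^sup>2 + (L2_norm M y)\<^sup>2 + 2 * (\<integral>t. cmod (x t) * cmod (y t) \<partial>M)"
    using assms by (simp add: L2_norm_square L2_integrable L2_mult_integrable(3))
  also have "\<dots> \<le> (L2_norm M x + L2_norm M y)\<^sup>2"
    using L2_Cauchy_Schwarz_abs[OF assms] by (simp add: power2_sum)
  finally show "(L2_norm M (\<lambda>t. x t + y t))\<^sup>2 \<le> (L2_norm M x + L2_norm M y)\<^sup>2" .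
qed simp

lemma L2_norm_minus_commute: "L2_norm M (\<lambda>t. x t - y t) = L2_norm M (\<lambda>t. y t - x t)"
  by (simp add: L2_norm_def norm_minus_commute)

lemma L2_norm_triangle_diff:
  assumes "x \<in> L2 M" "y \<in> L2 M" "z \<in> L2 M"
  shows "L2_norm M (\<lambda>t. x t - z t) \<le> L2_norm M (\<lambda>t. x t - y t) + L2_norm M (\<lambda>t. y t - z t)"
  using L2_norm_triangle[OF L2_diff[OF assms(1,2)] L2_diff[OF assms(2,3)]] by simp

lemma L2_norm_eq_0:
  assumes "x \<in> L2 M" "L2_norm M x = 0"
  shows "AE t in M. x t = 0"
proof -
  have "(\<integral>t. (cmod (x t))\<^sup>2 \<partial>M) = 0"
    using assms(2) by (simp add: L2_norm_def)
  then have "AE t in M. (cmod (x t))\<^sup>2 = 0"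
    using integral_nonneg_eq_0_iff_AE[OF L2_integrable[OF assms(1)]] by simp
  then show ?thesis by simp
qed

lemma nn_integral_cmod_square:
  assumes "x \<in> L2 M"
  shows "(\<integral>\<^sup>+t. ennreal ((cmod (x t))\<^sup>2) \<partial>M) = ennreal ((L2_norm M x)\<^sup>2)"
  using L2_integrable[OF assms] by (simp add: nn_integral_eq_integral L2_norm_square)

text \<open>\<open>L2_norm\<close> is a Bochner integral and returns 0 for functions that are not
  square integrable, so a bound on it alone proves nothing. Membership is read off from a
  nonnegative integral instead, the form in which Fatou's lemma delivers bounds.\<close>

lemma L2I_nn_integral:
  assumes [measurable]: "x \<in> borel_measurable M"
    and "(\<integral>\<^sup>+t. ennreal ((cmod (x t))\<^sup>2) \<partial>M) \<le> ennreal (c\<^sup>2)"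
  shows "x \<in> L2 M" and "0 \<le> c \<Longrightarrow> L2_norm M x \<le> c"
proof -
  have "integrable M (\<lambda>t. (cmod (x t))\<^sup>2)"
    using le_less_trans[OF assms(2) ennreal_less_top] by (intro integrableI_bounded) (auto simp: top.not_eq_extremum)
  then show x: "x \<in> L2 M" by (simp add: L2_def)
  show "L2_norm M x \<le> c" if "0 \<le> c"
    using assms(2) that unfolding nn_integral_cmod_square[OF x]
    by (intro power2_le_imp_le[OF _ that]) simp
qed

text \<open>The difference of the products is expanded around the limits,
  \<open>dx * dy + dx * y' + x' * dy\<close>, so that no separate bound on the norms of the
  \<open>y n\<close> is required.\<close>

lemma L2_inner_tendsto:
  assumes "\<And>n. x n \<in> L2 M" "x' \<in> L2 M" "\<And>n. y n \<in> L2 M" "y' \<in> L2 M"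
    and x: "(\<lambda>n. L2_norm M (\<lambda>t. x n t - x' t)) \<longlonglongrightarrow> 0"
    and y: "(\<lambda>n. L2_norm M (\<lambda>t. y n t - y' t)) \<longlonglongrightarrow> 0"
  shows "(\<lambda>n. \<integral>t. x n t * cnj (y n t) \<partial>M) \<longlonglongrightarrow> (\<integral>t. x' t * cnj (y' t) \<partial>M)"
proof (rule LIM_zero_cancel, rule Lim_null_comparison)
  let ?dx = "\<lambda>n. L2_norm M (\<lambda>t. x n t - x' t)" and ?dy = "\<lambda>n. L2_norm M (\<lambda>t. y n t - y' t)"
  show "(\<lambda>n. ?dx n * ?dy n + ?dx n * L2_norm M y' + L2_norm M x' * ?dy n) \<longlonglongrightarrow> 0"
    using x y by (auto intro!: tendsto_eq_intros)
  show "\<forall>\<^sub>F n in sequentially. norm ((\<integral>t. x n t * cnj (y n t) \<partial>M) - (\<integral>t. x' t * cnj (y' t) \<partial>M)) \<le>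
      ?dx n * ?dy n + ?dx n * L2_norm M y' + L2_norm M x' * ?dy n"
  proof (rule always_eventually, rule allI)
    fix n
    have dx: "(\<lambda>t. x n t - x' t) \<in> L2 M" and dy: "(\<lambda>t. y n t - y' t) \<in> L2 M"
      using assms by (auto intro: L2_diff)
    have "(\<integral>t. x n t * cnj (y n t) \<partial>M) - (\<integral>t. x' t * cnj (y' t) \<partial>M) =
        (\<integral>t. x n t * cnj (y n t) - x' t * cnj (y' t) \<partial>M)"
      using assms by (simp add: L2_mult_integrable)
    also have "\<dots> = (\<integral>t. (x n t - x' t) * cnj (y n t - y' t) + (x n t - x' t) * cnj (y' t)
        + x' t * cnj (y n t - y' t) \<partial>M)"
      by (intro Bochner_Integration.integral_cong) (auto simp: algebra_simps)
    also have "\<dots> = (\<integral>t. (x n t - x' t) * cnj (y n t - y' t) \<partial>M) + (\<integral>t. (x n t - x' t) * cnj (y' t) \<partial>M)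
        + (\<integral>t. x' t * cnj (y n t - y' t) \<partial>M)"
      using L2_mult_integrable(2)[OF dx dy] L2_mult_integrable(2)[OF dx assms(4)]
        L2_mult_integrable(2)[OF assms(2) dy] by simp
    finally have eq: "(\<integral>t. x n t * cnj (y n t) \<partial>M) - (\<integral>t. x' t * cnj (y' t) \<partial>M) =
        (\<integral>t. (x n t - x' t) * cnj (y n t - y' t) \<partial>M) + (\<integral>t. (x n t - x' t) * cnj (y' t) \<partial>M)
        + (\<integral>t. x' t * cnj (y n t - y' t) \<partial>M)" .
    show "norm ((\<integral>t. x n t * cnj (y n t) \<partial>M) - (\<integral>t. x' t * cnj (y' t) \<partial>M)) \<le>
      ?dx n * ?dy n + ?dx n * L2_norm M y' + L2_norm M x' * ?dy n"
      unfolding eq by (intro norm_triangle_le add_mono L2_Cauchy_Schwarz dx dy assms)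
  qed
qed

lemma suminf_ennreal_finite_imp_bounded:
  assumes "(\<Sum>k. ennreal (g k)) \<noteq> \<infinity>"
  obtains C where "0 \<le> C" "\<And>k. g k \<le> C"
proof
  define S where "S = (\<Sum>k. ennreal (g k))"
  show "0 \<le> enn2real S" by simp
  fix k
  have "ennreal (g k) \<le> S"
    unfolding S_def using sum_le_suminf[OF summableI, of "{k}" "\<lambda>k. ennreal (g k)"] by simp
  also have "S = ennreal (enn2real S)"
    using assms by (simp add: S_def[symmetric] top.not_eq_extremum)
  finally show "g k \<le> enn2real S" by simp
qed

text \<open>
  Along a subsequence with increments of norm at most \<open>2\<^sup>-\<^sup>k\<close>, the squared increments weighted by \<open>2\<^sup>k\<close>
  still have a finite integral, so the increments are almost everywhere dominated by a geometric
  series.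
\<close>

lemma L2_complete:
  assumes x: "\<And>n. x n \<in> L2 M"
    and cauchy: "\<And>e. 0 < e \<Longrightarrow> \<exists>N. \<forall>m\<ge>N. \<forall>n\<ge>N. L2_norm M (\<lambda>t. x m t - x n t) < e"
  obtains y where "y \<in> L2 M" "(\<lambda>n. L2_norm M (\<lambda>t. x n t - y t)) \<longlonglongrightarrow> 0"
proof -
  note [measurable] = L2_measurable[OF x]
  have "\<exists>N. \<forall>m\<ge>N. \<forall>n\<ge>N. L2_norm M (\<lambda>t. x m t - x n t) < (1/2)^k" for k :: nat
    by (rule cauchy) simp
  then obtain N where N: "\<And>k m n. N k \<le> m \<Longrightarrow> N k \<le> n \<Longrightarrow> L2_norm M (\<lambda>t. x m t - x n t) < (1/2)^k"
    by metis
  \<comment> \<open>The summand \<open>k\<close> gives \<open>j \<le> r j\<close>, used for the tail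
    estimate; the sum puts \<open>r k\<close> above every \<open>N i\<close> with
    \<open>i \<le> k\<close>, used for the increments.\<close>
  define r where "r k = k + (\<Sum>i\<le>k. N i)" for k
  have r: "N i \<le> r k" if "i \<le> k" for i k
    using member_le_sum[of i "{..k}" N] that by (simp add: r_def)
  define z where "z k = x (r k)" for k
  have z: "z k \<in> L2 M" for k by (simp add: z_def x)
  note [measurable] = L2_measurable[OF z]
  let ?d = "\<lambda>k t. (cmod (z (Suc k) t - z k t))\<^sup>2"
  have d: "(\<integral>\<^sup>+t. ennreal (2^k * ?d k t) \<partial>M) \<le> ennreal ((1/2)^k)" for k
  proof -
    have "(\<integral>\<^sup>+t. ennreal (2^k * ?d k t) \<partial>M) = ennreal (2^k) * ennreal ((L2_norm M (\<lambda>t. z (Suc k) t - z k t))\<^sup>2)"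
      by (simp add: ennreal_mult nn_integral_cmult nn_integral_cmod_square L2_diff z)
    also have "\<dots> \<le> ennreal (2^k) * ennreal (((1/2)^k)\<^sup>2)"
      using N[OF r r, of k "Suc k" k] by (intro mult_left_mono ennreal_leI power_mono) (auto simp: z_def)
    also have "\<dots> = ennreal ((1/2)^k)"
      by (simp add: ennreal_mult[symmetric] power2_eq_square power_one_over)
    finally show ?thesis .
  qed
  have "(\<integral>\<^sup>+t. (\<Sum>k. ennreal (2^k * ?d k t)) \<partial>M) = (\<Sum>k. \<integral>\<^sup>+t. ennreal (2^k * ?d k t) \<partial>M)"
    by (rule nn_integral_suminf) simp
  also have "\<dots> \<le> (\<Sum>k. ennreal ((1/2)^k))"
    by (intro suminf_le d) auto
  also have "\<dots> < \<infinity>"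
    by (subst suminf_ennreal2) (auto intro: summable_geometric)
  finally have "AE t in M. (\<Sum>k. ennreal (2^k * ?d k t)) \<noteq> \<infinity>"
    by (intro nn_integral_PInf_AE) auto
  then have conv: "AE t in M. convergent (\<lambda>k. z k t)"
  proof eventually_elim
    case (elim t)
    from suminf_ennreal_finite_imp_bounded[OF this]
    obtain C where C0: "0 \<le> C" and C: "\<And>k. 2^k * ?d k t \<le> C" by blast
    have b: "cmod (z (Suc k) t - z k t) \<le> sqrt C * (sqrt (1/2))^k" for k
    proof -
      have "?d k t \<le> C * (1/2)^k"
        using C[of k] unfolding power_one_over by (simp only: pos_le_divide_eq zero_less_power zero_less_numeral times_divide_eq_right mult_1_right mult.commute[of "2^k"])
      then have "cmod (z (Suc k) t - z k t) \<le> sqrt (C * (1/2)^k)"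
        by (rule real_le_rsqrt)
      then show ?thesis unfolding real_sqrt_mult real_sqrt_power .
    qed
    have "summable (\<lambda>k. sqrt C * (sqrt (1/2))^k)"
      by (intro summable_mult summable_geometric) auto
    then have "summable (\<lambda>k. z (Suc k) t - z k t)"
      using b by (rule summable_comparison_test'[where N=0])
    then have "(\<lambda>n. \<Sum>k<n. z (Suc k) t - z k t) \<longlonglongrightarrow> (\<Sum>k. z (Suc k) t - z k t)"
      by (rule summable_LIMSEQ)
    then have "(\<lambda>n. (z n t - z 0 t) + z 0 t) \<longlonglongrightarrow> (\<Sum>k. z (Suc k) t - z k t) + z 0 t"
      by (intro tendsto_add tendsto_const) (subst (asm) sum_lessThan_telescope)
    then show ?case by (auto simp: convergent_def)
  qed
  define y where "y t = lim (\<lambda>k. z k t)" for t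
  have [measurable]: "y \<in> borel_measurable M"
    unfolding y_def by measurable
  \<comment> \<open>Fatou's lemma along the subsequence: the distance to the pointwise limit is at
    most the lower limit of the distances to \<open>z j\<close>.\<close>
  have tail: "(\<integral>\<^sup>+t. ennreal ((cmod (x n t - y t))\<^sup>2) \<partial>M) \<le> ennreal (((1/2)^k)\<^sup>2)" if "N k \<le> n" for n k
  proof -
    have "(\<integral>\<^sup>+t. ennreal ((cmod (x n t - y t))\<^sup>2) \<partial>M) =
        (\<integral>\<^sup>+t. liminf (\<lambda>j. ennreal ((cmod (x n t - z j t))\<^sup>2)) \<partial>M)"
    proof (rule nn_integral_cong_AE)
      show "AE t in M. ennreal ((cmod (x n t - y t))\<^sup>2) = liminf (\<lambda>j. ennreal ((cmod (x n t - z j t))\<^sup>2))"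
        using conv
      proof eventually_elim
        case (elim t)
        then have "(\<lambda>j. z j t) \<longlonglongrightarrow> y t" by (simp add: y_def convergent_LIMSEQ_iff)
        then have "(\<lambda>j. ennreal ((cmod (x n t - z j t))\<^sup>2)) \<longlonglongrightarrow> ennreal ((cmod (x n t - y t))\<^sup>2)"
          by (intro tendsto_intros tendsto_ennrealI)
        then show ?case by (intro lim_imp_Liminf[symmetric]) auto
      qed
    qed
    also have "\<dots> \<le> liminf (\<lambda>j. \<integral>\<^sup>+t. ennreal ((cmod (x n t - z j t))\<^sup>2) \<partial>M)"
      by (rule nn_integral_liminf) auto
    also have "\<dots> \<le> ennreal (((1/2)^k)\<^sup>2)"
    proof (rule Liminf_le)
      show "\<forall>\<^sub>F j in sequentially. (\<integral>\<^sup>+t. ennreal ((cmod (x n t - z j t))\<^sup>2) \<partial>M) \<le> ennreal (((1/2)^k)\<^sup>2)"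
        using eventually_ge_at_top[of "N k"]
      proof eventually_elim
        case (elim j)
        have "N k \<le> r j" using elim by (simp add: r_def)
        then have "L2_norm M (\<lambda>t. x n t - z j t) < (1/2)^k"
          using N that by (simp add: z_def)
        then show ?case
          using nn_integral_cmod_square[OF L2_diff[OF x z], of n j]
          by (auto intro!: ennreal_leI power_mono)
      qed
    qed simp
    finally show ?thesis .
  qed
  have dL2: "(\<lambda>t. x n t - y t) \<in> L2 M" "L2_norm M (\<lambda>t. x n t - y t) \<le> (1/2)^k" if "N k \<le> n" for n k
    using L2I_nn_integral[OF _ tail[OF that]] by auto
  have "(\<lambda>t. x (N 0) t - (x (N 0) t - y t)) \<in> L2 M"
    by (intro L2_diff x dL2(1)[of 0]) simp
  then have "y \<in> L2 M" by simp
  moreover have "(\<lambda>n. L2_norm M (\<lambda>t. x n t - y t)) \<longlonglongrightarrow> 0"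
  proof (rule LIMSEQ_I)
    fix e :: real assume "0 < e"
    then obtain k where k: "(1/2)^k < e"
      using real_arch_pow_inv[of e "1/2"] by auto
    have "norm (L2_norm M (\<lambda>t. x n t - y t) - 0) < e" if "N k \<le> n" for n
      using dL2(2)[OF that] k by simp
    then show "\<exists>no. \<forall>n\<ge>no. norm (L2_norm M (\<lambda>t. x n t - y t) - 0) < e" by blast
  qed
  ultimately show ?thesis by (rule that)
qed


section \<open>Orthogonal projection\<close>

lemma cmod_diff_square: "(cmod (a - b))\<^sup>2 = (cmod a)\<^sup>2 + (cmod b)\<^sup>2 - 2 * Re (b * cnj a)"
  by (simp add: cmod_power2 power2_diff)

lemma L2_norm_diff_square:
  assumes "x \<in> L2 M" "y \<in> L2 M"
  shows "(L2_norm M (\<lambda>t. x t - y t))\<^sup>2 =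
    (L2_norm M x)\<^sup>2 + (L2_norm M y)\<^sup>2 - 2 * Re (\<integral>t. y t * cnj (x t) \<partial>M)"
proof -
  define r where "r t = Re (y t * cnj (x t))" for t
  have r: "integrable M r"
    unfolding r_def[abs_def] by (intro integrable_Re L2_mult_integrable assms)
  have "(L2_norm M (\<lambda>t. x t - y t))\<^sup>2 = (\<integral>t. (cmod (x t))\<^sup>2 + (cmod (y t))\<^sup>2 - 2 * r t \<partial>M)"
    by (simp only: L2_norm_square cmod_diff_square r_def)
  also have "\<dots> = (L2_norm M x)\<^sup>2 + (L2_norm M y)\<^sup>2 - 2 * (\<integral>t. r t \<partial>M)"
    using r by (simp add: L2_norm_square L2_integrable assms)
  also have "(\<integral>t. r t \<partial>M) = Re (\<integral>t. y t * cnj (x t) \<partial>M)"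
    unfolding r_def by (rule integral_Re[OF L2_mult_integrable(2)[OF assms(2,1)]])
  finally show ?thesis .
qed

lemma L2_parallelogram:
  assumes "x \<in> L2 M" "y \<in> L2 M"
  shows "(L2_norm M (\<lambda>t. x t - y t))\<^sup>2 + (L2_norm M (\<lambda>t. x t + y t))\<^sup>2 =
    2 * (L2_norm M x)\<^sup>2 + 2 * (L2_norm M y)\<^sup>2"
proof -
  have "(L2_norm M (\<lambda>t. x t - y t))\<^sup>2 + (L2_norm M (\<lambda>t. x t + y t))\<^sup>2 =
      (\<integral>t. (cmod (x t - y t))\<^sup>2 + (cmod (x t + y t))\<^sup>2 \<partial>M)"
    by (simp add: L2_norm_square L2_integrable L2_diff L2_add assms)
  also have "\<dots> = (\<integral>t. 2 * (cmod (x t))\<^sup>2 + 2 * (cmod (y t))\<^sup>2 \<partial>M)"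
    by (intro Bochner_Integration.integral_cong) (auto simp: cmod_power2 power2_diff power2_sum)
  also have "\<dots> = 2 * (L2_norm M x)\<^sup>2 + 2 * (L2_norm M y)\<^sup>2"
    by (simp add: L2_norm_square L2_integrable assms)
  finally show ?thesis .
qed

section \<open>Closed subspaces and best approximation\<close>

definition complex_subspace :: "('a \<Rightarrow> complex) set \<Rightarrow> bool" where
  "complex_subspace V \<longleftrightarrow> (\<lambda>t. 0) \<in> V \<and> (\<forall>p\<in>V. \<forall>q\<in>V. (\<lambda>t. p t + q t) \<in> V) \<and>
     (\<forall>c. \<forall>p\<in>V. (\<lambda>t. c * p t) \<in> V)"

definition L2_closure :: "'a measure \<Rightarrow> ('a \<Rightarrow> complex) set \<Rightarrow> ('a \<Rightarrow> complex) set" where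
  "L2_closure M V = {h \<in> L2 M. \<forall>e>0. \<exists>q\<in>V. L2_norm M (\<lambda>t. h t - q t) < e}"

lemma L2_closure_subset: "L2_closure M V \<subseteq> L2 M"
  by (auto simp: L2_closure_def)

lemma L2_closure_sequence:
  assumes "h \<in> L2_closure M V"
  obtains q where "\<And>n. q n \<in> V" "(\<lambda>n. L2_norm M (\<lambda>t. q n t - h t)) \<longlonglongrightarrow> 0"
proof -
  have "\<forall>n. \<exists>q\<in>V. L2_norm M (\<lambda>t. h t - q t) < inverse (real (Suc n))"
    using assms by (simp add: L2_closure_def del: of_nat_Suc)
  then obtain q where q: "\<And>n. q n \<in> V" "\<And>n. L2_norm M (\<lambda>t. h t - q n t) < inverse (real (Suc n))"
    by metis
  have "(\<lambda>n. L2_norm M (\<lambda>t. q n t - h t)) \<longlonglongrightarrow> 0"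
  proof (rule Lim_null_comparison[OF _ LIMSEQ_inverse_real_of_nat])
    show "\<forall>\<^sub>F n in sequentially. norm (L2_norm M (\<lambda>t. q n t - h t)) \<le> inverse (real (Suc n))"
      using q(2) by (auto simp: L2_norm_minus_commute[of _ "q _"] intro!: always_eventually less_imp_le)
  qed
  with q(1) show ?thesis by (rule that)
qed

lemma L2_closureI_sequence:
  assumes "h \<in> L2 M" "\<And>n. q n \<in> V" "(\<lambda>n. L2_norm M (\<lambda>t. q n t - h t)) \<longlonglongrightarrow> 0"
  shows "h \<in> L2_closure M V"
  unfolding L2_closure_def
proof (intro CollectI conjI allI impI assms(1))
  fix e :: real assume "0 < e"
  then obtain n where "L2_norm M (\<lambda>t. q n t - h t) < e"
    using order_tendstoD(2)[OF assms(3)] by (auto simp: eventually_sequentially)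
  then show "\<exists>q\<in>V. L2_norm M (\<lambda>t. h t - q t) < e"
    using assms(2) by (auto simp: L2_norm_minus_commute[of _ h])
qed

text \<open>One summand may stay in \<open>V\<close>: the variational argument for the projection
  perturbs the minimizer only in directions of \<open>V\<close>.\<close>

lemma L2_closure_add:
  assumes V: "complex_subspace V" "V \<subseteq> L2 M" and h: "h \<in> L2_closure M V" and p: "p \<in> V"
  shows "(\<lambda>t. h t + p t) \<in> L2_closure M V"
proof -
  obtain q where q: "\<And>n. q n \<in> V" "(\<lambda>n. L2_norm M (\<lambda>t. q n t - h t)) \<longlonglongrightarrow> 0"
    using L2_closure_sequence[OF h] by blast
  show ?thesis
  proof (rule L2_closureI_sequence)
    show "(\<lambda>t. h t + p t) \<in> L2 M"
      using V p h L2_closure_subset by (intro L2_add) auto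
    show "(\<lambda>t. q n t + p t) \<in> V" for n
      using V(1) q(1) p by (auto simp: complex_subspace_def)
    show "(\<lambda>n. L2_norm M (\<lambda>t. (q n t + p t) - (h t + p t))) \<longlonglongrightarrow> 0"
      using q(2) by simp
  qed
qed

lemma L2_closure_orthogonal:
  assumes V: "V \<subseteq> L2 M" and phi: "\<phi> \<in> L2 M" and orth: "\<And>q. q \<in> V \<Longrightarrow> (\<integral>t. q t * cnj (\<phi> t) \<partial>M) = 0"
    and h: "h \<in> L2_closure M V"
  shows "(\<integral>t. h t * cnj (\<phi> t) \<partial>M) = 0"
proof -
  obtain q where q: "\<And>n. q n \<in> V" "(\<lambda>n. L2_norm M (\<lambda>t. q n t - h t)) \<longlonglongrightarrow> 0"
    using L2_closure_sequence[OF h] by blast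
  have "(\<lambda>n. \<integral>t. q n t * cnj (\<phi> t) \<partial>M) \<longlonglongrightarrow> (\<integral>t. h t * cnj (\<phi> t) \<partial>M)"
    by (rule L2_inner_tendsto)
       (use q V phi subsetD[OF L2_closure_subset h] in \<open>auto simp: L2_norm_def\<close>)
  moreover have "(\<lambda>n. \<integral>t. q n t * cnj (\<phi> t) \<partial>M) = (\<lambda>n. 0)"
    using orth q(1) by simp
  ultimately show ?thesis
    using LIMSEQ_unique[OF tendsto_const] by metis
qed

text \<open>A minimizing sequence is taken in \<open>V\<close> itself. Midpoints of its members stay
  in \<open>V\<close>, hence at distance at least \<open>d\<close> from \<open>v\<close>, and the
  parallelogram law then makes the sequence Cauchy. That no element of the closure comes closer than
  \<open>d\<close> follows by approximating it from \<open>V\<close>.\<close>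

lemma L2_closure_best_approximation:
  assumes V: "complex_subspace V" "V \<subseteq> L2 M" and v: "v \<in> L2 M"
  obtains p where "p \<in> L2_closure M V"
    "\<And>h. h \<in> L2_closure M V \<Longrightarrow> L2_norm M (\<lambda>t. v t - p t) \<le> L2_norm M (\<lambda>t. v t - h t)"
proof -
  let ?dist = "\<lambda>q. L2_norm M (\<lambda>t. v t - q t)"
  define d where "d = (INF q\<in>V. ?dist q)"
  have V0: "V \<noteq> {}" using V by (auto simp: complex_subspace_def)
  have bdd: "bdd_below (?dist ` V)" by (rule bdd_belowI[where m=0]) auto
  have d_le: "d \<le> ?dist q" if "q \<in> V" for q
    unfolding d_def using bdd that by (rule cINF_lower)
  have d0: "0 \<le> d" unfolding d_def using V0 by (intro cINF_greatest) auto
  have "\<exists>q\<in>V. ?dist q < d + inverse (real (Suc n))" for n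
    using cINF_less_iff[OF V0 bdd, of "d + inverse (real (Suc n))"] by (simp add: d_def)
  then obtain q where q: "\<And>n. q n \<in> V" and qd: "\<And>n. ?dist (q n) < d + inverse (real (Suc n))"
    by metis
  have qL2: "q n \<in> L2 M" for n using q V by auto
  have par: "(L2_norm M (\<lambda>t. q m t - q n t))\<^sup>2 \<le> 2 * ((?dist (q m))\<^sup>2 - d\<^sup>2) + 2 * ((?dist (q n))\<^sup>2 - d\<^sup>2)" for m n
  proof -
    let ?x = "\<lambda>t. v t - q n t" and ?y = "\<lambda>t. v t - q m t"
    have "(L2_norm M (\<lambda>t. ?x t - ?y t))\<^sup>2 + (L2_norm M (\<lambda>t. ?x t + ?y t))\<^sup>2
        = 2 * (L2_norm M ?x)\<^sup>2 + 2 * (L2_norm M ?y)\<^sup>2"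
      by (intro L2_parallelogram L2_diff v qL2)
    moreover have "(L2_norm M (\<lambda>t. ?x t + ?y t))\<^sup>2 = 4 * (?dist (\<lambda>t. (1/2) * (q n t + q m t)))\<^sup>2"
    proof -
      have "(cmod (?x t + ?y t))\<^sup>2 = 4 * (cmod (v t - (1/2) * (q n t + q m t)))\<^sup>2" for t
      proof -
        have "?x t + ?y t = 2 * (v t - (1/2) * (q n t + q m t))" by (simp add: field_simps)
        then show ?thesis by (simp only: norm_mult power_mult_distrib) simp
      qed
      then show ?thesis by (simp only: L2_norm_square integral_mult_right_zero)
    qed
    moreover have "d\<^sup>2 \<le> (?dist (\<lambda>t. (1/2) * (q n t + q m t)))\<^sup>2"
    proof (intro power_mono d_le d0)
      have sum: "(\<lambda>t. q n t + q m t) \<in> V"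
        using V(1) q unfolding complex_subspace_def by blast
      have scale: "\<And>c p. p \<in> V \<Longrightarrow> (\<lambda>t. c * p t) \<in> V"
        using V(1) unfolding complex_subspace_def by blast
      show "(\<lambda>t. (1/2) * (q n t + q m t)) \<in> V"
        by (rule scale[OF sum])
    qed
    ultimately show ?thesis by simp
  qed
  have sq: "(\<lambda>n. (?dist (q n))\<^sup>2 - d\<^sup>2) \<longlonglongrightarrow> 0"
  proof -
    have "(\<lambda>n. ?dist (q n)) \<longlonglongrightarrow> d"
    proof (rule tendsto_sandwich)
      show "\<forall>\<^sub>F n in sequentially. d \<le> ?dist (q n)"
        using d_le[OF q] by simp
      show "\<forall>\<^sub>F n in sequentially. ?dist (q n) \<le> d + inverse (real (Suc n))"
        by (intro always_eventually allI less_imp_le qd)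
      show "(\<lambda>n. d + inverse (real (Suc n))) \<longlonglongrightarrow> d"
        using tendsto_add[OF tendsto_const LIMSEQ_inverse_real_of_nat] by simp
    qed simp
    then show ?thesis by (auto intro!: tendsto_eq_intros)
  qed
  obtain p where p: "p \<in> L2 M" "(\<lambda>n. L2_norm M (\<lambda>t. q n t - p t)) \<longlonglongrightarrow> 0"
  proof (rule L2_complete[OF qL2])
    fix e :: real assume "0 < e"
    \<comment> \<open>By \<open>par\<close> the squared distance is at most twice each of two
      defects, so a quarter of \<open>e\<close> squared for each suffices.\<close>
    then have "\<forall>\<^sub>F n in sequentially. (?dist (q n))\<^sup>2 - d\<^sup>2 < e\<^sup>2 / 4"
      by (intro order_tendstoD[OF sq]) auto
    then obtain N where N: "\<And>n. N \<le> n \<Longrightarrow> (?dist (q n))\<^sup>2 - d\<^sup>2 < e\<^sup>2 / 4"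
      by (auto simp: eventually_sequentially)
    have "L2_norm M (\<lambda>t. q m t - q n t) < e" if "N \<le> m" "N \<le> n" for m n
    proof (rule power_less_imp_less_base)
      show "(L2_norm M (\<lambda>t. q m t - q n t))\<^sup>2 < e\<^sup>2"
      proof -
        have less: "z < c" if "z \<le> 2 * a + 2 * b" "a < c / 4" "b < c / 4" for z a b c :: real
          using that by linarith
        show ?thesis by (rule less[OF par N N]) (use that in auto)
      qed
    qed (use \<open>0 < e\<close> in simp)
    then show "\<exists>N. \<forall>m\<ge>N. \<forall>n\<ge>N. L2_norm M (\<lambda>t. q m t - q n t) < e" by blast
  qed
  show ?thesis
  proof (rule that)
    show "p \<in> L2_closure M V" by (rule L2_closureI_sequence[OF p(1) q p(2)])
    have pd: "?dist p \<le> d"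
    proof (rule LIMSEQ_le_const)
      show "(\<lambda>n. d + inverse (real (Suc n)) + L2_norm M (\<lambda>t. q n t - p t)) \<longlonglongrightarrow> d"
        using tendsto_add[OF tendsto_add[OF tendsto_const LIMSEQ_inverse_real_of_nat] p(2)] by simp
      have "?dist p \<le> d + inverse (real (Suc n)) + L2_norm M (\<lambda>t. q n t - p t)" for n
        by (rule order_trans[OF L2_norm_triangle_diff[OF v qL2 p(1)] add_right_mono[OF less_imp_le[OF qd]]])
      then show "\<exists>N. \<forall>n\<ge>N. ?dist p \<le> d + inverse (real (Suc n)) + L2_norm M (\<lambda>t. q n t - p t)"
        by blast
    qed
    fix h assume h: "h \<in> L2_closure M V"
    then obtain r where r: "\<And>n. r n \<in> V" "(\<lambda>n. L2_norm M (\<lambda>t. r n t - h t)) \<longlonglongrightarrow> 0"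
      by (rule L2_closure_sequence) blast
    have hL2: "h \<in> L2 M" using h L2_closure_subset by auto
    have rL2: "r n \<in> L2 M" for n using r V by auto
    have "d \<le> ?dist h"
    proof (rule LIMSEQ_le_const)
      show "(\<lambda>n. ?dist h + L2_norm M (\<lambda>t. r n t - h t)) \<longlonglongrightarrow> ?dist h"
        using tendsto_add[OF tendsto_const r(2)] by simp
      have "d \<le> ?dist h + L2_norm M (\<lambda>t. r n t - h t)" for n
        using order_trans[OF d_le[OF r(1)] L2_norm_triangle_diff[OF v hL2 rL2]]
        by (simp add: L2_norm_minus_commute[of _ h])
      then show "\<exists>N. \<forall>n\<ge>N. d \<le> ?dist h + L2_norm M (\<lambda>t. r n t - h t)"
        by blast
    qed
    with pd show "?dist p \<le> ?dist h" by simp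
  qed
qed

text \<open>With \<open>p\<close> the best approximation of \<open>h\<close>, the residual
  \<open>h - p\<close> is orthogonal to \<open>V\<close>, hence to \<open>p\<close>; the hypothesis
  makes it orthogonal to \<open>h\<close> as well, so it is orthogonal to itself and has norm 0.
  Membership is thereby reduced to a statement about annihilators.\<close>

lemma L2_closureI_orthogonal:
  assumes V: "complex_subspace V" "V \<subseteq> L2 M" and h: "h \<in> L2 M"
    and orth: "\<And>\<phi>. \<phi> \<in> L2 M \<Longrightarrow> (\<And>q. q \<in> V \<Longrightarrow> (\<integral>t. q t * cnj (\<phi> t) \<partial>M) = 0) \<Longrightarrow>
      (\<integral>t. h t * cnj (\<phi> t) \<partial>M) = 0"
  shows "h \<in> L2_closure M V"
proof -
  obtain p where p: "p \<in> L2_closure M V"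
    and min: "\<And>k. k \<in> L2_closure M V \<Longrightarrow> L2_norm M (\<lambda>t. h t - p t) \<le> L2_norm M (\<lambda>t. h t - k t)"
    using L2_closure_best_approximation[OF V h] by blast
  have pL2: "p \<in> L2 M" using p L2_closure_subset by auto
  define \<phi> where "\<phi> t = h t - p t" for t
  have phi: "\<phi> \<in> L2 M" unfolding \<phi>_def by (intro L2_diff h pL2)
  have orth_V: "(\<integral>t. q t * cnj (\<phi> t) \<partial>M) = 0" if q: "q \<in> V" for q
  proof (rule ccontr)
    define I where "I = (\<integral>t. q t * cnj (\<phi> t) \<partial>M)"
    assume "(\<integral>t. q t * cnj (\<phi> t) \<partial>M) \<noteq> 0"
    then have I: "0 < (cmod I)\<^sup>2" by (simp add: I_def)
    have qL2: "q \<in> L2 M" using q V by auto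
    define Q where "Q = (L2_norm M q)\<^sup>2"
    \<comment> \<open>Any positive \<open>s\<close> with \<open>s * Q \<le> 1\<close> works: the
      quadratic term of the perturbed norm is then at most half of the linear one. The summand 1
      keeps the quotient meaningful when \<open>q\<close> has norm 0.\<close>
    define s where "s = 1 / (Q + 1)"
    have Q0: "0 \<le> Q" by (simp add: Q_def)
    then have s: "0 < s" "s * Q \<le> 1" by (simp_all add: s_def field_simps)
    \<comment> \<open>The conjugate turns \<open>c * I\<close> into a nonnegative real, so that the
      first-order change of the norm has full size.\<close>
    define c where "c = of_real s * cnj I"
    have "c * I = of_real (s * (cmod I)\<^sup>2)"
      unfolding of_real_mult complex_norm_square by (simp add: c_def mult_ac)
    then have c: "(cmod c)\<^sup>2 = s\<^sup>2 * (cmod I)\<^sup>2" "Re (c * I) = s * (cmod I)\<^sup>2"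
      by (simp_all only: Re_complex_of_real) (simp add: c_def norm_mult power_mult_distrib)
    have cq: "(\<lambda>t. c * q t) \<in> V" using V(1) q by (auto simp: complex_subspace_def)
    then have cqL2: "(\<lambda>t. c * q t) \<in> L2 M" using V by auto
    have "L2_norm M \<phi> \<le> L2_norm M (\<lambda>t. h t - (p t + c * q t))"
      unfolding \<phi>_def by (intro min L2_closure_add V p cq)
    then have "(L2_norm M \<phi>)\<^sup>2 \<le> (L2_norm M (\<lambda>t. \<phi> t - c * q t))\<^sup>2"
      by (intro power_mono) (simp_all add: \<phi>_def diff_diff_eq)
    also have "\<dots> = (L2_norm M \<phi>)\<^sup>2 + (L2_norm M (\<lambda>t. c * q t))\<^sup>2 - 2 * Re (\<integral>t. c * q t * cnj (\<phi> t) \<partial>M)"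
      by (rule L2_norm_diff_square[OF phi cqL2])
    also have "(L2_norm M (\<lambda>t. c * q t))\<^sup>2 = (cmod c)\<^sup>2 * Q"
      by (simp add: L2_norm_square Q_def norm_mult power_mult_distrib)
    also have "(\<integral>t. c * q t * cnj (\<phi> t) \<partial>M) = c * I"
      by (simp add: I_def mult.assoc)
    finally have "2 * (s * (cmod I)\<^sup>2) \<le> s\<^sup>2 * (cmod I)\<^sup>2 * Q"
      unfolding c by simp
    then have "2 * (s * (cmod I)\<^sup>2) \<le> (s * Q) * (s * (cmod I)\<^sup>2)"
      by (simp add: power2_eq_square mult_ac)
    also have "\<dots> \<le> 1 * (s * (cmod I)\<^sup>2)"
      using s I by (intro mult_right_mono) auto
    finally show False using s I by (simp add: mult_le_0_iff)
  qed
  have "(\<integral>t. h t * cnj (\<phi> t) \<partial>M) = 0" by (rule orth[OF phi orth_V])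
  moreover have "(\<integral>t. p t * cnj (\<phi> t) \<partial>M) = 0"
    by (rule L2_closure_orthogonal[OF V(2) phi orth_V p])
  ultimately have "(\<integral>t. \<phi> t * cnj (\<phi> t) \<partial>M) = 0"
    using L2_mult_integrable(2)[OF h phi] L2_mult_integrable(2)[OF pL2 phi]
    by (simp add: \<phi>_def left_diff_distrib)
  then have "complex_of_real ((L2_norm M \<phi>)\<^sup>2) = 0"
    by (simp only: L2_norm_square complex_norm_square flip: integral_complex_of_real)
  then have "L2_norm M (\<lambda>t. h t - p t) = 0" by (simp add: \<phi>_def[abs_def])
  \<comment> \<open>\<open>h\<close> and \<open>p\<close> agree only almost everywhere, so
    \<open>h\<close> itself is exhibited as the limit of a sequence converging to
    \<open>p\<close>.\<close>
  moreover obtain r where r: "\<And>n. r n \<in> V" "(\<lambda>n. L2_norm M (\<lambda>t. r n t - p t)) \<longlonglongrightarrow> 0"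
    using L2_closure_sequence[OF p] by blast
  moreover have "r n \<in> L2 M" for n using r V by auto
  ultimately have le: "L2_norm M (\<lambda>t. r n t - h t) \<le> L2_norm M (\<lambda>t. r n t - p t)" for n
    using L2_norm_triangle_diff[of "r n" M p h] pL2 h by (simp add: L2_norm_minus_commute[of _ p])
  have "(\<lambda>n. L2_norm M (\<lambda>t. r n t - h t)) \<longlonglongrightarrow> 0"
    by (rule Lim_null_comparison[OF _ r(2)]) (use le in \<open>auto intro!: always_eventually\<close>)
  with h r(1) show ?thesis by (rule L2_closureI_sequence)
qed

section \<open>Trigonometric polynomials with frequencies in a given set\<close>

definition trig_polys :: "real set \<Rightarrow> (real \<Rightarrow> complex) set" where
  "trig_polys U = {\<lambda>\<omega>. \<Sum>t\<in>F. c t * cis (t * \<omega>) | F c. finite F \<and> F \<subseteq> U}"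

lemma complex_subspace_trig_polys: "complex_subspace (trig_polys U)"
  unfolding complex_subspace_def
proof (intro conjI ballI allI)
  show "(\<lambda>t. 0) \<in> trig_polys U"
    unfolding trig_polys_def by (intro CollectI exI[of _ "{}"]) auto
next
  fix p q assume "p \<in> trig_polys U" "q \<in> trig_polys U"
  then obtain F c G d where F: "finite F" "F \<subseteq> U" "p = (\<lambda>\<omega>. \<Sum>t\<in>F. c t * cis (t * \<omega>))"
    and G: "finite G" "G \<subseteq> U" "q = (\<lambda>\<omega>. \<Sum>t\<in>G. d t * cis (t * \<omega>))"
    by (auto simp: trig_polys_def)
  let ?c = "\<lambda>t. (if t \<in> F then c t else 0) + (if t \<in> G then d t else 0)"
  have "p \<omega> + q \<omega> = (\<Sum>t\<in>F \<union> G. ?c t * cis (t * \<omega>))" for \<omega>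
  proof -
    have "(\<Sum>t\<in>F. c t * cis (t * \<omega>)) = (\<Sum>t\<in>F \<union> G. (if t \<in> F then c t else 0) * cis (t * \<omega>))"
      by (rule sum.mono_neutral_cong_left) (use F G in auto)
    moreover have "(\<Sum>t\<in>G. d t * cis (t * \<omega>)) = (\<Sum>t\<in>F \<union> G. (if t \<in> G then d t else 0) * cis (t * \<omega>))"
      by (rule sum.mono_neutral_cong_left) (use F G in auto)
    ultimately show ?thesis by (simp add: F(3) G(3) distrib_right sum.distrib)
  qed
  then show "(\<lambda>t. p t + q t) \<in> trig_polys U"
    unfolding trig_polys_def using F G by (intro CollectI exI[of _ "F \<union> G"] exI[of _ ?c]) auto
next
  fix a p assume "p \<in> trig_polys U"
  then obtain F c where F: "finite F" "F \<subseteq> U" "p = (\<lambda>\<omega>. \<Sum>t\<in>F. c t * cis (t * \<omega>))"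
    by (auto simp: trig_polys_def)
  then show "(\<lambda>t. a * p t) \<in> trig_polys U"
    unfolding trig_polys_def
    by (intro CollectI exI[of _ F] exI[of _ "\<lambda>t. a * c t"]) (auto simp: sum_distrib_left mult.assoc)
qed

lemma cis_in_trig_polys: "t \<in> U \<Longrightarrow> (\<lambda>\<omega>. cis (t * \<omega>)) \<in> trig_polys U"
  unfolding trig_polys_def by (intro CollectI exI[of _ "{t}"] exI[of _ "\<lambda>_. 1"]) auto

lemma borel_measurable_cis [measurable (raw)]:
  "f \<in> borel_measurable M \<Longrightarrow> (\<lambda>x. cis (f x)) \<in> borel_measurable M"
  by (intro borel_measurable_continuous_on[where f=cis] continuous_intros)

lemma L2_bounded_finite_measure:
  assumes "finite_measure M" "m \<in> borel_measurable M" "AE t in M. cmod (m t) \<le> c"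
  shows "m \<in> L2 M"
proof -
  have "(\<lambda>t. m t * 1) \<in> L2 M"
    by (rule L2_bounded_mult[OF _ assms(2,3)])
       (use finite_measure.integrable_const[OF assms(1)] in \<open>auto simp: L2_def\<close>)
  then show ?thesis by simp
qed

lemma trig_polys_subset_L2:
  assumes "finite_measure M" "sets M = sets borel"
  shows "trig_polys U \<subseteq> L2 M"
proof -
  have "(\<lambda>\<omega>. cis (t * \<omega>)) \<in> L2 M" for t
  proof (rule L2_bounded_finite_measure[OF assms(1)])
    have "(\<lambda>\<omega>. cis (t * \<omega>)) \<in> borel_measurable borel" by measurable
    then show "(\<lambda>\<omega>. cis (t * \<omega>)) \<in> borel_measurable M"
      using measurable_cong_sets[OF assms(2) refl] by blast
    show "AE \<omega> in M. cmod (cis (t * \<omega>)) \<le> 1" by simp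
  qed
  then show ?thesis by (auto simp: trig_polys_def intro!: L2_sum L2_cmult)
qed

text \<open>\<open>L2s\<close> bounds the square of the norm and the closure bounds the norm; since
  the bound ranges over all positive reals, passing to its square or its root identifies the
  two.\<close>

lemma L2s_eq_closure: "L2s U f g = L2_closure (spectral_measure f g) (trig_polys U)"
proof -
  let ?M = "spectral_measure f g"
  have "(\<forall>e>0. \<exists>F c. finite F \<and> F \<subseteq> U \<and>
       (\<integral>\<omega>. (cmod (h \<omega> - (\<Sum>t\<in>F. c t * cis (t * \<omega>))))\<^sup>2 \<partial>?M) < e) \<longleftrightarrow>
     (\<forall>e>0. \<exists>q\<in>trig_polys U. L2_norm ?M (\<lambda>t. h t - q t) < e)" (is "?L \<longleftrightarrow> ?R") for h
  proof -
    have "?L \<longleftrightarrow> (\<forall>e>0. \<exists>q\<in>trig_polys U. (L2_norm ?M (\<lambda>t. h t - q t))\<^sup>2 < e)"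
      unfolding L2_norm_square trig_polys_def by (fastforce simp: Bex_def)
    also have "\<dots> \<longleftrightarrow> ?R"
    proof safe
      fix e :: real assume "\<forall>e>0. \<exists>q\<in>trig_polys U. (L2_norm ?M (\<lambda>t. h t - q t))\<^sup>2 < e" "0 < e"
      then obtain q where "q \<in> trig_polys U" "(L2_norm ?M (\<lambda>t. h t - q t))\<^sup>2 < e\<^sup>2"
        by (meson zero_less_power)
      then show "\<exists>q\<in>trig_polys U. L2_norm ?M (\<lambda>t. h t - q t) < e"
        using \<open>0 < e\<close> by (meson less_imp_le power_less_imp_less_base)
    next
      fix e :: real assume "?R" "0 < e"
      then obtain q where "q \<in> trig_polys U" "L2_norm ?M (\<lambda>t. h t - q t) < sqrt e"
        by (meson real_sqrt_gt_zero)
      then show "\<exists>q\<in>trig_polys U. (L2_norm ?M (\<lambda>t. h t - q t))\<^sup>2 < e"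
        using \<open>0 < e\<close> by (metis L2_norm_nonneg less_imp_le real_less_rsqrt real_sqrt_less_iff real_sqrt_unique)
    qed
    finally show ?thesis .
  qed
  then show ?thesis by (simp add: L2s_def L2_closure_def)
qed


section \<open>The Fourier transform of integrable functions\<close>

text \<open>Sign and normalization agree with \<open>fourier\<close>: without a factor in front,
  norms grow by at most \<open>sqrt (2 * pi)\<close> and a double transform carries
  \<open>2 * pi\<close>.\<close>

definition FT :: "(real \<Rightarrow> complex) \<Rightarrow> real \<Rightarrow> complex" where
  "FT x \<omega> = (\<integral>u. x u * cis (u * \<omega>) \<partial>lborel)"

lemma FT_measurable [measurable (raw)]:
  assumes [measurable]: "x \<in> borel_measurable borel" "f \<in> borel_measurable M"
  shows "(\<lambda>\<omega>. FT x (f \<omega>)) \<in> borel_measurable M"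
proof -
  have "FT x \<in> borel_measurable borel" unfolding FT_def[abs_def] by measurable
  then show ?thesis using assms(2) by measurable
qed

lemma integrable_mult_bounded:
  fixes x :: "'a \<Rightarrow> complex"
  assumes x: "integrable M x" and [measurable]: "m \<in> borel_measurable M"
    and b: "AE t in M. cmod (m t) \<le> c"
  shows "integrable M (\<lambda>t. x t * m t)"
proof -
  note [measurable] = borel_measurable_integrable[OF x]
  show ?thesis
  proof (rule Bochner_Integration.integrable_bound[where f="\<lambda>t. c * cmod (x t)"])
    show "AE t in M. norm (x t * m t) \<le> norm (c * cmod (x t))"
      using b
    proof eventually_elim
      case (elim t)
      then have "norm (x t * m t) \<le> c * cmod (x t)"
        by (simp add: norm_mult mult.commute mult_right_mono)
      then show ?case by simp
    qed
  qed (use x in auto)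
qed

text \<open>Integrability is not presupposed, because the Bochner integral of a non-integrable
  function is 0.\<close>

lemma norm_integral_le_nn_integral:
  fixes f :: "'a \<Rightarrow> 'b::{banach, second_countable_topology}"
  shows "ennreal (norm (\<integral>t. f t \<partial>M)) \<le> (\<integral>\<^sup>+t. ennreal (norm (f t)) \<partial>M)"
  by (cases "integrable M f") (auto intro: integral_norm_bound_ennreal simp: not_integrable_integral_eq)

lemma integrable_cis: "integrable lborel x \<Longrightarrow> integrable lborel (\<lambda>u. x u * cis (u * \<omega>))"
  by (rule integrable_mult_bounded[where c=1]) auto

lemma FT_bound: "cmod (FT x \<omega>) \<le> (\<integral>u. cmod (x u) \<partial>lborel)"
  unfolding FT_def using integral_norm_bound[of lborel "\<lambda>u. x u * cis (u * \<omega>)"]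
  by (simp add: norm_mult)

lemma FT_diff:
  assumes "integrable lborel x" "integrable lborel y"
  shows "FT (\<lambda>u. x u - y u) \<omega> = FT x \<omega> - FT y \<omega>"
  unfolding FT_def using integrable_cis[OF assms(1)] integrable_cis[OF assms(2)]
  by (simp add: left_diff_distrib)

text \<open>Turns an inner product of transforms into a plain product of transforms, to which the
  multiplication formula applies.\<close>

lemma cnj_FT: "cnj (FT x \<omega>) = FT (\<lambda>u. cnj (x (- u))) \<omega>"
proof -
  have "cnj (FT x \<omega>) = (\<integral>u. cnj (x u) * cis (- (u * \<omega>)) \<partial>lborel)"
    unfolding FT_def Bochner_Integration.integral_cnj[symmetric] by (simp add: cis_cnj)
  also have "\<dots> = FT (\<lambda>u. cnj (x (- u))) \<omega>"
    unfolding FT_def by (subst lborel_integral_real_affine[where c="-1" and t=0]) auto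
  finally show ?thesis .
qed

lemma integrable_pair_product:
  fixes x y :: "real \<Rightarrow> complex"
  assumes "integrable lborel x" "integrable lborel y"
  shows "integrable (lborel \<Otimes>\<^sub>M lborel) (\<lambda>(u, v). x u * y v)"
proof -
  note [measurable] = borel_measurable_integrable[OF assms(1)] borel_measurable_integrable[OF assms(2)]
  show ?thesis
  proof (rule lborel_pair.Fubini_integrable)
    show "integrable lborel (\<lambda>u. \<integral>v. norm (case (u, v) of (u, v) \<Rightarrow> x u * y v) \<partial>lborel)"
      using assms by (simp add: norm_mult)
    show "AE u in lborel. integrable lborel (\<lambda>v. case (u, v) of (u, v) \<Rightarrow> x u * y v)"
      using assms by simp
  qed measurable
qed

lemma integrable_pair_bounded:
  fixes x y :: "real \<Rightarrow> complex"
  assumes "integrable lborel x" "integrable lborel y"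
    and [measurable]: "(\<lambda>(u, v). k u v) \<in> borel_measurable (lborel \<Otimes>\<^sub>M lborel)"
    and k: "\<And>u v. cmod (k u v) \<le> c"
  shows "integrable (lborel \<Otimes>\<^sub>M lborel) (\<lambda>(u, v). x u * y v * k u v)"
  using integrable_mult_bounded[OF integrable_pair_product[OF assms(1,2)] assms(3), of c] k
  by (simp add: case_prod_beta')

text \<open>Fubini's theorem; the kernel is bounded and symmetric in its two variables.\<close>

lemma FT_multiplication:
  assumes "integrable lborel x" "integrable lborel y"
  shows "(\<integral>\<omega>. FT x \<omega> * y \<omega> \<partial>lborel) = (\<integral>u. x u * FT y u \<partial>lborel)"
proof -
  have "integrable (lborel \<Otimes>\<^sub>M lborel) (\<lambda>(u, \<omega>). x u * y \<omega> * cis (u * \<omega>))"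
    by (rule integrable_pair_bounded[OF assms, where c=1]) auto
  from lborel_pair.Fubini_integral[OF this]
  have "(\<integral>\<omega>. \<integral>u. y \<omega> * (x u * cis (u * \<omega>)) \<partial>lborel \<partial>lborel) = (\<integral>u. \<integral>\<omega>. x u * (y \<omega> * cis (\<omega> * u)) \<partial>lborel \<partial>lborel)"
    by (simp add: mult_ac)
  then show ?thesis by (simp add: FT_def mult.commute)
qed

text \<open>Normalized to be 1 at the origin, not to have integral 1: as \<open>\<epsilon>\<close>
  tends to 0 it increases to the constant 1 and serves as a summability factor. Its width is
  \<open>1 / \<epsilon>\<close>, so that its transform is concentrated at scale
  \<open>\<epsilon>\<close>.\<close>

definition gauss :: "real \<Rightarrow> real \<Rightarrow> complex" where
  "gauss \<epsilon> t = of_real (exp (- (\<epsilon> * t)\<^sup>2 / 2))"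

lemma gauss_measurable [measurable]: "gauss \<epsilon> \<in> borel_measurable borel"
  unfolding gauss_def[abs_def] by measurable

lemma gauss_bound: "cmod (gauss \<epsilon> t) \<le> 1"
  by (simp add: gauss_def)

lemma gauss_eq_normal_density:
  assumes "\<epsilon> > 0"
  shows "gauss \<epsilon> t = of_real (sqrt (2 * pi) / \<epsilon> * normal_density 0 (1 / \<epsilon>) t)"
proof -
  have "sqrt (2 * pi * (1/\<epsilon>)\<^sup>2) = sqrt (2 * pi) / \<epsilon>"
    using assms by (simp add: real_sqrt_mult real_sqrt_divide power_divide)
  then show ?thesis
    using assms by (simp add: gauss_def normal_density_def power_mult_distrib power_divide field_simps)
qed

lemma integrable_gauss:
  assumes "\<epsilon> > 0"
  shows "integrable lborel (gauss \<epsilon>)"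
  unfolding gauss_eq_normal_density[OF assms, abs_def]
  using assms by (intro integrable_of_real integrable_mult_right) auto

text \<open>Obtained by scaling from the characteristic function of the standard normal
  distribution.\<close>

lemma FT_gauss:
  assumes "\<epsilon> > 0"
  shows "FT (gauss \<epsilon>) \<omega> = of_real (2 * pi * normal_density 0 \<epsilon> \<omega>)"
proof -
  have "complex_of_real (exp (- (\<omega> / \<epsilon>)\<^sup>2 / 2)) = char std_normal_distribution (\<omega> / \<epsilon>)"
    by (simp add: char_std_normal_distribution)
  also have "\<dots> = (\<integral>x. std_normal_density x *\<^sub>R cis (\<omega> / \<epsilon> * x) \<partial>lborel)"
    unfolding char_def by (subst integral_density) (auto simp: cis_conv_exp)
  also have "\<dots> = \<epsilon> *\<^sub>R (\<integral>x. std_normal_density (\<epsilon> * x) *\<^sub>R cis (\<omega> * x) \<partial>lborel)"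
    using assms by (subst lborel_integral_real_affine[where c=\<epsilon> and t=0]) auto
  also have "(\<integral>x. std_normal_density (\<epsilon> * x) *\<^sub>R cis (\<omega> * x) \<partial>lborel) =
      (\<integral>x. of_real (1 / sqrt (2 * pi)) * (gauss \<epsilon> x * cis (x * \<omega>)) \<partial>lborel)"
    by (intro Bochner_Integration.integral_cong)
       (auto simp: std_normal_density_def gauss_def scaleR_conv_of_real mult_ac)
  also have "\<dots> = of_real (1 / sqrt (2 * pi)) * FT (gauss \<epsilon>) \<omega>"
    by (simp add: FT_def)
  finally have "complex_of_real (exp (- (\<omega> / \<epsilon>)\<^sup>2 / 2)) = of_real (\<epsilon> / sqrt (2 * pi)) * FT (gauss \<epsilon>) \<omega>"
    by (simp add: scaleR_conv_of_real)
  then have "FT (gauss \<epsilon>) \<omega> = of_real (sqrt (2 * pi) / \<epsilon>) * complex_of_real (exp (- (\<omega> / \<epsilon>)\<^sup>2 / 2))"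
    using assms by (simp add: field_simps)
  also have "sqrt (2 * pi) / \<epsilon> = 2 * pi * (1 / sqrt (2 * pi * \<epsilon>\<^sup>2))"
  proof -
    have "sqrt (2 * pi * \<epsilon>\<^sup>2) = sqrt (2 * pi) * \<epsilon>" using assms by (simp add: real_sqrt_mult)
    moreover have "2 * pi = sqrt (2 * pi) * sqrt (2 * pi)" by simp
    ultimately show ?thesis using assms by (simp add: field_simps del: real_sqrt_mult_self)
  qed
  finally show ?thesis
    by (simp add: normal_density_def power_divide mult_ac)
qed

text \<open>Fourier inversion in its Gaussian-regularized form: the factor between the two
  transforms becomes convolution with a normal density. The sum \<open>u + \<omega>\<close> appears
  because transforming twice reflects the argument.\<close>

lemma FT_FT_gauss:
  assumes x: "integrable lborel x" and e: "\<epsilon> > 0"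
  shows "FT (\<lambda>t. FT x t * gauss \<epsilon> t) \<omega> = 2 * of_real pi * (\<integral>u. x u * of_real (normal_density 0 \<epsilon> (u + \<omega>)) \<partial>lborel)"
proof -
  have inner: "FT (\<lambda>t. gauss \<epsilon> t * cis (t * \<omega>)) u = of_real (2 * pi * normal_density 0 \<epsilon> (u + \<omega>))" for u
    unfolding FT_gauss[OF e, symmetric] by (simp add: FT_def mult.assoc cis_mult distrib_left add.commute)
  have "FT (\<lambda>t. FT x t * gauss \<epsilon> t) \<omega> = (\<integral>t. FT x t * (gauss \<epsilon> t * cis (t * \<omega>)) \<partial>lborel)"
    by (simp add: FT_def[of "\<lambda>t. FT x t * gauss \<epsilon> t"] mult_ac)
  also have "\<dots> = (\<integral>u. x u * FT (\<lambda>t. gauss \<epsilon> t * cis (t * \<omega>)) u \<partial>lborel)"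
    by (intro FT_multiplication x integrable_cis integrable_gauss e)
  finally show ?thesis unfolding inner by (simp add: mult.left_commute[of "x _"] mult.assoc)
qed

lemma integrable_FT_gauss:
  assumes x: "integrable lborel x" and e: "\<epsilon> > 0"
  shows "integrable lborel (\<lambda>t. FT x t * gauss \<epsilon> t)"
proof -
  note [measurable] = borel_measurable_integrable[OF x]
  have "integrable lborel (\<lambda>t. gauss \<epsilon> t * FT x t)"
    by (rule integrable_mult_bounded[OF integrable_gauss[OF e]]) (use FT_bound in auto)
  then show ?thesis by (simp add: mult.commute)
qed

lemma integrable_reflect_cnj:
  assumes "integrable lborel x"
  shows "integrable lborel (\<lambda>u. cnj (x (- u :: real)))"
  using lborel_integrable_real_affine[OF assms, of "-1" 0] by simp

text \<open>Parseval's identity with a Gaussian factor. It is valid for all integrable functions and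
  is the common source of the Bessel inequality and of the orthogonality of transforms of functions
  with separated supports.\<close>

lemma FT_inner_gauss:
  assumes x: "integrable lborel x" and y: "integrable lborel y" and e: "\<epsilon> > 0"
  shows "(\<integral>\<omega>. FT x \<omega> * cnj (FT y \<omega>) * gauss \<epsilon> \<omega> \<partial>lborel) =
    2 * of_real pi * (\<integral>u. x u * (\<integral>v. cnj (y v) * of_real (normal_density 0 \<epsilon> (u - v)) \<partial>lborel) \<partial>lborel)"
proof -
  let ?y = "\<lambda>u. cnj (y (- u))"
  have y': "integrable lborel ?y" by (rule integrable_reflect_cnj[OF y])
  have inner: "FT (\<lambda>\<omega>. FT ?y \<omega> * gauss \<epsilon> \<omega>) u =
      2 * of_real pi * (\<integral>v. cnj (y v) * of_real (normal_density 0 \<epsilon> (u - v)) \<partial>lborel)" for u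
    unfolding FT_FT_gauss[OF y' e]
    by (subst lborel_integral_real_affine[where c="-1" and t=0]) (auto simp: add.commute)
  have "(\<integral>\<omega>. FT x \<omega> * cnj (FT y \<omega>) * gauss \<epsilon> \<omega> \<partial>lborel) = (\<integral>\<omega>. FT x \<omega> * (FT ?y \<omega> * gauss \<epsilon> \<omega>) \<partial>lborel)"
    by (simp add: cnj_FT mult.assoc)
  also have "\<dots> = (\<integral>u. x u * FT (\<lambda>\<omega>. FT ?y \<omega> * gauss \<epsilon> \<omega>) u \<partial>lborel)"
    by (intro FT_multiplication x integrable_FT_gauss y' e)
  finally show ?thesis unfolding inner by (simp add: mult.left_commute[of "x _"] mult.assoc)
qed

lemma nn_integral_normal_density_shift:
  assumes "\<epsilon> > 0"
  shows "(\<integral>\<^sup>+v. ennreal (normal_density 0 \<epsilon> (u - v)) \<partial>lborel) = 1"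
proof -
  have "1 = (\<integral>\<^sup>+v. ennreal (normal_density 0 \<epsilon> v) \<partial>lborel)"
    using assms by (subst nn_integral_eq_integral) auto
  also have "\<dots> = (\<integral>\<^sup>+v. ennreal (normal_density 0 \<epsilon> (u - v)) \<partial>lborel)"
    by (subst nn_integral_real_affine[where c="-1" and t=u]) auto
  finally show ?thesis by simp
qed

lemma normal_density_diff_commute: "normal_density 0 \<epsilon> (u - v) = normal_density 0 \<epsilon> (v - u)"
  by (simp add: normal_density_def power2_commute)

text \<open>A Schur test: the product of the two moduli is at most half the sum of their squares,
  and the symmetric kernel has mass 1 in either variable.\<close>

lemma nn_integral_normal_convolution:
  assumes [measurable]: "x \<in> borel_measurable lborel" and e: "\<epsilon> > 0"
  shows "(\<integral>\<^sup>+u. \<integral>\<^sup>+v. ennreal (cmod (x u)) * (ennreal (cmod (x v)) * ennreal (normal_density 0 \<epsilon> (u - v))) \<partial>lborel \<partial>lborel)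
    \<le> (\<integral>\<^sup>+u. ennreal ((cmod (x u))\<^sup>2) \<partial>lborel)"
proof -
  let ?n = "\<lambda>u v. ennreal (normal_density 0 \<epsilon> (u - v))"
  let ?q = "\<lambda>u. ennreal ((cmod (x u))\<^sup>2 / 2)"
  have "ennreal (cmod (x u)) * (ennreal (cmod (x v)) * ?n u v) \<le> ?q u * ?n u v + ?q v * ?n v u" for u v
  proof -
    have "cmod (x u) * cmod (x v) \<le> (cmod (x u))\<^sup>2 / 2 + (cmod (x v))\<^sup>2 / 2"
      using sum_squares_bound[of "cmod (x u)" "cmod (x v)"] by simp
    then have "(cmod (x u) * cmod (x v)) * normal_density 0 \<epsilon> (u - v) \<le>
        ((cmod (x u))\<^sup>2 / 2 + (cmod (x v))\<^sup>2 / 2) * normal_density 0 \<epsilon> (u - v)"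
      by (rule mult_right_mono) simp
    then have "ennreal (cmod (x u) * cmod (x v) * normal_density 0 \<epsilon> (u - v)) \<le>
        ennreal ((cmod (x u))\<^sup>2 / 2 * normal_density 0 \<epsilon> (u - v) + (cmod (x v))\<^sup>2 / 2 * normal_density 0 \<epsilon> (v - u))"
      by (intro ennreal_leI) (simp add: distrib_right normal_density_diff_commute[of \<epsilon> v u])
    then show ?thesis
      by (simp add: ennreal_mult[symmetric] ennreal_plus[symmetric] mult.assoc del: ennreal_plus)
  qed
  then have "(\<integral>\<^sup>+u. \<integral>\<^sup>+v. ennreal (cmod (x u)) * (ennreal (cmod (x v)) * ?n u v) \<partial>lborel \<partial>lborel) \<le>
      (\<integral>\<^sup>+u. \<integral>\<^sup>+v. ?q u * ?n u v + ?q v * ?n v u \<partial>lborel \<partial>lborel)"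
    by (intro nn_integral_mono)
  also have "\<dots> = (\<integral>\<^sup>+u. \<integral>\<^sup>+v. ?q u * ?n u v \<partial>lborel \<partial>lborel) + (\<integral>\<^sup>+u. \<integral>\<^sup>+v. ?q v * ?n v u \<partial>lborel \<partial>lborel)"
    by (simp add: nn_integral_add)
  also have "(\<integral>\<^sup>+u. \<integral>\<^sup>+v. ?q v * ?n v u \<partial>lborel \<partial>lborel) = (\<integral>\<^sup>+v. \<integral>\<^sup>+u. ?q v * ?n v u \<partial>lborel \<partial>lborel)"
    by (rule lborel_pair.Fubini') measurable
  also have "(\<integral>\<^sup>+u. \<integral>\<^sup>+v. ?q u * ?n u v \<partial>lborel \<partial>lborel) = (\<integral>\<^sup>+u. ?q u \<partial>lborel)"
    by (simp add: nn_integral_cmult nn_integral_normal_density_shift[OF e])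
  also have "(\<integral>\<^sup>+u. ?q u \<partial>lborel) + (\<integral>\<^sup>+u. ?q u \<partial>lborel) = (\<integral>\<^sup>+u. ennreal ((cmod (x u))\<^sup>2) \<partial>lborel)"
    by (subst nn_integral_add[symmetric]) (auto simp: ennreal_plus[symmetric] simp del: ennreal_plus)
  finally show ?thesis .
qed

text \<open>The Gaussian makes the integral finite before the transform is known to be square
  integrable. The bound is independent of \<open>\<epsilon>\<close>, as the passage to the limit
  demands.\<close>

lemma FT_L2_gauss_bound:
  assumes x: "integrable lborel x" "x \<in> L2 lborel" and e: "\<epsilon> > 0"
  shows "(\<integral>\<^sup>+\<omega>. ennreal ((cmod (FT x \<omega>))\<^sup>2 * exp (- (\<epsilon> * \<omega>)\<^sup>2 / 2)) \<partial>lborel) \<le> ennreal ((sqrt (2 * pi) * L2_norm lborel x)\<^sup>2)"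
proof -
  note [measurable] = borel_measurable_integrable[OF x(1)]
  define I where "I = (\<integral>\<omega>. (cmod (FT x \<omega>))\<^sup>2 * exp (- (\<epsilon> * \<omega>)\<^sup>2 / 2) \<partial>lborel)"
  have eq: "complex_of_real ((cmod (FT x \<omega>))\<^sup>2 * exp (- (\<epsilon> * \<omega>)\<^sup>2 / 2)) = FT x \<omega> * cnj (FT x \<omega>) * gauss \<epsilon> \<omega>" for \<omega>
    by (simp only: of_real_mult complex_norm_square gauss_def)
  have "integrable lborel (\<lambda>\<omega>. FT x \<omega> * gauss \<epsilon> \<omega> * cnj (FT x \<omega>))"
    by (rule integrable_mult_bounded[OF integrable_FT_gauss[OF x(1) e]]) (use FT_bound in auto)
  then have "integrable lborel (\<lambda>\<omega>. complex_of_real ((cmod (FT x \<omega>))\<^sup>2 * exp (- (\<epsilon> * \<omega>)\<^sup>2 / 2)))"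
    unfolding eq by (simp add: mult_ac)
  then have int: "integrable lborel (\<lambda>\<omega>. (cmod (FT x \<omega>))\<^sup>2 * exp (- (\<epsilon> * \<omega>)\<^sup>2 / 2))"
    by (simp only: complex_of_real_integrable_eq)
  have I0: "0 \<le> I" by (simp add: I_def)
  let ?inner = "\<lambda>u. \<integral>v. cnj (x v) * of_real (normal_density 0 \<epsilon> (u - v)) \<partial>lborel"
  have "complex_of_real I = 2 * of_real pi * (\<integral>u. x u * ?inner u \<partial>lborel)"
    unfolding I_def FT_inner_gauss[OF x(1) x(1) e, symmetric] by (simp only: eq[symmetric] integral_complex_of_real)
  then have "I = cmod (2 * of_real pi * (\<integral>u. x u * ?inner u \<partial>lborel))"
    using I0 by (metis abs_of_nonneg norm_of_real)
  then have "I = 2 * pi * cmod (\<integral>u. x u * ?inner u \<partial>lborel)"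
    by (simp add: norm_mult)
  then have "ennreal I = ennreal (2 * pi) * ennreal (cmod (\<integral>u. x u * ?inner u \<partial>lborel))"
    by (simp add: ennreal_mult)
  also have "\<dots> \<le> ennreal (2 * pi) * (\<integral>\<^sup>+u. ennreal (cmod (x u * ?inner u)) \<partial>lborel)"
    by (intro mult_left_mono norm_integral_le_nn_integral) simp
  also have "\<dots> \<le> ennreal (2 * pi) * (\<integral>\<^sup>+u. \<integral>\<^sup>+v. ennreal (cmod (x u)) * (ennreal (cmod (x v)) * ennreal (normal_density 0 \<epsilon> (u - v))) \<partial>lborel \<partial>lborel)"
  proof (intro mult_left_mono nn_integral_mono)
    fix u
    have "ennreal (cmod (?inner u)) \<le> (\<integral>\<^sup>+v. ennreal (cmod (cnj (x v) * of_real (normal_density 0 \<epsilon> (u - v)))) \<partial>lborel)"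
      by (rule norm_integral_le_nn_integral)
    also have "\<dots> = (\<integral>\<^sup>+v. ennreal (cmod (x v)) * ennreal (normal_density 0 \<epsilon> (u - v)) \<partial>lborel)"
      by (simp add: norm_mult ennreal_mult)
    finally show "ennreal (cmod (x u * ?inner u)) \<le> (\<integral>\<^sup>+v. ennreal (cmod (x u)) * (ennreal (cmod (x v)) * ennreal (normal_density 0 \<epsilon> (u - v))) \<partial>lborel)"
      by (simp add: norm_mult ennreal_mult nn_integral_cmult mult_left_mono)
  qed simp
  also have "\<dots> \<le> ennreal (2 * pi) * (\<integral>\<^sup>+u. ennreal ((cmod (x u))\<^sup>2) \<partial>lborel)"
    by (intro mult_left_mono nn_integral_normal_convolution e) auto
  also have "\<dots> = ennreal ((sqrt (2 * pi) * L2_norm lborel x)\<^sup>2)"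
    by (simp add: nn_integral_cmod_square[OF x(2)] ennreal_mult[symmetric] power_mult_distrib)
  finally show ?thesis
    using int by (simp add: I_def nn_integral_eq_integral)
qed

text \<open>Fatou's lemma as the Gaussian flattens. The inequality is what is needed to extend the
  transform from truncations to all of L2 by continuity.\<close>

lemma FT_bessel:
  assumes x: "integrable lborel x" "x \<in> L2 lborel"
  shows "FT x \<in> L2 lborel" and "L2_norm lborel (FT x) \<le> sqrt (2 * pi) * L2_norm lborel x"
proof -
  note [measurable] = borel_measurable_integrable[OF x(1)]
  define e where "e n = inverse (real (Suc n))" for n
  have e: "e \<longlonglongrightarrow> 0" "\<And>n. 0 < e n"
    unfolding e_def[abs_def] by (rule LIMSEQ_inverse_real_of_nat) simp
  let ?u = "\<lambda>n \<omega>. ennreal ((cmod (FT x \<omega>))\<^sup>2 * exp (- (e n * \<omega>)\<^sup>2 / 2))"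
  have "(\<integral>\<^sup>+\<omega>. ennreal ((cmod (FT x \<omega>))\<^sup>2) \<partial>lborel) = (\<integral>\<^sup>+\<omega>. liminf (\<lambda>n. ?u n \<omega>) \<partial>lborel)"
  proof (rule nn_integral_cong)
    fix \<omega>
    have "(\<lambda>n. ?u n \<omega>) \<longlonglongrightarrow> ennreal ((cmod (FT x \<omega>))\<^sup>2 * exp (- (0 * \<omega>)\<^sup>2 / 2))"
      by (intro tendsto_ennrealI tendsto_intros e) auto
    then show "ennreal ((cmod (FT x \<omega>))\<^sup>2) = liminf (\<lambda>n. ?u n \<omega>)"
      by (intro lim_imp_Liminf[symmetric]) auto
  qed
  also have "\<dots> \<le> liminf (\<lambda>n. \<integral>\<^sup>+\<omega>. ?u n \<omega> \<partial>lborel)"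
    by (rule nn_integral_liminf) auto
  also have "\<dots> \<le> ennreal ((sqrt (2 * pi) * L2_norm lborel x)\<^sup>2)"
    using FT_L2_gauss_bound[OF x e(2)] by (intro Liminf_le) auto
  finally have *: "(\<integral>\<^sup>+\<omega>. ennreal ((cmod (FT x \<omega>))\<^sup>2) \<partial>lborel) \<le> ennreal ((sqrt (2 * pi) * L2_norm lborel x)\<^sup>2)" .
  show "FT x \<in> L2 lborel" by (rule L2I_nn_integral(1)[OF _ *]) measurable
  show "L2_norm lborel (FT x) \<le> sqrt (2 * pi) * L2_norm lborel x"
    by (rule L2I_nn_integral(2)[OF _ *]) auto
qed


section \<open>The Fourier transform in the mean\<close>

lemma ext_by_zero_indicator: "ext_by_zero T x = (\<lambda>u. indicator T u *\<^sub>R x u)"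
  by (auto simp: ext_by_zero_def indicator_def)

lemma L2_restrict_iff:
  fixes T :: "real set"
  assumes "T \<in> sets borel"
  shows "x \<in> L2 (restrict_space lborel T) \<longleftrightarrow> ext_by_zero T x \<in> L2 lborel"
proof -
  have T: "T \<inter> space lborel \<in> sets lborel" using assms by simp
  have "(\<lambda>u. (cmod (ext_by_zero T x u))\<^sup>2) = (\<lambda>u. indicator T u *\<^sub>R (cmod (x u))\<^sup>2)"
    by (auto simp: ext_by_zero_def indicator_def)
  then show ?thesis
    by (simp add: L2_def borel_measurable_restrict_space_iff[OF T] integrable_restrict_space[OF T]
        set_integrable_def ext_by_zero_indicator)
qed

lemma integral_restrict_ext:
  fixes T :: "real set"
  assumes "T \<in> sets borel"
  shows "(\<integral>t. x t * cnj (y t) \<partial>restrict_space lborel T) =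
    (\<integral>t. ext_by_zero T x t * cnj (ext_by_zero T y t) \<partial>lborel)"
proof -
  have T: "T \<inter> space lborel \<in> sets lborel" using assms by simp
  show ?thesis
    unfolding integral_restrict_space[OF T] set_lebesgue_integral_def
    by (intro Bochner_Integration.integral_cong) (auto simp: ext_by_zero_def indicator_def)
qed

lemma L2_norm_restrict:
  fixes T :: "real set"
  assumes "T \<in> sets borel"
  shows "L2_norm (restrict_space lborel T) x = L2_norm lborel (ext_by_zero T x)"
proof -
  have T: "T \<inter> space lborel \<in> sets lborel" using assms by simp
  show ?thesis
    unfolding L2_norm_def integral_restrict_space[OF T] set_lebesgue_integral_def
    by (intro arg_cong[where f=sqrt] Bochner_Integration.integral_cong) (auto simp: ext_by_zero_def indicator_def)
qed

section \<open>Truncation to bounded intervals\<close>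

definition clip :: "nat \<Rightarrow> (real \<Rightarrow> complex) \<Rightarrow> real \<Rightarrow> complex" where
  "clip n y u = indicator {- real n..real n} u *\<^sub>R y u"

lemma clip_measurable [measurable]: "y \<in> borel_measurable borel \<Longrightarrow> clip n y \<in> borel_measurable borel"
  unfolding clip_def[abs_def] by measurable

lemma clip_le: "cmod (clip n y u) \<le> cmod (y u)"
  by (simp add: clip_def indicator_def)

lemma clip_L2:
  assumes "y \<in> L2 lborel"
  shows "clip n y \<in> L2 lborel"
proof -
  note [measurable] = L2_measurable[OF assms]
  have "integrable lborel (\<lambda>t. (cmod (clip n y t))\<^sup>2)"
    by (rule Bochner_Integration.integrable_bound[OF L2_integrable[OF assms]]) (auto simp: clip_le power_mono)
  then show ?thesis by (simp add: L2_def)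
qed

lemma clip_integrable:
  assumes "y \<in> L2 lborel"
  shows "integrable lborel (clip n y)"
proof -
  have "(indicator {- real n..real n} :: real \<Rightarrow> complex) \<in> L2 lborel"
  proof -
    have "(\<lambda>t::real. (cmod (indicator {- real n..real n} t))\<^sup>2) = indicator {- real n..real n}"
      by (auto simp: indicator_def)
    then show ?thesis by (simp add: L2_def)
  qed
  from L2_mult_integrable(1)[OF this assms] show ?thesis
    by (rule back_subst[where P="integrable lborel"]) (auto simp: clip_def indicator_def)
qed

lemma clip_tendsto:
  assumes "y \<in> L2 lborel"
  shows "(\<lambda>n. L2_norm lborel (\<lambda>t. clip n y t - y t)) \<longlonglongrightarrow> 0"
proof -
  note [measurable] = L2_measurable[OF assms]
  have "(\<lambda>n. \<integral>t. (cmod (clip n y t - y t))\<^sup>2 \<partial>lborel) \<longlonglongrightarrow> (\<integral>t. 0 \<partial>(lborel :: real measure))"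
  proof (rule integral_dominated_convergence[where w="\<lambda>t. (cmod (y t))\<^sup>2"])
    show "AE t in lborel. (\<lambda>n. (cmod (clip n y t - y t))\<^sup>2) \<longlonglongrightarrow> 0"
    proof (rule AE_I2, rule tendsto_eventually)
      fix t :: real
      obtain N where N: "\<bar>t\<bar> \<le> real N" using real_arch_simple by blast
      show "\<forall>\<^sub>F n in sequentially. (cmod (clip n y t - y t))\<^sup>2 = 0"
        using eventually_ge_at_top[of N]
      proof eventually_elim
        case (elim n)
        then have "t \<in> {- real n..real n}" using N by auto
        then show ?case by (simp add: clip_def)
      qed
    qed
    show "AE t in lborel. norm ((cmod (clip n y t - y t))\<^sup>2) \<le> (cmod (y t))\<^sup>2" for n
      by (auto simp: clip_def indicator_def)
  qed (use L2_integrable[OF assms] in auto)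
  from tendsto_real_sqrt[OF this] show ?thesis by (simp add: L2_norm_def)
qed

text \<open>A relation and not a function, since a limit in mean is fixed only up to a null set; the
  truncations are integrable, so that \<open>FT\<close> applies to them.\<close>

definition fourier_L2 :: "(real \<Rightarrow> complex) \<Rightarrow> (real \<Rightarrow> complex) \<Rightarrow> bool" where
  "fourier_L2 y Y \<longleftrightarrow> Y \<in> L2 lborel \<and> (\<lambda>n. L2_norm lborel (\<lambda>\<omega>. FT (clip n y) \<omega> - Y \<omega>)) \<longlonglongrightarrow> 0"

lemma FT_clip_L2: "y \<in> L2 lborel \<Longrightarrow> FT (clip n y) \<in> L2 lborel"
  by (intro FT_bessel(1) clip_integrable clip_L2)

lemma FT_L2_diff:
  assumes "integrable lborel x" "x \<in> L2 lborel" "integrable lborel y" "y \<in> L2 lborel"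
  shows "L2_norm lborel (\<lambda>\<omega>. FT x \<omega> - FT y \<omega>) \<le> sqrt (2 * pi) * L2_norm lborel (\<lambda>u. x u - y u)"
  using FT_bessel(2)[OF Bochner_Integration.integrable_diff[OF assms(1,3)] L2_diff[OF assms(2,4)]]
  by (simp add: FT_diff[OF assms(1,3), abs_def])

text \<open>The truncated integral over T is the transform of the clipped zero extension, so
  everything about \<open>fourier T\<close> reduces to the whole line.\<close>

lemma is_fourier_iff:
  assumes T: "T \<in> sets borel" and x: "x \<in> L2 (restrict_space lborel T)"
  shows "is_fourier T x X \<longleftrightarrow> fourier_L2 (ext_by_zero T x) X"
proof -
  let ?y = "ext_by_zero T x"
  have y: "?y \<in> L2 lborel" using x L2_restrict_iff[OF T] by simp
  have tr: "(LINT u:T \<inter> {- real n..real n}|lborel. x u * cis (u * \<omega>)) = FT (clip n ?y) \<omega>" for n \<omega>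
    unfolding set_lebesgue_integral_def FT_def
    by (intro Bochner_Integration.integral_cong) (auto simp: clip_def ext_by_zero_def indicator_def)
  have "(\<lambda>n. \<integral>\<^sup>+\<omega>. ennreal ((cmod (X \<omega> - FT (clip n ?y) \<omega>))\<^sup>2) \<partial>lborel) \<longlonglongrightarrow> 0 \<longleftrightarrow>
      (\<lambda>n. L2_norm lborel (\<lambda>\<omega>. FT (clip n ?y) \<omega> - X \<omega>)) \<longlonglongrightarrow> 0" if X: "X \<in> L2 lborel"
  proof -
    let ?d = "\<lambda>n. L2_norm lborel (\<lambda>\<omega>. FT (clip n ?y) \<omega> - X \<omega>)"
    have "(\<integral>\<^sup>+\<omega>. ennreal ((cmod (X \<omega> - FT (clip n ?y) \<omega>))\<^sup>2) \<partial>lborel) = ennreal ((?d n)\<^sup>2)" for n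
      using nn_integral_cmod_square[OF L2_diff[OF X FT_clip_L2[OF y]]]
      by (simp add: L2_norm_minus_commute[of _ X])
    then have "(\<lambda>n. \<integral>\<^sup>+\<omega>. ennreal ((cmod (X \<omega> - FT (clip n ?y) \<omega>))\<^sup>2) \<partial>lborel) \<longlonglongrightarrow> 0 \<longleftrightarrow>
        (\<lambda>n. ennreal ((?d n)\<^sup>2)) \<longlonglongrightarrow> ennreal 0" by simp
    also have "\<dots> \<longleftrightarrow> (\<lambda>n. (?d n)\<^sup>2) \<longlonglongrightarrow> 0"
      by (rule tendsto_ennreal_iff) auto
    also have "\<dots> \<longleftrightarrow> ?d \<longlonglongrightarrow> 0"
    proof
      assume "(\<lambda>n. (?d n)\<^sup>2) \<longlonglongrightarrow> 0"
      from tendsto_real_sqrt[OF this] show "?d \<longlonglongrightarrow> 0" by simp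
    next
      assume "?d \<longlonglongrightarrow> 0"
      from tendsto_power[OF this, of 2] show "(\<lambda>n. (?d n)\<^sup>2) \<longlonglongrightarrow> 0" by simp
    qed
    finally show ?thesis .
  qed
  then show ?thesis unfolding is_fourier_def fourier_L2_def tr by blast
qed

lemma fourier_L2_FT:
  assumes y: "integrable lborel y" "y \<in> L2 lborel"
  shows "fourier_L2 y (FT y)"
  unfolding fourier_L2_def
proof (intro conjI FT_bessel(1) y)
  have lim: "(\<lambda>n. sqrt (2 * pi) * L2_norm lborel (\<lambda>u. clip n y u - y u)) \<longlonglongrightarrow> 0"
    using tendsto_mult[OF tendsto_const clip_tendsto[OF y(2)]] by simp
  have le: "norm (L2_norm lborel (\<lambda>\<omega>. FT (clip n y) \<omega> - FT y \<omega>)) \<le>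
      sqrt (2 * pi) * L2_norm lborel (\<lambda>u. clip n y u - y u)" for n
    using FT_L2_diff[OF clip_integrable[OF y(2)] clip_L2[OF y(2)] y] by simp
  show "(\<lambda>n. L2_norm lborel (\<lambda>\<omega>. FT (clip n y) \<omega> - FT y \<omega>)) \<longlonglongrightarrow> 0"
    by (rule Lim_null_comparison[OF always_eventually[OF allI[OF le]] lim])
qed

lemma fourier_L2_exists:
  assumes y: "y \<in> L2 lborel"
  obtains Y where "fourier_L2 y Y"
proof (rule L2_complete[where x="\<lambda>n. FT (clip n y)" and M=lborel])
  show "FT (clip n y) \<in> L2 lborel" for n by (rule FT_clip_L2[OF y])
  fix e :: real assume e: "0 < e"
  \<comment> \<open>The factor 2 pays for the triangle inequality through \<open>y\<close>, the root
    for the constant in the Bessel inequality.\<close>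
  define e' where "e' = e / (2 * sqrt (2 * pi))"
  have e': "0 < e'" using e by (simp add: e'_def)
  then have "\<forall>\<^sub>F n in sequentially. L2_norm lborel (\<lambda>t. clip n y t - y t) < e'"
    by (rule order_tendstoD(2)[OF clip_tendsto[OF y]])
  then obtain N where N: "\<And>n. N \<le> n \<Longrightarrow> L2_norm lborel (\<lambda>t. clip n y t - y t) < e'"
    by (auto simp: eventually_sequentially)
  have "L2_norm lborel (\<lambda>\<omega>. FT (clip m y) \<omega> - FT (clip n y) \<omega>) < e" if mn: "N \<le> m" "N \<le> n" for m n
  proof -
    have "L2_norm lborel (\<lambda>t. clip m y t - clip n y t) \<le>
        L2_norm lborel (\<lambda>t. clip m y t - y t) + L2_norm lborel (\<lambda>t. y t - clip n y t)"
      by (intro L2_norm_triangle_diff clip_L2 y)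
    also have "\<dots> < e' + e'"
      using N[OF mn(1)] N[OF mn(2)] unfolding L2_norm_minus_commute[of lborel y] by (rule add_strict_mono)
    finally have "sqrt (2 * pi) * L2_norm lborel (\<lambda>t. clip m y t - clip n y t) < sqrt (2 * pi) * (e' + e')"
      by (rule mult_strict_left_mono) simp
    also have "\<dots> = e" by (simp add: e'_def)
    finally show ?thesis
      using FT_L2_diff[OF clip_integrable[OF y] clip_L2[OF y] clip_integrable[OF y] clip_L2[OF y], of m n] by simp
  qed
  then show "\<exists>N. \<forall>m\<ge>N. \<forall>n\<ge>N. L2_norm lborel (\<lambda>\<omega>. FT (clip m y) \<omega> - FT (clip n y) \<omega>) < e" by blast
next
  fix Y assume "Y \<in> L2 lborel" "(\<lambda>n. L2_norm lborel (\<lambda>\<omega>. FT (clip n y) \<omega> - Y \<omega>)) \<longlonglongrightarrow> 0"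
  then show thesis by (intro that) (simp add: fourier_L2_def)
qed

text \<open>\<open>fourier\<close> is a Hilbert choice; the existence of the limit in mean is what
  makes the chosen function a transform.\<close>

lemma fourier_fourier_L2:
  assumes T: "T \<in> sets borel" and x: "x \<in> L2 (restrict_space lborel T)"
  shows "fourier_L2 (ext_by_zero T x) (fourier T x)"
proof -
  have "ext_by_zero T x \<in> L2 lborel" using x L2_restrict_iff[OF T] by simp
  then obtain Y where "fourier_L2 (ext_by_zero T x) Y" by (rule fourier_L2_exists)
  then have "is_fourier T x Y" by (simp add: is_fourier_iff[OF T x])
  then have "is_fourier T x (fourier T x)" unfolding fourier_def by (rule someI[where P="is_fourier T x"])
  then show ?thesis by (simp add: is_fourier_iff[OF T x])
qed

lemma fourier_L2_diff:
  assumes y: "y \<in> L2 lborel" "z \<in> L2 lborel" and Y: "fourier_L2 y Y" "fourier_L2 z Z"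
  shows "fourier_L2 (\<lambda>u. y u - z u) (\<lambda>\<omega>. Y \<omega> - Z \<omega>)"
proof -
  have YL: "Y \<in> L2 lborel" "Z \<in> L2 lborel" using Y by (auto simp: fourier_L2_def)
  have clip_diff: "clip n (\<lambda>u. y u - z u) = (\<lambda>u. clip n y u - clip n z u)" for n
    by (auto simp: clip_def scaleR_diff_right)
  have eq: "FT (clip n (\<lambda>u. y u - z u)) \<omega> - (Y \<omega> - Z \<omega>) = (FT (clip n y) \<omega> - Y \<omega>) + (Z \<omega> - FT (clip n z) \<omega>)" for n \<omega>
    unfolding clip_diff FT_diff[OF clip_integrable[OF y(1)] clip_integrable[OF y(2)]] by simp
  have le: "norm (L2_norm lborel (\<lambda>\<omega>. FT (clip n (\<lambda>u. y u - z u)) \<omega> - (Y \<omega> - Z \<omega>))) \<le>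
      L2_norm lborel (\<lambda>\<omega>. FT (clip n y) \<omega> - Y \<omega>) + L2_norm lborel (\<lambda>\<omega>. FT (clip n z) \<omega> - Z \<omega>)" for n
    unfolding eq using L2_norm_triangle[OF L2_diff[OF FT_clip_L2[OF y(1)] YL(1)] L2_diff[OF YL(2) FT_clip_L2[OF y(2)]], of n n]
    by (simp add: L2_norm_minus_commute[of lborel Z])
  have lim: "(\<lambda>n. L2_norm lborel (\<lambda>\<omega>. FT (clip n y) \<omega> - Y \<omega>) + L2_norm lborel (\<lambda>\<omega>. FT (clip n z) \<omega> - Z \<omega>)) \<longlonglongrightarrow> 0"
    using Y by (auto simp: fourier_L2_def intro: tendsto_add_zero)
  show ?thesis
    unfolding fourier_L2_def
    by (intro conjI L2_diff YL Lim_null_comparison[OF always_eventually[OF allI[OF le]] lim])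
qed

lemma L2_norm_tendsto:
  assumes "\<And>n. x n \<in> L2 M" "y \<in> L2 M" and lim: "(\<lambda>n. L2_norm M (\<lambda>t. x n t - y t)) \<longlonglongrightarrow> 0"
  shows "(\<lambda>n. L2_norm M (x n)) \<longlonglongrightarrow> L2_norm M y"
proof (rule LIM_zero_cancel, rule Lim_null_comparison[OF _ lim], rule always_eventually, rule allI)
  fix n
  have "L2_norm M (x n) \<le> L2_norm M (\<lambda>t. x n t - y t) + L2_norm M y"
    using L2_norm_triangle[OF L2_diff[OF assms(1)[of n] assms(2)] assms(2)] by simp
  moreover have "L2_norm M y \<le> L2_norm M (\<lambda>t. x n t - y t) + L2_norm M (x n)"
    using L2_norm_triangle[OF L2_diff[OF assms(2) assms(1)[of n]] assms(1)[of n]]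
    by (simp add: L2_norm_minus_commute[of M y])
  ultimately show "norm (L2_norm M (x n) - L2_norm M y) \<le> L2_norm M (\<lambda>t. x n t - y t)"
    by (simp add: abs_le_iff)
qed

lemma fourier_L2_bessel:
  assumes y: "y \<in> L2 lborel" and Y: "fourier_L2 y Y"
  shows "L2_norm lborel Y \<le> sqrt (2 * pi) * L2_norm lborel y"
proof (rule LIMSEQ_le)
  show "(\<lambda>n. L2_norm lborel (FT (clip n y))) \<longlonglongrightarrow> L2_norm lborel Y"
    using Y FT_clip_L2[OF y] by (intro L2_norm_tendsto) (auto simp: fourier_L2_def)
  show "(\<lambda>n. sqrt (2 * pi) * L2_norm lborel (clip n y)) \<longlonglongrightarrow> sqrt (2 * pi) * L2_norm lborel y"
    by (intro tendsto_mult tendsto_const L2_norm_tendsto clip_tendsto clip_L2 y)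
  show "\<exists>N. \<forall>n\<ge>N. L2_norm lborel (FT (clip n y)) \<le> sqrt (2 * pi) * L2_norm lborel (clip n y)"
    by (intro exI allI impI FT_bessel(2) clip_integrable clip_L2 y)
qed

text \<open>The difference of two transforms of \<open>y\<close> is a transform of the zero
  function, and the Bessel inequality gives it norm 0.\<close>

lemma fourier_L2_unique:
  assumes y: "y \<in> L2 lborel" and Y: "fourier_L2 y Y" "fourier_L2 y Z"
  shows "AE \<omega> in lborel. Y \<omega> = Z \<omega>"
proof -
  have L: "(\<lambda>\<omega>. Y \<omega> - Z \<omega>) \<in> L2 lborel" using Y by (auto simp: fourier_L2_def intro: L2_diff)
  have z: "(\<lambda>u. y u - y u) \<in> L2 lborel" by (rule L2_diff[OF y y])
  have "L2_norm lborel (\<lambda>\<omega>. Y \<omega> - Z \<omega>) \<le> sqrt (2 * pi) * L2_norm lborel (\<lambda>u. y u - y u)"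
    by (rule fourier_L2_bessel[OF z fourier_L2_diff[OF y y Y]])
  also have "\<dots> = 0" by (simp add: L2_norm_def)
  finally have "L2_norm lborel (\<lambda>\<omega>. Y \<omega> - Z \<omega>) = 0" using L2_norm_nonneg[of lborel] by (intro antisym) auto
  from L2_norm_eq_0[OF L this] show ?thesis by simp
qed

lemma L2_reflect:
  assumes "x \<in> L2 lborel"
  shows "(\<lambda>t. x (- t :: real)) \<in> L2 lborel"
proof -
  note [measurable] = L2_measurable[OF assms]
  have "(\<lambda>t. x (- t)) \<in> borel_measurable borel" by measurable
  then show ?thesis
    using lborel_integrable_real_affine[OF L2_integrable[OF assms], of "-1" 0] by (simp add: L2_def)
qed

lemma L2_norm_reflect: "L2_norm lborel (\<lambda>t. x (- t :: real)) = L2_norm lborel x"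
  unfolding L2_norm_def
  by (subst (2) lborel_integral_real_affine[where c="-1" and t=0]) auto

text \<open>Passage to the limit from truncations. The reflected argument is the one in
  \<open>R_op\<close>, whose outer transform is moved in this way onto the test function
  \<open>k\<close>.\<close>

lemma fourier_L2_multiplication:
  assumes x: "x \<in> L2 lborel" and k: "k \<in> L2 lborel" and X: "fourier_L2 x X" and K: "fourier_L2 k K"
  shows "(\<integral>t. X (- t) * cnj (k t) \<partial>lborel) = (\<integral>\<omega>. x \<omega> * cnj (K \<omega>) \<partial>lborel)"
proof (rule LIMSEQ_unique)
  have XL: "X \<in> L2 lborel" "K \<in> L2 lborel" using X K by (auto simp: fourier_L2_def)
  have XC: "(\<lambda>n. L2_norm lborel (\<lambda>t. FT (clip n x) (- t) - X (- t))) \<longlonglongrightarrow> 0"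
    using X L2_norm_reflect[of "\<lambda>t. FT (clip _ x) t - X t"] by (simp add: fourier_L2_def)
  show "(\<lambda>n. \<integral>t. FT (clip n x) (- t) * cnj (clip n k t) \<partial>lborel) \<longlonglongrightarrow> (\<integral>t. X (- t) * cnj (k t) \<partial>lborel)"
    by (intro L2_inner_tendsto[where x="\<lambda>n t. FT (clip n x) (- t)" and x'="\<lambda>t. X (- t)"] L2_reflect FT_clip_L2 clip_L2 x k XL XC clip_tendsto)
  have eq: "(\<integral>t. FT (clip n x) (- t) * cnj (clip n k t) \<partial>lborel) = (\<integral>\<omega>. clip n x \<omega> * cnj (FT (clip n k) \<omega>) \<partial>lborel)" for n
  proof -
    have "(\<integral>t. FT (clip n x) (- t) * cnj (clip n k t) \<partial>lborel) = (\<integral>t. FT (clip n x) t * cnj (clip n k (- t)) \<partial>lborel)"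
      by (subst lborel_integral_real_affine[where c="-1" and t=0]) auto
    also have "\<dots> = (\<integral>\<omega>. clip n x \<omega> * FT (\<lambda>t. cnj (clip n k (- t))) \<omega> \<partial>lborel)"
      by (intro FT_multiplication integrable_reflect_cnj clip_integrable x k)
    finally show ?thesis by (simp add: cnj_FT)
  qed
  show "(\<lambda>n. \<integral>t. FT (clip n x) (- t) * cnj (clip n k t) \<partial>lborel) \<longlonglongrightarrow> (\<integral>\<omega>. x \<omega> * cnj (K \<omega>) \<partial>lborel)"
    unfolding eq using K by (intro L2_inner_tendsto FT_clip_L2 clip_L2 x k XL clip_tendsto) (simp add: fourier_L2_def)
qed


section \<open>Approximation by Gaussian convolution\<close>

lemma integrable_indicator_translate:
  fixes A :: "real set"
  assumes "A \<in> sets borel" "emeasure lborel A < \<infinity>"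
  shows "integrable lborel (\<lambda>x. indicator A (x + s) :: real)" "(\<integral>x. indicator A (x + s) \<partial>lborel) = measure lborel A"
proof -
  have i: "integrable lborel (indicator A :: real \<Rightarrow> real)"
    using assms by (intro integrable_real_indicator) auto
  show "integrable lborel (\<lambda>x. indicator A (x + s) :: real)"
    using lborel_integrable_real_affine[OF i, of 1 s] by (simp add: add.commute)
  have "measure lborel A = (\<integral>x. indicator A x \<partial>lborel)" by simp
  also have "\<dots> = (\<integral>x. indicator A (x + s) \<partial>lborel)"
    by (subst lborel_integral_real_affine[where c=1 and t=s]) (auto simp: add.commute)
  finally show "(\<integral>x. indicator A (x + s) \<partial>lborel) = measure lborel A" by simp
qed

text \<open>The measure of the symmetric difference is governed by the overlap of \<open>A\<close>
  with its translate. Replacing the translate of \<open>A\<close> by that of an open superset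
  \<open>U\<close> costs the small measure of \<open>U - A\<close>; for open \<open>U\<close>,
  points of \<open>A\<close> stay in \<open>U\<close> under small shifts, so the overlap converges
  by dominated convergence.\<close>

lemma translation_tendsto_indicator:
  fixes A :: "real set"
  assumes A: "A \<in> sets borel" "emeasure lborel A < \<infinity>" and s: "s \<longlonglongrightarrow> 0"
  shows "(\<lambda>n. \<integral>x. \<bar>indicator A (x + s n) - indicator A x\<bar> \<partial>lborel) \<longlonglongrightarrow> (0 :: real)"
proof (rule LIMSEQ_I)
  fix e :: real assume e: "0 < e"
  \<comment> \<open>A quarter suffices: the final bound contains the excess of \<open>U\<close> and
    the defect of the overlap twice each.\<close>
  obtain U where U: "open U" "A \<subseteq> U" "emeasure lborel (U - A) < ennreal (e / 4)"
    using outer_regular_lborel[OF A(1), of "e / 4"] e by auto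
  note [measurable] = A(1)
  have [measurable]: "U \<in> sets borel" using U(1) by simp
  have UA: "emeasure lborel (U - A) < \<infinity>" by (rule less_trans[OF U(3)]) simp
  have mUA: "measure lborel (U - A) \<le> e / 4"
    unfolding measure_def using U(3) e by (intro enn2real_leI) auto
  let ?a = "\<lambda>x. indicator A x :: real"
  let ?g = "\<lambda>n x. ?a x * indicator U (x + s n)"
  have ia: "integrable lborel ?a" using A by (intro integrable_real_indicator) auto
  have g: "(\<lambda>n. \<integral>x. ?g n x \<partial>lborel) \<longlonglongrightarrow> (\<integral>x. ?a x \<partial>lborel)"
  proof (rule integral_dominated_convergence[where w="?a"])
    show "AE x in lborel. (\<lambda>n. ?g n x) \<longlonglongrightarrow> ?a x"
    proof (rule AE_I2, rule tendsto_eventually)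
      fix x :: real
      show "\<forall>\<^sub>F n in sequentially. ?g n x = ?a x"
      proof (cases "x \<in> A")
        case True
        have "(\<lambda>n. x + s n) \<longlonglongrightarrow> x" using tendsto_add[OF tendsto_const s] by simp
        then have "\<forall>\<^sub>F n in sequentially. x + s n \<in> U"
          using U True by (auto dest: topological_tendstoD)
        then show ?thesis by eventually_elim simp
      qed simp
    qed
    show "AE x in lborel. norm (?g n x) \<le> ?a x" for n by (auto simp: indicator_def)
  qed (use ia in auto)
  have ig: "integrable lborel (?g n)" for n
    by (rule Bochner_Integration.integrable_bound[OF ia]) (auto simp: indicator_def)
  have bound: "(\<integral>x. \<bar>indicator A (x + s n) - ?a x\<bar> \<partial>lborel) \<le>
      2 * ((\<integral>x. ?a x \<partial>lborel) - (\<integral>x. ?g n x \<partial>lborel)) + 2 * (e / 4)" for n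
  proof -
    have "(\<integral>x. \<bar>indicator A (x + s n) - ?a x\<bar> \<partial>lborel) \<le>
        (\<integral>x. indicator A (x + s n) + ?a x - 2 * ?g n x + 2 * indicator (U - A) (x + s n) \<partial>lborel)"
    proof (rule integral_mono)
      show "integrable lborel (\<lambda>x. indicator A (x + s n) + ?a x - 2 * ?g n x + 2 * indicator (U - A) (x + s n))"
        using A UA ia ig by (intro Bochner_Integration.integrable_add Bochner_Integration.integrable_diff
          integrable_mult_right integrable_indicator_translate) auto
      show "integrable lborel (\<lambda>x. \<bar>indicator A (x + s n) - ?a x\<bar>)"
        using A ia by (intro integrable_abs Bochner_Integration.integrable_diff integrable_indicator_translate) auto
      show "\<bar>indicator A (x + s n) - ?a x\<bar> \<le>
          indicator A (x + s n) + ?a x - 2 * ?g n x + 2 * indicator (U - A) (x + s n)" for x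
        using U(2) by (auto simp: indicator_def)
    qed
    also have "\<dots> = measure lborel A + (\<integral>x. ?a x \<partial>lborel) - 2 * (\<integral>x. ?g n x \<partial>lborel) + 2 * measure lborel (U - A)"
      using A UA ia ig integrable_indicator_translate[of A "s n"] integrable_indicator_translate[of "U - A" "s n"] by simp
    also have "\<dots> \<le> 2 * ((\<integral>x. ?a x \<partial>lborel) - (\<integral>x. ?g n x \<partial>lborel)) + 2 * (e / 4)"
      using mUA by simp
    finally show ?thesis .
  qed
  have "\<forall>\<^sub>F n in sequentially. (\<integral>x. ?a x \<partial>lborel) - e / 4 < (\<integral>x. ?g n x \<partial>lborel)"
    using e by (intro order_tendstoD(1)[OF g]) auto
  then obtain N where N: "\<And>n. N \<le> n \<Longrightarrow> (\<integral>x. ?a x \<partial>lborel) - e / 4 < (\<integral>x. ?g n x \<partial>lborel)"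
    by (auto simp: eventually_sequentially)
  have "norm ((\<integral>x. \<bar>indicator A (x + s n) - ?a x\<bar> \<partial>lborel) - 0) < e" if "N \<le> n" for n
  proof -
    have less: "z < e" if "z \<le> 2 * (p - q) + 2 * (e / 4)" "p - e / 4 < q" for z p q
      using that by argo
    show ?thesis using less[OF bound N[OF that]] by simp
  qed
  then show "\<exists>no. \<forall>n\<ge>no. norm ((\<integral>x. \<bar>indicator A (x + s n) - ?a x\<bar> \<partial>lborel) - 0) < e" by blast
qed

lemma integrable_translate:
  fixes f :: "real \<Rightarrow> 'a::{banach, second_countable_topology}"
  shows "integrable lborel f \<Longrightarrow> integrable lborel (\<lambda>x. f (x + s))"
  using lborel_integrable_real_affine[of f 1 s] by (simp add: add.commute)

lemma integral_translate:
  fixes f :: "real \<Rightarrow> 'a::{banach, second_countable_topology}"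
  shows "(\<integral>x. f (x + s) \<partial>lborel) = (\<integral>x. f x \<partial>lborel)"
  by (subst (2) lborel_integral_real_affine[where c=1 and t=s]) (auto simp: add.commute)

text \<open>Induction over integrable functions: indicators, sums, and limits of dominated simple
  functions. The limit step is a three-term estimate in which translation invariance controls the
  shifted error.\<close>

lemma translation_tendsto:
  fixes f :: "real \<Rightarrow> 'a::{banach, second_countable_topology}"
  assumes "integrable lborel f" and s: "s \<longlonglongrightarrow> 0"
  shows "(\<lambda>n. \<integral>x. norm (f (x + s n) - f x) \<partial>lborel) \<longlonglongrightarrow> 0"
  using assms(1)
proof (induction rule: integrable_induct)
  case (base A c)
  have "norm (indicator A (x + s n) *\<^sub>R c - indicator A x *\<^sub>R c) = norm c * \<bar>indicator A (x + s n) - indicator A x\<bar>" for n x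
    by (simp add: scaleR_diff_left[symmetric])
  then show ?case
    using tendsto_mult[OF tendsto_const[of "norm c"] translation_tendsto_indicator[OF _ base(2) s]] base by simp
next
  case (add f g)
  have "(\<integral>x. norm (f (x + s n) + g (x + s n) - (f x + g x)) \<partial>lborel) \<le>
      (\<integral>x. norm (f (x + s n) - f x) \<partial>lborel) + (\<integral>x. norm (g (x + s n) - g x) \<partial>lborel)" for n
  proof -
    have i: "integrable lborel (\<lambda>x. norm (f (x + s n) - f x))" "integrable lborel (\<lambda>x. norm (g (x + s n) - g x))"
      using add by (auto intro!: integrable_norm Bochner_Integration.integrable_diff integrable_translate)
    have "(\<integral>x. norm (f (x + s n) + g (x + s n) - (f x + g x)) \<partial>lborel) \<le>
        (\<integral>x. norm (f (x + s n) - f x) + norm (g (x + s n) - g x) \<partial>lborel)"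
    proof (rule integral_mono)
      show "integrable lborel (\<lambda>x. norm (f (x + s n) + g (x + s n) - (f x + g x)))"
        using add by (intro integrable_norm Bochner_Integration.integrable_diff Bochner_Integration.integrable_add integrable_translate)
      show "norm (f (x + s n) + g (x + s n) - (f x + g x)) \<le> norm (f (x + s n) - f x) + norm (g (x + s n) - g x)" for x
        using norm_triangle_ineq[of "f (x + s n) - f x" "g (x + s n) - g x"] by (simp add: algebra_simps)
    qed (use i in auto)
    then show ?thesis using i by simp
  qed
  then have le: "norm (\<integral>x. norm (f (x + s n) + g (x + s n) - (f x + g x)) \<partial>lborel) \<le>
      (\<integral>x. norm (f (x + s n) - f x) \<partial>lborel) + (\<integral>x. norm (g (x + s n) - g x) \<partial>lborel)" for n
    by simp
  have lim: "(\<lambda>n. (\<integral>x. norm (f (x + s n) - f x) \<partial>lborel) + (\<integral>x. norm (g (x + s n) - g x) \<partial>lborel)) \<longlonglongrightarrow> 0"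
    using add by (auto intro: tendsto_add_zero)
  show ?case by (rule Lim_null_comparison[OF always_eventually[OF allI[OF le]] lim])
next
  case (lim f S)
  note [measurable] = borel_measurable_integrable[OF lim.hyps(1)] borel_measurable_integrable[OF lim.hyps(4)]
  have L1: "(\<lambda>i. \<integral>x. norm (S i x - f x) \<partial>lborel) \<longlonglongrightarrow> (\<integral>x. 0 \<partial>(lborel :: real measure))"
  \<comment> \<open>The approximants satisfy the bound 2 times the norm of \<open>f\<close>, whence
    the factor 3 for the difference.\<close>
  proof (rule integral_dominated_convergence[where w="\<lambda>x. 3 * norm (f x)"])
    show "AE x in lborel. (\<lambda>i. norm (S i x - f x)) \<longlonglongrightarrow> 0"
      using lim.hyps(2) by (auto intro!: tendsto_norm_zero LIM_zero)
    show "AE x in lborel. norm (norm (S i x - f x)) \<le> 3 * norm (f x)" for i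
    proof (rule AE_I2)
      fix x
      show "norm (norm (S i x - f x)) \<le> 3 * norm (f x)"
        using norm_triangle_ineq4[of "S i x" "f x"] lim.hyps(3)[of x i] by simp
    qed
  qed (use lim.hyps in auto)
  show ?case
  proof (rule LIMSEQ_I)
    fix e :: real assume e: "0 < e"
    have "\<forall>\<^sub>F i in sequentially. (\<integral>x. norm (S i x - f x) \<partial>lborel) < e / 3"
      using L1 e by (intro order_tendstoD(2)[where y=0]) auto
    then obtain i where i: "(\<integral>x. norm (S i x - f x) \<partial>lborel) < e / 3"
      by (auto simp: eventually_sequentially)
    have "\<forall>\<^sub>F n in sequentially. (\<integral>x. norm (S i (x + s n) - S i x) \<partial>lborel) < e / 3"
      using lim.IH[of i] e by (intro order_tendstoD(2)[where y=0]) auto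
    then obtain N where N: "\<And>n. N \<le> n \<Longrightarrow> (\<integral>x. norm (S i (x + s n) - S i x) \<partial>lborel) < e / 3"
      by (auto simp: eventually_sequentially)
    have "norm ((\<integral>x. norm (f (x + s n) - f x) \<partial>lborel) - 0) < e" if "N \<le> n" for n
    proof -
      let ?d = "\<lambda>x. norm (S i x - f x)"
      have d: "integrable lborel ?d" using lim.hyps by (intro integrable_norm Bochner_Integration.integrable_diff)
      have d': "integrable lborel (\<lambda>x. ?d (x + s n))" by (rule integrable_translate[OF d])
      have m: "integrable lborel (\<lambda>x. norm (S i (x + s n) - S i x))"
        using lim.hyps by (intro integrable_norm Bochner_Integration.integrable_diff integrable_translate)
      have "(\<integral>x. norm (f (x + s n) - f x) \<partial>lborel) \<le>
          (\<integral>x. ?d (x + s n) + norm (S i (x + s n) - S i x) + ?d x \<partial>lborel)"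
      proof (rule integral_mono)
        show "integrable lborel (\<lambda>x. norm (f (x + s n) - f x))"
          using lim.hyps by (intro integrable_norm Bochner_Integration.integrable_diff integrable_translate)
        show "norm (f (x + s n) - f x) \<le> ?d (x + s n) + norm (S i (x + s n) - S i x) + ?d x" for x
          using norm_triangle_ineq[of "f (x + s n) - S i (x + s n)" "S i (x + s n) - S i x + (S i x - f x)"]
            norm_triangle_ineq[of "S i (x + s n) - S i x" "S i x - f x"]
          by (simp add: norm_minus_commute)
      qed (use d d' m in auto)
      also have "\<dots> = (\<integral>x. ?d x \<partial>lborel) + (\<integral>x. norm (S i (x + s n) - S i x) \<partial>lborel) + (\<integral>x. ?d x \<partial>lborel)"
        using d d' m integral_translate[of ?d "s n"] by simp
      also have "\<dots> < e / 3 + e / 3 + e / 3"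
        by (intro add_strict_mono i N that)
      finally show ?thesis by simp
    qed
    then show "\<exists>no. \<forall>n\<ge>no. norm ((\<integral>x. norm (f (x + s n) - f x) \<partial>lborel) - 0) < e" by blast
  qed
qed

text \<open>Licenses Fubini's theorem for the convolution. After shifting the variable the density
  depends on \<open>s\<close> alone, while the inner integral is bounded uniformly in
  \<open>s\<close> by translation invariance.\<close>

lemma integrable_normal_pair:
  fixes h \<Psi> :: "real \<Rightarrow> complex"
  assumes Psi: "integrable lborel \<Psi>" and h[measurable]: "h \<in> borel_measurable borel"
    and b: "AE t in lborel. cmod (h t) \<le> c" and e: "\<epsilon> > 0"
  shows "integrable (lborel \<Otimes>\<^sub>M lborel) (\<lambda>(s, l). of_real (normal_density 0 \<epsilon> s) * (h l * \<Psi> (l + s)))"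
proof (rule lborel_pair.Fubini_integrable)
  note [measurable] = borel_measurable_integrable[OF Psi]
  show "(\<lambda>(s, l). of_real (normal_density 0 \<epsilon> s) * (h l * \<Psi> (l + s))) \<in> borel_measurable (lborel \<Otimes>\<^sub>M lborel)"
    by measurable
  have bs: "AE l in lborel. norm (h l * \<Psi> (l + s)) \<le> norm (c * cmod (\<Psi> (l + s)))" for s
    using b
  proof eventually_elim
    case (elim l)
    then have "norm (h l * \<Psi> (l + s)) \<le> c * cmod (\<Psi> (l + s))" by (simp add: norm_mult mult_right_mono)
    then show ?case by simp
  qed
  have iP: "integrable lborel (\<lambda>l. c * cmod (\<Psi> (l + s)))" for s
    by (intro integrable_mult_right integrable_norm integrable_translate Psi)
  have i: "integrable lborel (\<lambda>l. h l * \<Psi> (l + s))" for s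
    by (rule Bochner_Integration.integrable_bound[OF iP _ bs]) measurable
  then show "AE s in lborel. integrable lborel (\<lambda>l. case (s, l) of (s, l) \<Rightarrow> of_real (normal_density 0 \<epsilon> s) * (h l * \<Psi> (l + s)))"
    by simp
  have le: "(\<integral>l. norm (h l * \<Psi> (l + s)) \<partial>lborel) \<le> \<bar>c\<bar> * (\<integral>l. cmod (\<Psi> l) \<partial>lborel)" for s
  proof -
    have "(\<integral>l. norm (h l * \<Psi> (l + s)) \<partial>lborel) \<le> (\<integral>l. \<bar>c\<bar> * cmod (\<Psi> (l + s)) \<partial>lborel)"
      using bs[of s] by (intro integral_mono_AE integrable_norm i integrable_mult_right integrable_translate Psi)
        (simp_all add: abs_mult)
    also have "\<dots> = \<bar>c\<bar> * (\<integral>l. cmod (\<Psi> l) \<partial>lborel)"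
      using integral_translate[of "\<lambda>l. cmod (\<Psi> l)" s] by simp
    finally show ?thesis .
  qed
  show "integrable lborel (\<lambda>s. \<integral>l. norm (case (s, l) of (s, l) \<Rightarrow> of_real (normal_density 0 \<epsilon> s) * (h l * \<Psi> (l + s))) \<partial>lborel)"
  proof (rule Bochner_Integration.integrable_bound[where f="\<lambda>s. normal_density 0 \<epsilon> s * (\<bar>c\<bar> * (\<integral>l. cmod (\<Psi> l) \<partial>lborel))"])
    show "integrable lborel (\<lambda>s. normal_density 0 \<epsilon> s * (\<bar>c\<bar> * (\<integral>l. cmod (\<Psi> l) \<partial>lborel)))"
      using e by (intro integrable_mult_left) auto
    show "AE s in lborel. norm (\<integral>l. norm (case (s, l) of (s, l) \<Rightarrow> of_real (normal_density 0 \<epsilon> s) * (h l * \<Psi> (l + s))) \<partial>lborel) \<le>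
        norm (normal_density 0 \<epsilon> s * (\<bar>c\<bar> * (\<integral>l. cmod (\<Psi> l) \<partial>lborel)))"
      using le by (auto simp: norm_mult[of "complex_of_real _"] abs_mult mult_left_mono)
  qed measurable
qed

text \<open>With \<open>h\<close> merely bounded and \<open>\<Psi>\<close> merely integrable, the
  limit is taken in the pairing: \<open>G\<close> is bounded, and continuous at 0 because
  translation is continuous in the mean. Rescaling by \<open>\<epsilon> n\<close> presents the
  pairing as an average of \<open>G (\<epsilon> n * z)\<close> against the fixed standard normal
  density.\<close>

lemma normal_convolution_tendsto:
  fixes h \<Psi> :: "real \<Rightarrow> complex"
  assumes Psi: "integrable lborel \<Psi>" and h[measurable]: "h \<in> borel_measurable borel"
    and b: "AE t in lborel. cmod (h t) \<le> c" and e: "\<epsilon> \<longlonglongrightarrow> 0" "\<And>n. \<epsilon> n > 0"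
  shows "(\<lambda>n. \<integral>l. h l * (\<integral>u. \<Psi> u * of_real (normal_density 0 (\<epsilon> n) (u - l)) \<partial>lborel) \<partial>lborel)
    \<longlonglongrightarrow> (\<integral>l. h l * \<Psi> l \<partial>lborel)"
proof -
  note [measurable] = borel_measurable_integrable[OF Psi]
  define G where "G s = (\<integral>l. h l * \<Psi> (l + s) \<partial>lborel)" for s
  have [measurable]: "G \<in> borel_measurable borel" unfolding G_def[abs_def] by measurable
  have iP: "integrable lborel (\<lambda>l. h l * \<Psi> (l + s))" for s
    using integrable_mult_bounded[OF integrable_translate[OF Psi] _ b] by (simp add: mult.commute)
  have ae: "AE l in lborel. norm (h l * z l) \<le> \<bar>c\<bar> * norm (z l)" for z :: "real \<Rightarrow> complex"
    using b
  proof eventually_elim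
    case (elim l)
    then have "cmod (h l) \<le> \<bar>c\<bar>" by simp
    then show ?case by (simp add: norm_mult mult_right_mono)
  qed
  have G_bound: "cmod (G s) \<le> \<bar>c\<bar> * (\<integral>l. cmod (\<Psi> l) \<partial>lborel)" for s
  proof -
    have "cmod (G s) \<le> (\<integral>l. norm (h l * \<Psi> (l + s)) \<partial>lborel)" unfolding G_def by (rule integral_norm_bound)
    also have "\<dots> \<le> (\<integral>l. \<bar>c\<bar> * cmod (\<Psi> (l + s)) \<partial>lborel)"
      by (intro integral_mono_AE integrable_norm iP integrable_mult_right integrable_translate Psi ae)
    also have "\<dots> = \<bar>c\<bar> * (\<integral>l. cmod (\<Psi> l) \<partial>lborel)"
      using integral_translate[of "\<lambda>l. cmod (\<Psi> l)" s] by simp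
    finally show ?thesis .
  qed
  have G_cont: "(\<lambda>n. G (s n)) \<longlonglongrightarrow> G 0" if s: "s \<longlonglongrightarrow> 0" for s
  proof (rule LIM_zero_cancel, rule Lim_null_comparison)
    show "(\<lambda>n. \<bar>c\<bar> * (\<integral>l. norm (\<Psi> (l + s n) - \<Psi> l) \<partial>lborel)) \<longlonglongrightarrow> 0"
      using tendsto_mult[OF tendsto_const translation_tendsto[OF Psi s]] by simp
    have "norm (G (s n) - G 0) \<le> \<bar>c\<bar> * (\<integral>l. norm (\<Psi> (l + s n) - \<Psi> l) \<partial>lborel)" for n
    proof -
      have "G (s n) - G 0 = (\<integral>l. h l * (\<Psi> (l + s n) - \<Psi> l) \<partial>lborel)"
        using iP[of "s n"] iP[of 0] by (simp add: G_def right_diff_distrib)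
      also have "norm \<dots> \<le> (\<integral>l. norm (h l * (\<Psi> (l + s n) - \<Psi> l)) \<partial>lborel)" by (rule integral_norm_bound)
      also have "\<dots> \<le> (\<integral>l. \<bar>c\<bar> * norm (\<Psi> (l + s n) - \<Psi> l) \<partial>lborel)"
      proof (intro integral_mono_AE integrable_norm integrable_mult_right ae)
        show "integrable lborel (\<lambda>l. h l * (\<Psi> (l + s n) - \<Psi> l))"
          using iP[of "s n"] iP[of 0] by (simp add: right_diff_distrib)
        show "integrable lborel (\<lambda>l. \<Psi> (l + s n) - \<Psi> l)"
          by (intro Bochner_Integration.integrable_diff integrable_translate Psi)
      qed
      finally show ?thesis by simp
    qed
    then show "\<forall>\<^sub>F n in sequentially. norm (G (s n) - G 0) \<le> \<bar>c\<bar> * (\<integral>l. norm (\<Psi> (l + s n) - \<Psi> l) \<partial>lborel)"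
      by simp
  qed
  have eq: "(\<integral>l. h l * (\<integral>u. \<Psi> u * of_real (normal_density 0 (\<epsilon> n) (u - l)) \<partial>lborel) \<partial>lborel) =
      (\<integral>z. of_real (std_normal_density z) * G (\<epsilon> n * z) \<partial>lborel)" for n
  proof -
    have "(\<integral>u. \<Psi> u * of_real (normal_density 0 (\<epsilon> n) (u - l)) \<partial>lborel) =
        (\<integral>s. \<Psi> (l + s) * of_real (normal_density 0 (\<epsilon> n) s) \<partial>lborel)" for l
      by (subst lborel_integral_real_affine[where c=1 and t=l]) auto
    then have "(\<integral>l. h l * (\<integral>u. \<Psi> u * of_real (normal_density 0 (\<epsilon> n) (u - l)) \<partial>lborel) \<partial>lborel) =
        (\<integral>l. \<integral>s. of_real (normal_density 0 (\<epsilon> n) s) * (h l * \<Psi> (l + s)) \<partial>lborel \<partial>lborel)"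
      by (simp add: mult_ac flip: integral_mult_right_zero)
    also have "\<dots> = (\<integral>s. \<integral>l. of_real (normal_density 0 (\<epsilon> n) s) * (h l * \<Psi> (l + s)) \<partial>lborel \<partial>lborel)"
      by (rule lborel_pair.Fubini_integral[OF integrable_normal_pair[OF Psi h b e(2)]])
    also have "\<dots> = (\<integral>s. of_real (normal_density 0 (\<epsilon> n) s) * G s \<partial>lborel)"
      by (simp add: G_def)
    also have "\<dots> = \<epsilon> n *\<^sub>R (\<integral>z. of_real (normal_density 0 (\<epsilon> n) (\<epsilon> n * z)) * G (\<epsilon> n * z) \<partial>lborel)"
      using e(2)[of n] by (subst lborel_integral_real_affine[where c="\<epsilon> n" and t=0]) auto
    also have "\<dots> = (\<integral>z. of_real (std_normal_density z) * G (\<epsilon> n * z) \<partial>lborel)"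
    proof -
      have "\<epsilon> n * normal_density 0 (\<epsilon> n) (\<epsilon> n * z) = std_normal_density z" for z
        using e(2)[of n] by (simp add: normal_density_def real_sqrt_mult power_mult_distrib)
      then have "of_real (std_normal_density z) * G (\<epsilon> n * z) = \<epsilon> n *\<^sub>R (of_real (normal_density 0 (\<epsilon> n) (\<epsilon> n * z)) * G (\<epsilon> n * z))" for z
        by (simp add: scaleR_conv_of_real mult.assoc[symmetric] flip: of_real_mult)
      then show ?thesis by simp
    qed
    finally show ?thesis .
  qed
  have "(\<lambda>n. \<integral>z. of_real (std_normal_density z) * G (\<epsilon> n * z) \<partial>lborel) \<longlonglongrightarrow>
      (\<integral>z. of_real (std_normal_density z) * G 0 \<partial>lborel)"
  proof (rule integral_dominated_convergence[where w="\<lambda>z. std_normal_density z * (\<bar>c\<bar> * (\<integral>l. cmod (\<Psi> l) \<partial>lborel))"])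
    show "AE z in lborel. (\<lambda>n. of_real (std_normal_density z) * G (\<epsilon> n * z)) \<longlonglongrightarrow> of_real (std_normal_density z) * G 0"
      using e(1) by (auto intro!: tendsto_mult tendsto_const G_cont tendsto_mult_left_zero)
    show "AE z in lborel. norm (of_real (std_normal_density z) * G (\<epsilon> n * z)) \<le>
        std_normal_density z * (\<bar>c\<bar> * (\<integral>l. cmod (\<Psi> l) \<partial>lborel))" for n
      using G_bound by (auto simp: norm_mult intro!: mult_left_mono)
    show "integrable lborel (\<lambda>z. std_normal_density z * (\<bar>c\<bar> * (\<integral>l. cmod (\<Psi> l) \<partial>lborel)))"
      by (intro integrable_mult_left) auto
  qed auto
  moreover have "(\<integral>z. complex_of_real (std_normal_density z) * G 0 \<partial>lborel) = (\<integral>l. h l * \<Psi> l \<partial>lborel)"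
    by (simp add: G_def)
  ultimately show ?thesis unfolding eq by simp
qed

text \<open>In the regularized Parseval identity the kernel is evaluated only at distances at least
  \<open>d\<close>, where the narrowing normal density tends to 0 uniformly; integrability of the
  product allows the Gaussian to be removed.\<close>

lemma FT_orthogonal_separated:
  assumes x: "integrable lborel x" and y: "integrable lborel y" and d: "0 < d"
    and sep: "\<And>u v. x u \<noteq> 0 \<Longrightarrow> y v \<noteq> 0 \<Longrightarrow> d \<le> \<bar>u - v\<bar>"
    and int: "integrable lborel (\<lambda>\<omega>. FT x \<omega> * cnj (FT y \<omega>))"
  shows "(\<integral>\<omega>. FT x \<omega> * cnj (FT y \<omega>) \<partial>lborel) = 0"
proof (rule LIMSEQ_unique)
  note [measurable] = borel_measurable_integrable[OF x] borel_measurable_integrable[OF y]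
  define e where "e n = inverse (real (Suc n))" for n
  have e: "e \<longlonglongrightarrow> 0" "\<And>n. 0 < e n"
    unfolding e_def[abs_def] by (rule LIMSEQ_inverse_real_of_nat) simp
  let ?J = "\<lambda>n. \<integral>\<omega>. FT x \<omega> * cnj (FT y \<omega>) * gauss (e n) \<omega> \<partial>lborel"
  show "?J \<longlonglongrightarrow> (\<integral>\<omega>. FT x \<omega> * cnj (FT y \<omega>) \<partial>lborel)"
  proof (rule integral_dominated_convergence[where w="\<lambda>\<omega>. norm (FT x \<omega> * cnj (FT y \<omega>))"])
    have "(\<lambda>n. FT x \<omega> * cnj (FT y \<omega>) * gauss (e n) \<omega>) \<longlonglongrightarrow> FT x \<omega> * cnj (FT y \<omega>) * gauss 0 \<omega>" for \<omega>
      unfolding gauss_def by (intro tendsto_intros e) auto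
    then show "AE \<omega> in lborel. (\<lambda>n. FT x \<omega> * cnj (FT y \<omega>) * gauss (e n) \<omega>) \<longlonglongrightarrow> FT x \<omega> * cnj (FT y \<omega>)"
      by (simp add: gauss_def)
    show "AE \<omega> in lborel. norm (FT x \<omega> * cnj (FT y \<omega>) * gauss (e n) \<omega>) \<le> norm (FT x \<omega> * cnj (FT y \<omega>))" for n
    proof (rule AE_I2)
      fix \<omega>
      show "norm (FT x \<omega> * cnj (FT y \<omega>) * gauss (e n) \<omega>) \<le> norm (FT x \<omega> * cnj (FT y \<omega>))"
        unfolding norm_mult[of _ "gauss _ _"] using gauss_bound by (rule mult_left_le) simp
    qed
  qed (use int in auto)
  define N where "N n = normal_density 0 (e n) d" for n
  have bound: "norm (?J n) \<le> 2 * pi * ((\<integral>u. cmod (x u) \<partial>lborel) * (\<integral>v. cmod (y v) \<partial>lborel)) * N n" for n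
  proof -
    let ?in = "\<lambda>u. \<integral>v. cnj (y v) * of_real (normal_density 0 (e n) (u - v)) \<partial>lborel"
    let ?Y = "\<integral>v. cmod (y v) \<partial>lborel"
    have N0: "0 \<le> N n" by (simp add: N_def)
    have dens: "normal_density 0 (e n) (u - v) \<le> N n" if "d \<le> \<bar>u - v\<bar>" for u v
    proof -
      have "d\<^sup>2 \<le> (u - v)\<^sup>2" using that d by (simp add: abs_le_square_iff[symmetric])
      then show ?thesis
        using e(2)[of n] by (auto simp: N_def normal_density_def divide_right_mono intro!: mult_left_mono)
    qed
    have inner: "cmod (x u * ?in u) \<le> cmod (x u) * (?Y * N n)" for u
    proof (cases "x u = 0")
      case False
      have "cmod (?in u) \<le> (\<integral>v. cmod (y v) * N n \<partial>lborel)"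
      proof (rule Bochner_Integration.integral_norm_bound_integral)
        show le: "norm (cnj (y v) * of_real (normal_density 0 (e n) (u - v))) \<le> cmod (y v) * N n" for v
          using dens[OF sep[OF False]] by (cases "y v = 0") (auto simp: norm_mult)
        show yN: "integrable lborel (\<lambda>v. cmod (y v) * N n)" using y by simp
        show "integrable lborel (\<lambda>v. cnj (y v) * of_real (normal_density 0 (e n) (u - v)))"
          by (rule Bochner_Integration.integrable_bound[OF yN]) (use le N0 in \<open>auto simp: abs_mult\<close>)
      qed
      then show ?thesis by (simp add: norm_mult mult_left_mono)
    qed simp
    have "cmod (\<integral>u. x u * ?in u \<partial>lborel) \<le> (\<integral>u. cmod (x u) * (?Y * N n) \<partial>lborel)"
    proof (rule Bochner_Integration.integral_norm_bound_integral)
      show xN: "integrable lborel (\<lambda>u. cmod (x u) * (?Y * N n))" using x by simp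
      show "integrable lborel (\<lambda>u. x u * ?in u)"
        by (rule Bochner_Integration.integrable_bound[OF xN]) (use inner N0 in \<open>auto simp: abs_mult\<close>)
    qed (rule inner)
    then show ?thesis
      unfolding FT_inner_gauss[OF x y e(2)] by (simp add: norm_mult mult_ac)
  qed
  have N: "N \<longlonglongrightarrow> 0"
  proof -
    \<comment> \<open>With \<open>z\<close> the exponent, \<open>exp (- z) \<le> 1 / z\<close> is of
      order \<open>e n\<close> squared, which outweighs the prefactor of order
      \<open>1 / e n\<close>.\<close>
    have le: "norm (N n) \<le> 2 / (sqrt (2 * pi) * d\<^sup>2) * e n" for n
    proof -
      define z where "z = d\<^sup>2 / (2 * (e n)\<^sup>2)"
      have z: "0 < z" using d e(2)[of n] by (simp add: z_def)
      have "z \<le> exp z" using exp_ge_add_one_self[of z] by linarith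
      then have "exp (- z) \<le> 1 / z" using z by (simp add: exp_minus field_simps)
      also have "1 / z = 2 * (e n)\<^sup>2 / d\<^sup>2" by (simp add: z_def)
      finally have "1 / (sqrt (2 * pi) * e n) * exp (- z) \<le> 1 / (sqrt (2 * pi) * e n) * (2 * (e n)\<^sup>2 / d\<^sup>2)"
        using e(2)[of n] by (intro mult_left_mono) auto
      also have "\<dots> = 2 / (sqrt (2 * pi) * d\<^sup>2) * e n"
        using e(2)[of n] by (simp add: power2_eq_square)
      also have "1 / (sqrt (2 * pi) * e n) * exp (- z) = N n"
        using e(2)[of n] by (simp add: N_def normal_density_def z_def real_sqrt_mult)
      finally show ?thesis by (simp add: N_def)
    qed
    have "(\<lambda>n. 2 / (sqrt (2 * pi) * d\<^sup>2) * e n) \<longlonglongrightarrow> 0"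
      by (rule tendsto_mult_right_zero[OF e(1)])
    then show ?thesis
      by (rule Lim_null_comparison[OF always_eventually[OF allI[OF le]]])
  qed
  show "?J \<longlonglongrightarrow> 0"
  proof (rule Lim_null_comparison[OF always_eventually[OF allI[OF bound]]])
    show "(\<lambda>n. 2 * pi * ((\<integral>u. cmod (x u) \<partial>lborel) * (\<integral>v. cmod (y v) \<partial>lborel)) * N n) \<longlonglongrightarrow> 0"
      using tendsto_mult[OF tendsto_const N] by simp
  qed
qed

section \<open>Pointwise vanishing of the inverse transform away from the support\<close>

lemma cmod_cis_diff_le: "cmod (cis x - cis y) \<le> \<bar>x - y\<bar>"
proof -
  have "cis x - cis y = cis y * (cis (x - y) - 1)"
    by (simp add: right_diff_distrib cis_mult)
  also have "cmod \<dots> \<le> \<bar>x - y\<bar>"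
    using iexp_approx1[of "x - y" 0] by (simp add: norm_mult cis_conv_exp)
  finally show ?thesis .
qed

lemma FT_indicator:
  assumes d: "0 < d"
  shows "integrable lborel (indicator {t..t + d} :: real \<Rightarrow> complex)"
    and "indicator {t..t + d} \<in> L2 lborel"
    and "cmod (FT (indicator {t..t + d}) \<omega>) \<le> d"
    and "cmod (FT (indicator {t..t + d}) \<omega> - of_real d * cis (t * \<omega>)) \<le> d * (d * \<bar>\<omega>\<bar>)"
proof -
  let ?I = "indicator {t..t + d}"
  have m: "measure lborel {t..t + d} = d" using d by simp
  have ir: "integrable lborel (?I :: real \<Rightarrow> real)" using d by (intro integrable_real_indicator) auto
  have Ic: "(?I :: real \<Rightarrow> complex) = (\<lambda>u. of_real (?I u))" by (auto simp: indicator_def)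
  then show i: "integrable lborel (?I :: real \<Rightarrow> complex)" using integrable_of_real[OF ir] by simp
  have sq: "(\<lambda>u. (cmod (?I u))\<^sup>2) = (?I :: real \<Rightarrow> real)" by (auto simp: indicator_def)
  show "?I \<in> L2 lborel" using ir by (simp add: L2_def sq)
  have n1: "(\<lambda>u. cmod (?I u)) = (?I :: real \<Rightarrow> real)" by (auto simp: indicator_def)
  show "cmod (FT ?I \<omega>) \<le> d"
    using FT_bound[of ?I \<omega>] m by (simp add: n1)
  have "FT ?I \<omega> - of_real d * cis (t * \<omega>) = (\<integral>u. ?I u * cis (u * \<omega>) \<partial>lborel) - (\<integral>u. ?I u * cis (t * \<omega>) \<partial>lborel)"
  proof -
    have "(\<integral>u. ?I u \<partial>lborel) = complex_of_real (\<integral>u. ?I u \<partial>lborel)"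
      unfolding Ic integral_complex_of_real ..
    also have "\<dots> = of_real d" using m by simp
    finally show ?thesis by (simp add: FT_def)
  qed
  also have "\<dots> = (\<integral>u. ?I u * cis (u * \<omega>) - ?I u * cis (t * \<omega>) \<partial>lborel)"
    using i integrable_cis[OF i] by (subst Bochner_Integration.integral_diff) auto
  finally have eq: "FT ?I \<omega> - of_real d * cis (t * \<omega>) = (\<integral>u. ?I u * cis (u * \<omega>) - ?I u * cis (t * \<omega>) \<partial>lborel)" .
  have "cmod (FT ?I \<omega> - of_real d * cis (t * \<omega>)) \<le> (\<integral>u. ?I u * (d * \<bar>\<omega>\<bar>) \<partial>lborel)"
    unfolding eq
  proof (rule Bochner_Integration.integral_norm_bound_integral)
    show "integrable lborel (\<lambda>u. ?I u * cis (u * \<omega>) - ?I u * cis (t * \<omega>))"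
      using i integrable_cis[OF i] by (intro Bochner_Integration.integrable_diff) auto
    show "integrable lborel (\<lambda>u. ?I u * (d * \<bar>\<omega>\<bar>))" using ir by simp
    fix u
    show "cmod (?I u * cis (u * \<omega>) - ?I u * cis (t * \<omega>)) \<le> ?I u * (d * \<bar>\<omega>\<bar>)"
    proof (cases "u \<in> {t..t + d}")
      case True
      have "cmod (cis (u * \<omega>) - cis (t * \<omega>)) \<le> \<bar>u * \<omega> - t * \<omega>\<bar>" by (rule cmod_cis_diff_le)
      also have "\<dots> = \<bar>u - t\<bar> * \<bar>\<omega>\<bar>" by (simp add: abs_mult[symmetric] left_diff_distrib)
      also have "\<dots> \<le> d * \<bar>\<omega>\<bar>" using True by (intro mult_right_mono) auto
      finally show ?thesis using True by simp
    qed simp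
  qed
  also have "\<dots> = d * (d * \<bar>\<omega>\<bar>)" using m by simp
  finally show "cmod (FT ?I \<omega> - of_real d * cis (t * \<omega>)) \<le> d * (d * \<bar>\<omega>\<bar>)" .
qed

text \<open>
  \<open>Y\<close> is tested against the transforms of the indicators of \<open>[t, t + d]\<close>; divided by \<open>d\<close> they tend
  boundedly to \<open>cis (t\<omega>)\<close>, which makes the pointwise value of the inverse transform accessible.
\<close>

lemma fourier_L2_vanishing:
  assumes y: "y \<in> L2 lborel" and Y: "fourier_L2 y Y" and int: "integrable lborel Y"
    and r: "0 < r" and van: "\<And>u. \<bar>u - t\<bar> < r \<Longrightarrow> y u = 0"
  shows "(\<integral>\<omega>. Y \<omega> * cnj (cis (t * \<omega>)) \<partial>lborel) = 0"
proof (rule LIMSEQ_unique)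
  note [measurable] = borel_measurable_integrable[OF int]
  define d where "d n = r / 2 * inverse (real (Suc n))" for n
  have d0: "0 < d n" for n using r by (simp add: d_def)
  have dr: "d n \<le> r / 2" for n
    using mult_left_mono[of "inverse (real (Suc n))" 1 "r / 2"] r by (simp add: d_def inverse_le_1_iff)
  have dlim: "d \<longlonglongrightarrow> 0"
    unfolding d_def[abs_def] using tendsto_mult[OF tendsto_const LIMSEQ_inverse_real_of_nat] by simp
  define \<theta> where "\<theta> n = (indicator {t..t + d n} :: real \<Rightarrow> complex)" for n
  note ind = FT_indicator[where t=t, OF d0, folded \<theta>_def]
  have \<theta>L: "FT (\<theta> n) \<in> L2 lborel" for n by (intro FT_bessel(1) ind)
  note [measurable] = L2_measurable[OF \<theta>L]
  have YL: "Y \<in> L2 lborel" using Y by (simp add: fourier_L2_def)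
  \<comment> \<open>The intervals have length at most \<open>r / 2\<close>, so they keep distance at
    least \<open>r / 2\<close> from the support of each truncation of \<open>y\<close>;
    orthogonality then passes to the limit in mean.\<close>
  have zero: "(\<integral>\<omega>. Y \<omega> * cnj (FT (\<theta> n) \<omega>) \<partial>lborel) = 0" for n
  proof -
    have "(\<lambda>m. \<integral>\<omega>. FT (clip m y) \<omega> * cnj (FT (\<theta> n) \<omega>) \<partial>lborel) \<longlonglongrightarrow> (\<integral>\<omega>. Y \<omega> * cnj (FT (\<theta> n) \<omega>) \<partial>lborel)"
      by (rule L2_inner_tendsto) (use Y YL \<theta>L FT_clip_L2[OF y] in \<open>auto simp: fourier_L2_def L2_norm_def\<close>)
    moreover have "(\<integral>\<omega>. FT (clip m y) \<omega> * cnj (FT (\<theta> n) \<omega>) \<partial>lborel) = 0" for m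
    proof (rule FT_orthogonal_separated[where d="r / 2"])
      show "r / 2 \<le> \<bar>u - v\<bar>" if "clip m y u \<noteq> 0" "\<theta> n v \<noteq> 0" for u v
      proof -
        have "r \<le> \<bar>u - t\<bar>" using van[of u] that(1) by (cases "\<bar>u - t\<bar> < r") (auto simp: clip_def)
        moreover have "t \<le> v" "v \<le> t + d n" using that(2) by (auto simp: \<theta>_def indicator_def split: if_splits)
        ultimately show ?thesis using dr[of n] by linarith
      qed
    qed (use r in \<open>auto intro: clip_integrable y ind L2_mult_integrable FT_clip_L2 \<theta>L\<close>)
    ultimately show ?thesis by (simp add: LIMSEQ_const_iff)
  qed
  let ?e = "\<lambda>n \<omega>. of_real (1 / d n) * FT (\<theta> n) \<omega>"
  show "(\<lambda>n. \<integral>\<omega>. Y \<omega> * cnj (?e n \<omega>) \<partial>lborel) \<longlonglongrightarrow> (\<integral>\<omega>. Y \<omega> * cnj (cis (t * \<omega>)) \<partial>lborel)"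
  proof (rule integral_dominated_convergence[where w="\<lambda>\<omega>. cmod (Y \<omega>)"])
    show "AE \<omega> in lborel. (\<lambda>n. Y \<omega> * cnj (?e n \<omega>)) \<longlonglongrightarrow> Y \<omega> * cnj (cis (t * \<omega>))"
    proof (rule AE_I2)
      fix \<omega>
      have le: "cmod (?e n \<omega> - cis (t * \<omega>)) \<le> d n * \<bar>\<omega>\<bar>" for n
      proof -
        have "?e n \<omega> - cis (t * \<omega>) = of_real (1 / d n) * (FT (\<theta> n) \<omega> - of_real (d n) * cis (t * \<omega>))"
          using d0[of n] by (simp add: right_diff_distrib)
        then have "cmod (?e n \<omega> - cis (t * \<omega>)) = (1 / d n) * cmod (FT (\<theta> n) \<omega> - of_real (d n) * cis (t * \<omega>))"
          using d0[of n] by (simp only: norm_mult norm_of_real) simp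
        also have "\<dots> \<le> (1 / d n) * (d n * (d n * \<bar>\<omega>\<bar>))"
          using d0[of n] by (intro mult_left_mono ind) auto
        finally show ?thesis using d0[of n] by simp
      qed
      have "(\<lambda>n. d n * \<bar>\<omega>\<bar>) \<longlonglongrightarrow> 0" using tendsto_mult[OF dlim tendsto_const] by simp
      from Lim_null_comparison[OF always_eventually[OF allI[OF le]] this]
      have "(\<lambda>n. ?e n \<omega>) \<longlonglongrightarrow> cis (t * \<omega>)" by (rule LIM_zero_cancel)
      then show "(\<lambda>n. Y \<omega> * cnj (?e n \<omega>)) \<longlonglongrightarrow> Y \<omega> * cnj (cis (t * \<omega>))"
        by (intro tendsto_mult tendsto_const tendsto_cnj)
    qed
    show "AE \<omega> in lborel. norm (Y \<omega> * cnj (?e n \<omega>)) \<le> cmod (Y \<omega>)" for n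
    proof (rule AE_I2)
      fix \<omega>
      have "cmod (?e n \<omega>) \<le> 1" using ind(3)[of n \<omega>] d0[of n] by (simp add: norm_divide)
      then show "norm (Y \<omega> * cnj (?e n \<omega>)) \<le> cmod (Y \<omega>)"
        unfolding norm_mult complex_mod_cnj by (rule mult_left_le) simp
    qed
  qed (use int in auto)
  have "(\<integral>\<omega>. Y \<omega> * cnj (?e n \<omega>) \<partial>lborel) = 0" for n
    using zero[of n] integral_mult_right_zero[of lborel "of_real (1 / d n)" "\<lambda>\<omega>. Y \<omega> * cnj (FT (\<theta> n) \<omega>)"]
    by (simp add: mult.left_commute)
  then show "(\<lambda>n. \<integral>\<omega>. Y \<omega> * cnj (?e n \<omega>) \<partial>lborel) \<longlonglongrightarrow> 0" by (simp add: zero)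
qed


section \<open>Spectral measures\<close>

lemma spectral_density_measurable: "spectral_density f \<Longrightarrow> f \<in> borel_measurable borel"
  by (auto simp: spectral_density_def dest: borel_measurable_integrable)

lemma spectral_density_nonneg: "spectral_density f \<Longrightarrow> 0 \<le> f \<omega>"
  by (simp add: spectral_density_def)

lemma spectral_density_integrable: "spectral_density f \<Longrightarrow> integrable lborel f"
  by (simp add: spectral_density_def)

lemma sets_spectral_measure [measurable_cong, simp]: "sets (spectral_measure f g) = sets borel"
  by (simp add: spectral_measure_def)

lemma finite_spectral_measure:
  assumes "spectral_density f" "spectral_density g"
  shows "finite_measure (spectral_measure f g)"
proof (rule finite_measureI)
  note [measurable] = assms[THEN spectral_density_measurable]
  have "integrable lborel (\<lambda>\<omega>. f \<omega> + g \<omega>)"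
    using assms by (simp add: spectral_density_def)
  then have "(\<integral>\<^sup>+\<omega>. ennreal (f \<omega> + g \<omega>) \<partial>lborel) = ennreal (\<integral>\<omega>. f \<omega> + g \<omega> \<partial>lborel)"
    using assms by (intro nn_integral_eq_integral) (auto simp: spectral_density_def)
  then show "emeasure (spectral_measure f g) (space (spectral_measure f g)) \<noteq> \<infinity>"
    by (simp add: spectral_measure_def emeasure_density)
qed

lemma
  fixes F :: "real \<Rightarrow> 'b::{banach, second_countable_topology}"
  assumes fg: "spectral_density f" "spectral_density g" and F: "F \<in> borel_measurable borel"
  shows integral_spectral_measure:
      "(\<integral>\<omega>. F \<omega> \<partial>spectral_measure f g) = (\<integral>\<omega>. (f \<omega> + g \<omega>) *\<^sub>R F \<omega> \<partial>lborel)"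
    and integrable_spectral_measure:
      "integrable (spectral_measure f g) F \<longleftrightarrow> integrable lborel (\<lambda>\<omega>. (f \<omega> + g \<omega>) *\<^sub>R F \<omega>)"
proof -
  note [measurable] = fg[THEN spectral_density_measurable] F
  have nn: "AE \<omega> in lborel. 0 \<le> f \<omega> + g \<omega>" using fg by (simp add: spectral_density_def)
  show "(\<integral>\<omega>. F \<omega> \<partial>spectral_measure f g) = (\<integral>\<omega>. (f \<omega> + g \<omega>) *\<^sub>R F \<omega> \<partial>lborel)"
    unfolding spectral_measure_def by (rule integral_density) (use nn in auto)
  show "integrable (spectral_measure f g) F \<longleftrightarrow> integrable lborel (\<lambda>\<omega>. (f \<omega> + g \<omega>) *\<^sub>R F \<omega>)"
    unfolding spectral_measure_def by (rule integrable_density) (use nn in auto)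
qed

lemma AE_spectral_measureI:
  assumes fg: "spectral_density f" "spectral_density g" and "AE \<omega> in lborel. P \<omega>"
  shows "AE \<omega> in spectral_measure f g. P \<omega>"
proof -
  note [measurable] = fg[THEN spectral_density_measurable]
  have "(\<lambda>\<omega>. ennreal (f \<omega> + g \<omega>)) \<in> borel_measurable lborel" by measurable
  from AE_density[OF this] assms(3) show ?thesis
    unfolding spectral_measure_def by auto
qed

lemma L2_spectral_measurable: "h \<in> L2 (spectral_measure f g) \<Longrightarrow> h \<in> borel_measurable borel"
  using L2_measurable measurable_cong_sets[OF sets_spectral_measure refl] by blast

lemma L2_spectral_bounded:
  assumes fg: "spectral_density f" "spectral_density g" and h: "h \<in> borel_measurable borel"
    and b: "AE \<omega> in lborel. cmod (h \<omega>) \<le> c"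
  shows "h \<in> L2 (spectral_measure f g)"
proof (rule L2_bounded_finite_measure[OF finite_spectral_measure[OF fg] _ AE_spectral_measureI[OF fg b]])
  show "h \<in> borel_measurable (spectral_measure f g)"
    using h measurable_cong_sets[OF sets_spectral_measure refl] by blast
qed

lemma trig_polys_subset_L2_spectral:
  assumes "spectral_density f" "spectral_density g"
  shows "trig_polys U \<subseteq> L2 (spectral_measure f g)"
  by (rule trig_polys_subset_L2[OF finite_spectral_measure[OF assms] sets_spectral_measure])

lemma L2_integrable_bounded:
  assumes x: "integrable M x" and b: "AE t in M. cmod (x t) \<le> c"
  shows "x \<in> L2 M"
proof -
  note [measurable] = borel_measurable_integrable[OF x]
  have "integrable M (\<lambda>t. (cmod (x t))\<^sup>2)"
  proof (rule Bochner_Integration.integrable_bound[where f="\<lambda>t. c * cmod (x t)"])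
    show "AE t in M. norm ((cmod (x t))\<^sup>2) \<le> norm (c * cmod (x t))"
      using b
    proof eventually_elim
      case (elim t)
      then have "(cmod (x t))\<^sup>2 \<le> c * cmod (x t)" by (simp add: power2_eq_square mult_right_mono)
      then show ?case by simp
    qed
  qed (use x in auto)
  then show ?thesis by (simp add: L2_def)
qed

lemma L2s_memI:
  assumes fg: "spectral_density f" "spectral_density g"
    and T: "T \<in> sets borel" and U: "U = - T"
    and h: "h \<in> borel_measurable borel" and b: "AE \<omega> in lborel. cmod (h \<omega>) \<le> c"
    and orth: "\<And>k. k \<in> L2 (restrict_space lborel T) \<Longrightarrow> (\<integral>\<omega>. h \<omega> * cnj (fourier T k \<omega>) \<partial>lborel) = 0"
  shows "h \<in> L2s U f g"
  unfolding L2s_eq_closure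
proof (rule L2_closureI_orthogonal)
  let ?M = "spectral_measure f g"
  show "complex_subspace (trig_polys U)" by (rule complex_subspace_trig_polys)
  show "trig_polys U \<subseteq> L2 ?M" by (rule trig_polys_subset_L2_spectral[OF fg])
  show "h \<in> L2 ?M" by (rule L2_spectral_bounded[OF fg h b])
  fix \<phi> assume phi: "\<phi> \<in> L2 ?M" and orth_V: "\<And>q. q \<in> trig_polys U \<Longrightarrow> (\<integral>t. q t * cnj (\<phi> t) \<partial>?M) = 0"
  note [measurable] = fg[THEN spectral_density_measurable] L2_spectral_measurable[OF phi] h
  define \<Psi> where "\<Psi> \<omega> = (f \<omega> + g \<omega>) *\<^sub>R cnj (\<phi> \<omega>)" for \<omega>
  have one: "(\<lambda>_. 1) \<in> L2 ?M" by (rule L2_spectral_bounded[OF fg, where c=1]) auto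
  have "integrable ?M (\<lambda>\<omega>. 1 * cnj (\<phi> \<omega>))" by (rule L2_mult_integrable(2)[OF one phi])
  then have "integrable lborel (\<lambda>\<omega>. (f \<omega> + g \<omega>) *\<^sub>R (1 * cnj (\<phi> \<omega>)))"
    by (subst (asm) integrable_spectral_measure[OF fg]) (auto simp del: mult_1)
  then have Psi: "integrable lborel \<Psi>"
    by (simp only: \<Psi>_def[abs_def] mult_1)
  note [measurable] = borel_measurable_integrable[OF Psi]
  have FT0: "FT \<Psi> t = 0" if "t \<in> U" for t
  proof -
    have "0 = (\<integral>\<omega>. cis (t * \<omega>) * cnj (\<phi> \<omega>) \<partial>?M)"
      using orth_V[OF cis_in_trig_polys[OF that]] by simp
    also have "\<dots> = (\<integral>\<omega>. (f \<omega> + g \<omega>) *\<^sub>R (cis (t * \<omega>) * cnj (\<phi> \<omega>)) \<partial>lborel)"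
      by (rule integral_spectral_measure[OF fg]) measurable
    also have "\<dots> = FT \<Psi> t"
      unfolding FT_def by (intro Bochner_Integration.integral_cong) (auto simp: \<Psi>_def mult_ac scaleR_conv_of_real)
    finally show ?thesis by simp
  qed
  define e where "e n = inverse (real (Suc n))" for n
  have e: "e \<longlonglongrightarrow> 0" "\<And>n. 0 < e n"
    unfolding e_def[abs_def] by (rule LIMSEQ_inverse_real_of_nat) simp
  \<comment> \<open>The conjugate compensates the one in \<open>orth\<close>:
    \<open>cnj (FT (k n))\<close> is \<open>2 * pi\<close> times the convolution of
    \<open>\<Psi>\<close> with a normal density.\<close>
  define k where "k n t = cnj (FT \<Psi> t * gauss (e n) t)" for n t
  have ik: "integrable lborel (k n)" for n
    unfolding k_def[abs_def] by (intro integrable_cnj integrable_FT_gauss Psi e)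
  have kL: "k n \<in> L2 lborel" for n
  proof (rule L2_integrable_bounded[OF ik, where c="\<integral>u. cmod (\<Psi> u) \<partial>lborel"], rule AE_I2)
    fix t
    have "cmod (k n t) \<le> cmod (FT \<Psi> t)"
      unfolding k_def complex_mod_cnj norm_mult using gauss_bound by (rule mult_left_le) simp
    then show "cmod (k n t) \<le> (\<integral>u. cmod (\<Psi> u) \<partial>lborel)" using FT_bound by (rule order_trans)
  qed
  \<comment> \<open>By \<open>FT0\<close> the function already vanishes at every point off T, so it
    is an element of L2(T) without being cut off.\<close>
  have ext: "ext_by_zero T (k n) = k n" for n
    using FT0 U by (auto simp: ext_by_zero_def k_def fun_eq_iff)
  have kT: "k n \<in> L2 (restrict_space lborel T)" for n
    using kL by (simp add: L2_restrict_iff[OF T] ext)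
  have conv: "cnj (FT (k n) l) = 2 * of_real pi * (\<integral>u. \<Psi> u * of_real (normal_density 0 (e n) (u - l)) \<partial>lborel)" for n l
  proof -
    have "cnj (FT (k n) l) = (\<integral>u. FT \<Psi> (- u) * gauss (e n) (- u) * cis (u * l) \<partial>lborel)"
      unfolding cnj_FT FT_def[of "\<lambda>u. cnj (k n (- u))"] by (simp add: k_def)
    also have "\<dots> = FT (\<lambda>t. FT \<Psi> t * gauss (e n) t) (- l)"
      unfolding FT_def[of "\<lambda>t. FT \<Psi> t * gauss (e n) t"]
      by (subst lborel_integral_real_affine[where c="-1" and t=0]) auto
    finally show ?thesis unfolding FT_FT_gauss[OF Psi e(2)] by simp
  qed
  have zero: "(\<integral>l. h l * (\<integral>u. \<Psi> u * of_real (normal_density 0 (e n) (u - l)) \<partial>lborel) \<partial>lborel) = 0" for n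
  proof -
    have "fourier_L2 (k n) (fourier T (k n))" using fourier_fourier_L2[OF T kT[of n]] by (simp add: ext)
    from fourier_L2_unique[OF kL this fourier_L2_FT[OF ik kL]]
    have ae: "AE \<omega> in lborel. fourier T (k n) \<omega> = FT (k n) \<omega>" .
    have [measurable]: "fourier T (k n) \<in> borel_measurable borel" "k n \<in> borel_measurable borel"
      using \<open>fourier_L2 (k n) (fourier T (k n))\<close> L2_measurable[of _ "lborel :: real measure"] borel_measurable_integrable[OF ik[of n]]
      by (auto simp: fourier_L2_def)
    have "0 = (\<integral>\<omega>. h \<omega> * cnj (fourier T (k n) \<omega>) \<partial>lborel)" using orth[OF kT] by simp
    also have "\<dots> = (\<integral>\<omega>. h \<omega> * cnj (FT (k n) \<omega>) \<partial>lborel)"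
    proof (rule integral_cong_AE)
      show "AE \<omega> in lborel. h \<omega> * cnj (fourier T (k n) \<omega>) = h \<omega> * cnj (FT (k n) \<omega>)"
        using ae by eventually_elim simp
    qed measurable
    finally show ?thesis unfolding conv by (simp add: mult.left_commute[of "h _"] mult.assoc)
  qed
  have "(\<integral>l. h l * \<Psi> l \<partial>lborel) = 0"
    using normal_convolution_tendsto[OF Psi h b e] unfolding zero
    by (rule LIMSEQ_unique[OF _ tendsto_const])
  moreover have "(\<integral>t. h t * cnj (\<phi> t) \<partial>?M) = (\<integral>l. h l * \<Psi> l \<partial>lborel)"
    by (subst integral_spectral_measure[OF fg]) (auto simp: \<Psi>_def)
  ultimately show "(\<integral>t. h t * cnj (\<phi> t) \<partial>?M) = 0" by simp
qed


section \<open>The mean-square error\<close>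

text \<open>Completing the square in \<open>h\<close>. Where \<open>f + g\<close> is 0 both
  densities vanish, and so do both sides.\<close>

lemma mse_pointwise:
  fixes a h :: complex and f g :: real
  assumes "0 \<le> f" "0 \<le> g"
  shows "(cmod (a - h))\<^sup>2 * f + (cmod h)\<^sup>2 * g =
    (f + g) * (cmod (a * of_real (f / (f + g)) - h))\<^sup>2 + (cmod a)\<^sup>2 * (f * g / (f + g))"
proof (cases "f + g = 0")
  case True
  then show ?thesis using assms by (simp add: add_nonneg_eq_0_iff)
next
  case False
  define s p where "s = f + g" and "p = f / (f + g)"
  have f: "f = s * p" and g: "g = s * (1 - p)" using False by (simp_all add: s_def p_def field_simps)
  have "s \<noteq> 0" using False by (simp add: s_def)
  then have fg: "f * g / s = s * (p * (1 - p))"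
    by (subst f, subst g) simp
  have "(cmod (a - h))\<^sup>2 * (s * p) + (cmod h)\<^sup>2 * (s * (1 - p)) =
      s * (cmod (a * of_real p - h))\<^sup>2 + (cmod a)\<^sup>2 * (s * (p * (1 - p)))"
    unfolding cmod_power2 by (simp add: power2_eq_square algebra_simps)
  then show ?thesis
    unfolding f[symmetric] g[symmetric] fg[symmetric] unfolding p_def s_def .
qed

text \<open>The noncausal Wiener filter, which minimizes the error pointwise in the frequency;
  restricting the observations amounts to projecting it onto \<open>L2s U f g\<close>.\<close>

definition wiener :: "(real \<Rightarrow> complex) \<Rightarrow> (real \<Rightarrow> real) \<Rightarrow> (real \<Rightarrow> real) \<Rightarrow> real \<Rightarrow> complex" where
  "wiener A f g \<omega> = A \<omega> * of_real (f \<omega> / (f \<omega> + g \<omega>))"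

lemma share_le_1:
  assumes "0 \<le> f" "0 \<le> (g :: real)"
  shows "\<bar>f / (f + g)\<bar> \<le> 1"
  using assms by (cases "f + g = 0") (auto simp: field_simps)

lemma wiener_L2:
  assumes fg: "spectral_density f" "spectral_density g"
    and A: "A \<in> borel_measurable borel" "\<And>\<omega>. cmod (A \<omega>) \<le> c"
  shows "wiener A f g \<in> L2 (spectral_measure f g)"
proof (rule L2_spectral_bounded[OF fg, where c=c])
  note [measurable] = fg[THEN spectral_density_measurable] A(1)
  show "wiener A f g \<in> borel_measurable borel" unfolding wiener_def[abs_def] by measurable
  show "AE \<omega> in lborel. cmod (wiener A f g \<omega>) \<le> c"
  proof (rule AE_I2)
    fix \<omega>
    have "cmod (wiener A f g \<omega>) \<le> cmod (A \<omega>)"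
      unfolding wiener_def norm_mult norm_of_real
      by (rule mult_left_le[OF share_le_1[OF fg[THEN spectral_density_nonneg]]]) simp
    then show "cmod (wiener A f g \<omega>) \<le> c" using A(2) by (rule order_trans)
  qed
qed

lemma mse_integrable:
  assumes fg: "spectral_density f" "spectral_density g"
    and A: "A_fun R a \<in> borel_measurable borel" "\<And>\<omega>. cmod (A_fun R a \<omega>) \<le> c"
    and h: "h \<in> L2 (spectral_measure f g)"
  shows "integrable lborel (\<lambda>\<omega>. (cmod (A_fun R a \<omega> - h \<omega>))\<^sup>2 * f \<omega>)"
    and "integrable lborel (\<lambda>\<omega>. (cmod (h \<omega>))\<^sup>2 * g \<omega>)"
proof -
  note [measurable] = fg[THEN spectral_density_measurable] A(1) L2_spectral_measurable[OF h]
  have le: "integrable lborel (\<lambda>\<omega>. (cmod (z \<omega>))\<^sup>2 * p \<omega>)"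
    if z: "z \<in> L2 (spectral_measure f g)" and p: "p = f \<or> p = g" for z p
  proof -
    note [measurable] = L2_spectral_measurable[OF z]
    have [measurable]: "p \<in> borel_measurable borel" using p by auto
    have "integrable lborel (\<lambda>\<omega>. (f \<omega> + g \<omega>) *\<^sub>R (cmod (z \<omega>))\<^sup>2)"
      using L2_integrable[OF z] by (subst (asm) integrable_spectral_measure[OF fg]) auto
    then show ?thesis
      by (rule Bochner_Integration.integrable_bound)
         (use p fg[THEN spectral_density_nonneg] in \<open>auto simp: abs_mult mult.commute intro!: AE_I2 mult_right_mono\<close>)
  qed
  have "A_fun R a \<in> L2 (spectral_measure f g)"
    using A by (intro L2_spectral_bounded[OF fg]) auto
  then show "integrable lborel (\<lambda>\<omega>. (cmod (A_fun R a \<omega> - h \<omega>))\<^sup>2 * f \<omega>)"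
    by (intro le L2_diff h) auto
  show "integrable lborel (\<lambda>\<omega>. (cmod (h \<omega>))\<^sup>2 * g \<omega>)" by (intro le h) auto
qed

text \<open>Only the squared distance to the Wiener filter depends on \<open>h\<close>, so
  minimizing the error is best approximation in L2(f + g).\<close>

lemma mse_eq:
  assumes fg: "spectral_density f" "spectral_density g"
    and A: "A_fun R a \<in> borel_measurable borel" "\<And>\<omega>. cmod (A_fun R a \<omega>) \<le> c"
    and h: "h \<in> L2 (spectral_measure f g)"
  shows "mse R a f g h = 1 / (2 * pi) *
    ((L2_norm (spectral_measure f g) (\<lambda>\<omega>. wiener (A_fun R a) f g \<omega> - h \<omega>))\<^sup>2 +
     (\<integral>\<omega>. (cmod (A_fun R a \<omega>))\<^sup>2 * (f \<omega> * g \<omega> / (f \<omega> + g \<omega>)) \<partial>lborel))"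
proof -
  let ?v = "wiener (A_fun R a) f g"
  note [measurable] = fg[THEN spectral_density_measurable] A(1) L2_spectral_measurable[OF h]
  have vL: "?v \<in> L2 (spectral_measure f g)" by (rule wiener_L2[OF fg A])
  note [measurable] = L2_spectral_measurable[OF vL]
  have i1: "integrable lborel (\<lambda>\<omega>. (f \<omega> + g \<omega>) * (cmod (?v \<omega> - h \<omega>))\<^sup>2)"
    using L2_integrable[OF L2_diff[OF vL h]] by (subst (asm) integrable_spectral_measure[OF fg]) auto
  have i2: "integrable lborel (\<lambda>\<omega>. (cmod (A_fun R a \<omega>))\<^sup>2 * (f \<omega> * g \<omega> / (f \<omega> + g \<omega>)))"
  proof (rule Bochner_Integration.integrable_bound[where f="\<lambda>\<omega>. c\<^sup>2 * g \<omega>"])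
    show "AE \<omega> in lborel. norm ((cmod (A_fun R a \<omega>))\<^sup>2 * (f \<omega> * g \<omega> / (f \<omega> + g \<omega>))) \<le> norm (c\<^sup>2 * g \<omega>)"
    proof (rule AE_I2)
      fix \<omega>
      have "norm ((cmod (A_fun R a \<omega>))\<^sup>2 * (f \<omega> * g \<omega> / (f \<omega> + g \<omega>))) =
          (cmod (A_fun R a \<omega>))\<^sup>2 * (\<bar>f \<omega> / (f \<omega> + g \<omega>)\<bar> * \<bar>g \<omega>\<bar>)"
        by (simp add: abs_mult abs_divide)
      also have "\<dots> \<le> c\<^sup>2 * (1 * \<bar>g \<omega>\<bar>)"
      proof (rule mult_mono)
        show "(cmod (A_fun R a \<omega>))\<^sup>2 \<le> c\<^sup>2" by (rule power_mono[OF A(2)]) simp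
        show "\<bar>f \<omega> / (f \<omega> + g \<omega>)\<bar> * \<bar>g \<omega>\<bar> \<le> 1 * \<bar>g \<omega>\<bar>"
          by (rule mult_right_mono[OF share_le_1[OF fg[THEN spectral_density_nonneg]]]) simp
      qed simp_all
      finally show "norm ((cmod (A_fun R a \<omega>))\<^sup>2 * (f \<omega> * g \<omega> / (f \<omega> + g \<omega>))) \<le> norm (c\<^sup>2 * g \<omega>)"
        by (simp add: abs_mult)
    qed
  qed (use spectral_density_integrable[OF fg(2)] in auto)
  have "mse R a f g h = 1 / (2 * pi) *
      (\<integral>\<omega>. (cmod (A_fun R a \<omega> - h \<omega>))\<^sup>2 * f \<omega> + (cmod (h \<omega>))\<^sup>2 * g \<omega> \<partial>lborel)"
    unfolding mse_def Bochner_Integration.integral_add[OF mse_integrable[OF fg A h]]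
    by (rule distrib_left[symmetric])
  also have "(\<integral>\<omega>. (cmod (A_fun R a \<omega> - h \<omega>))\<^sup>2 * f \<omega> + (cmod (h \<omega>))\<^sup>2 * g \<omega> \<partial>lborel) =
      (\<integral>\<omega>. (f \<omega> + g \<omega>) * (cmod (?v \<omega> - h \<omega>))\<^sup>2 + (cmod (A_fun R a \<omega>))\<^sup>2 * (f \<omega> * g \<omega> / (f \<omega> + g \<omega>)) \<partial>lborel)"
    unfolding wiener_def
    by (intro Bochner_Integration.integral_cong mse_pointwise spectral_density_nonneg fg refl)
  also have "\<dots> = (\<integral>\<omega>. (f \<omega> + g \<omega>) * (cmod (?v \<omega> - h \<omega>))\<^sup>2 \<partial>lborel) +
      (\<integral>\<omega>. (cmod (A_fun R a \<omega>))\<^sup>2 * (f \<omega> * g \<omega> / (f \<omega> + g \<omega>)) \<partial>lborel)"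
    by (rule Bochner_Integration.integral_add[OF i1 i2])
  also have "(\<integral>\<omega>. (f \<omega> + g \<omega>) * (cmod (?v \<omega> - h \<omega>))\<^sup>2 \<partial>lborel) = (L2_norm (spectral_measure f g) (\<lambda>\<omega>. ?v \<omega> - h \<omega>))\<^sup>2"
    unfolding L2_norm_square by (subst integral_spectral_measure[OF fg]) auto
  finally show ?thesis .
qed

lemma mse_le_iff:
  assumes fg: "spectral_density f" "spectral_density g"
    and A: "A_fun R a \<in> borel_measurable borel" "\<And>\<omega>. cmod (A_fun R a \<omega>) \<le> c"
    and "h \<in> L2 (spectral_measure f g)" "h' \<in> L2 (spectral_measure f g)"
  shows "mse R a f g h \<le> mse R a f g h' \<longleftrightarrow>
    L2_norm (spectral_measure f g) (\<lambda>\<omega>. wiener (A_fun R a) f g \<omega> - h \<omega>) \<le>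
    L2_norm (spectral_measure f g) (\<lambda>\<omega>. wiener (A_fun R a) f g \<omega> - h' \<omega>)"
  unfolding mse_eq[OF fg A assms(5)] mse_eq[OF fg A assms(6)]
  by (simp add: divide_le_cancel power2_le_iff_abs_le)

text \<open>\<open>opt_char\<close> is a Hilbert choice; the existence of a best approximation makes
  it an actual minimizer that lies in the admissible subspace.\<close>

lemma opt_mse_le:
  assumes fg: "spectral_density f" "spectral_density g"
    and A: "A_fun R a \<in> borel_measurable borel" "\<And>\<omega>. cmod (A_fun R a \<omega>) \<le> c"
  shows "h \<in> L2s U f g \<Longrightarrow> opt_mse U R a f g \<le> mse R a f g h"
    and "opt_char U R a f g \<in> L2s U f g"
proof -
  let ?M = "spectral_measure f g" and ?v = "wiener (A_fun R a) f g"
  have vL: "?v \<in> L2 ?M" by (rule wiener_L2[OF fg A])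
  obtain p where p: "p \<in> L2s U f g"
    and min: "\<And>h. h \<in> L2s U f g \<Longrightarrow> L2_norm ?M (\<lambda>t. ?v t - p t) \<le> L2_norm ?M (\<lambda>t. ?v t - h t)"
    using L2_closure_best_approximation[OF complex_subspace_trig_polys trig_polys_subset_L2_spectral[OF fg] vL]
    unfolding L2s_eq_closure by blast
  have sub: "L2s U f g \<subseteq> L2 ?M" unfolding L2s_eq_closure by (rule L2_closure_subset)
  have "mse R a f g p \<le> mse R a f g h" if "h \<in> L2s U f g" for h
    using mse_le_iff[OF fg A, of p h] min[OF that] sub p that by blast
  then have "is_arg_min (mse R a f g) (\<lambda>x. x \<in> L2s U f g) p"
    using p by (auto simp: is_arg_min_def not_less)
  then have "is_arg_min (mse R a f g) (\<lambda>x. x \<in> L2s U f g) (opt_char U R a f g)"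
    unfolding opt_char_def arg_min_on_def arg_min_def
    by (rule someI[where P="is_arg_min (mse R a f g) (\<lambda>x. x \<in> L2s U f g)"])
  then show "opt_char U R a f g \<in> L2s U f g"
    and "h \<in> L2s U f g \<Longrightarrow> opt_mse U R a f g \<le> mse R a f g h"
    by (auto simp: is_arg_min_def opt_mse_def not_less)
qed

text \<open>The normal equations, tested on single exponentials, extend to the closed span by
  linearity and continuity; Pythagoras' theorem then gives the comparison.\<close>

lemma mse_minimal_if_orthogonal:
  assumes fg: "spectral_density f" "spectral_density g"
    and A: "A_fun R a \<in> borel_measurable borel" "\<And>\<omega>. cmod (A_fun R a \<omega>) \<le> c"
    and h0: "h0 \<in> L2s U f g"
    and orth: "\<And>t. t \<in> U \<Longrightarrow>
      (\<integral>\<omega>. cis (t * \<omega>) * cnj (wiener (A_fun R a) f g \<omega> - h0 \<omega>) \<partial>spectral_measure f g) = 0"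
    and h: "h \<in> L2s U f g"
  shows "mse R a f g h0 \<le> mse R a f g h"
proof -
  let ?M = "spectral_measure f g" and ?v = "wiener (A_fun R a) f g"
  have vL: "?v \<in> L2 ?M" by (rule wiener_L2[OF fg A])
  have sub: "L2s U f g \<subseteq> L2 ?M" unfolding L2s_eq_closure by (rule L2_closure_subset)
  have hL: "h \<in> L2 ?M" "h0 \<in> L2 ?M" using h h0 sub by auto
  define x y where "x t = ?v t - h0 t" and "y t = h t - h0 t" for t
  have x: "x \<in> L2 ?M" and y: "y \<in> L2 ?M"
    unfolding x_def[abs_def] y_def[abs_def] by (intro L2_diff vL hL)+
  have cisL: "(\<lambda>\<omega>. cis (t * \<omega>)) \<in> L2 ?M" for t
    using trig_polys_subset_L2_spectral[OF fg, of UNIV] cis_in_trig_polys[of t UNIV] by auto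
  have orth_V: "(\<integral>t. q t * cnj (x t) \<partial>?M) = 0" if q: "q \<in> trig_polys U" for q
  proof -
    obtain F c where F: "finite F" "F \<subseteq> U" "q = (\<lambda>\<omega>. \<Sum>t\<in>F. c t * cis (t * \<omega>))"
      using q by (auto simp: trig_polys_def)
    have "(\<integral>t. q t * cnj (x t) \<partial>?M) = (\<integral>\<omega>. (\<Sum>t\<in>F. c t * (cis (t * \<omega>) * cnj (x \<omega>))) \<partial>?M)"
      by (simp add: F(3) sum_distrib_right mult.assoc)
    also have "\<dots> = (\<Sum>t\<in>F. \<integral>\<omega>. c t * (cis (t * \<omega>) * cnj (x \<omega>)) \<partial>?M)"
      by (intro Bochner_Integration.integral_sum integrable_mult_right L2_mult_integrable cisL x)
    also have "\<dots> = (\<Sum>t\<in>F. c t * (\<integral>\<omega>. cis (t * \<omega>) * cnj (x \<omega>) \<partial>?M))"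
      by (simp only: integral_mult_right_zero)
    also have "\<dots> = 0"
      using orth F(2) unfolding x_def by (intro sum.neutral) auto
    finally show ?thesis .
  qed
  have orth': "(\<integral>t. k t * cnj (x t) \<partial>?M) = 0" if k: "k \<in> L2s U f g" for k
    by (rule L2_closure_orthogonal[OF trig_polys_subset_L2_spectral[OF fg] x _ k[unfolded L2s_eq_closure]])
       (rule orth_V)
  have "(\<integral>t. y t * cnj (x t) \<partial>?M) = (\<integral>t. h t * cnj (x t) \<partial>?M) - (\<integral>t. h0 t * cnj (x t) \<partial>?M)"
    unfolding y_def left_diff_distrib
    by (intro Bochner_Integration.integral_diff L2_mult_integrable hL x)
  also have "\<dots> = 0" using orth'[OF h] orth'[OF h0] by simp
  finally have "(L2_norm ?M (\<lambda>t. x t - y t))\<^sup>2 = (L2_norm ?M x)\<^sup>2 + (L2_norm ?M y)\<^sup>2"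
    using L2_norm_diff_square[OF x y] by simp
  then have "(L2_norm ?M x)\<^sup>2 \<le> (L2_norm ?M (\<lambda>t. x t - y t))\<^sup>2" by simp
  then have "L2_norm ?M x \<le> L2_norm ?M (\<lambda>t. x t - y t)" by (rule power2_le_imp_le) simp
  then show ?thesis
    unfolding mse_le_iff[OF fg A hL(2) hL(1)] by (simp add: x_def[abs_def] y_def)
qed

text \<open>A nontrivial entire function has countably many zeros, and elsewhere a zero of
  \<open>f + g\<close> would make the extended quotient infinite. Hence divisions by
  \<open>f + g\<close> are genuine almost everywhere.\<close>

lemma minimality_imp_positive:
  assumes fg: "spectral_density f" "spectral_density g" and min: "minimality f g"
  shows "AE \<omega> in lborel. 0 < f \<omega> + g \<omega>"
proof -
  note [measurable] = fg[THEN spectral_density_measurable]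
  obtain \<gamma> where hol: "\<gamma> holomorphic_on UNIV"
    and nz: "\<exists>\<omega>::real. \<gamma> (complex_of_real \<omega>) \<noteq> 0"
    and fin: "(\<integral>\<^sup>+\<omega>. ennreal ((cmod (\<gamma> (complex_of_real \<omega>)))\<^sup>2) / ennreal (f \<omega> + g \<omega>) \<partial>lborel) < \<infinity>"
    using min unfolding minimality_def exponential_type_def by blast
  have [measurable]: "(\<lambda>\<omega>::real. \<gamma> (complex_of_real \<omega>)) \<in> borel_measurable borel"
    by (rule borel_measurable_continuous_onI,
        rule continuous_on_compose2[OF holomorphic_on_imp_continuous_on[OF hol]])
       (auto intro!: continuous_intros)
  let ?Z = "{\<omega>::real. \<gamma> (complex_of_real \<omega>) = 0}"
  have "\<gamma> \<noteq> (\<lambda>_. 0)" using nz by auto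
  then have "countable {z. \<gamma> z = 0}"
    using holomorphic_countable_equal_UNIV[OF hol holomorphic_on_const[of 0]] by blast
  then have "countable (complex_of_real ` ?Z)"
    by (rule countable_subset[rotated]) blast
  then have "countable ?Z"
    by (rule countable_image_inj_on) (simp add: inj_on_def)
  from AE_not_in[OF countable_imp_null_set_lborel[OF this]]
  have "AE \<omega> in lborel. \<gamma> (complex_of_real \<omega>) \<noteq> 0" by simp
  moreover have "AE \<omega> in lborel. ennreal ((cmod (\<gamma> (complex_of_real \<omega>)))\<^sup>2) / ennreal (f \<omega> + g \<omega>) \<noteq> \<infinity>"
    using fin by (intro nn_integral_PInf_AE) (auto simp: top.not_eq_extremum)
  ultimately show ?thesis
  proof eventually_elim
    case (elim \<omega>)
    have "f \<omega> + g \<omega> \<noteq> 0"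
    proof
      assume "f \<omega> + g \<omega> = 0"
      then show False using elim by (simp add: ennreal_divide_eq_top_iff)
    qed
    then show ?case using spectral_density_nonneg[OF fg(1), of \<omega>] spectral_density_nonneg[OF fg(2), of \<omega>] by linarith
  qed
qed


section \<open>The operator \<open>B\<close>\<close>

lemma fourier_L2_space:
  assumes "T \<in> sets borel" "x \<in> L2 (restrict_space lborel T)"
  shows "fourier T x \<in> L2 lborel"
  using fourier_fourier_L2[OF assms] by (simp add: fourier_L2_def)

text \<open>Both sides of the weak equation for B are moved to the frequency side, the right one by
  the multiplication formula, and the factors \<open>1 / (2 * pi)\<close> cancel. The bracket in the
  conclusion is the candidate characteristic itself. \<open>A\<close> is tied to the transform only
  almost everywhere, since \<open>fourier\<close> is determined no better.\<close>

lemma B_graph_orthogonal: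
  assumes fg: "spectral_density f" "spectral_density g" and pos: "AE \<omega> in lborel. 0 < f \<omega> + g \<omega>"
    and T: "T \<in> sets borel" and b: "b \<in> L2 (restrict_space lborel T)"
    and A: "A \<in> borel_measurable borel" "AE \<omega> in lborel. fourier T b (- \<omega>) = A \<omega>"
  shows "R_op T f g b \<in> L2 (restrict_space lborel T)"
    and "B_graph T f g x (R_op T f g b) \<Longrightarrow> k \<in> B_form_domain T f g \<Longrightarrow>
      (\<integral>\<omega>. (wiener A f g \<omega> - fourier T x \<omega> / of_real (f \<omega> + g \<omega>)) * cnj (fourier T k \<omega>) \<partial>lborel) = 0"
proof -
  note [measurable] = fg[THEN spectral_density_measurable] A(1)
  define X where "X \<omega> = fourier T b (- \<omega>) * complex_of_real (f \<omega> / (f \<omega> + g \<omega>))" for \<omega>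
  have XL: "X \<in> L2 lborel"
  proof -
    have "(\<lambda>\<omega>. complex_of_real (f \<omega> / (f \<omega> + g \<omega>)) * fourier T b (- \<omega>)) \<in> L2 lborel"
    proof (rule L2_bounded_mult[where c=1])
      show "(\<lambda>\<omega>. fourier T b (- \<omega>)) \<in> L2 lborel" by (rule L2_reflect[OF fourier_L2_space[OF T b]])
      show "AE \<omega> in lborel. cmod (complex_of_real (f \<omega> / (f \<omega> + g \<omega>))) \<le> 1"
        unfolding norm_of_real by (rule AE_I2, rule share_le_1[OF fg[THEN spectral_density_nonneg]])
    qed measurable
    then show ?thesis by (simp add: X_def[abs_def] mult.commute)
  qed
  note [measurable] = L2_measurable[OF XL]
  have XU: "X \<in> L2 (restrict_space lborel UNIV)" "ext_by_zero UNIV X = X"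
    using XL by (simp_all add: L2_restrict_iff ext_by_zero_def[abs_def])
  define F where "F = fourier UNIV X"
  have F: "fourier_L2 X F" using fourier_fourier_L2[OF _ XU(1)] XU(2) by (simp add: F_def)
  then have FL: "F \<in> L2 lborel" by (simp add: fourier_L2_def)
  note [measurable] = L2_measurable[OF FL] T
  let ?y = "R_op T f g b"
  have y: "?y = (\<lambda>t. 1 / (2 * complex_of_real pi) * F (- t))"
    by (simp add: R_op_def F_def X_def[abs_def] fun_eq_iff)
  have "(\<lambda>t. indicator T t * (1 / (2 * complex_of_real pi) * F (- t))) \<in> L2 lborel"
    by (rule L2_bounded_mult[OF L2_cmult[OF L2_reflect[OF FL]], where c=1]) (auto simp: indicator_def)
  moreover have "ext_by_zero T ?y = (\<lambda>t. indicator T t * (1 / (2 * complex_of_real pi) * F (- t)))"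
    by (auto simp: ext_by_zero_def y)
  ultimately show "R_op T f g b \<in> L2 (restrict_space lborel T)"
    by (simp add: L2_restrict_iff[OF T])
  assume graph: "B_graph T f g x ?y" and k: "k \<in> B_form_domain T f g"
  have kL: "k \<in> L2 (restrict_space lborel T)" using k by (simp add: B_form_domain_def)
  have x: "x \<in> B_form_domain T f g" using graph by (simp add: B_graph_def)
  have xL: "x \<in> L2 (restrict_space lborel T)" using x by (simp add: B_form_domain_def)
  let ?K = "fourier T k" and ?C = "fourier T x"
  have KL: "?K \<in> L2 lborel" "?C \<in> L2 lborel" using fourier_L2_space[OF T] kL xL by auto
  note [measurable] = L2_measurable[OF KL(1)] L2_measurable[OF KL(2)]
  \<comment> \<open>Sharing the weight \<open>1 / (f + g)\<close> as a square root between both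
    factors turns the form into an inner product of L2 functions; this gives its
    integrability.\<close>
  have weighted: "(\<lambda>\<omega>. fourier T z \<omega> / of_real (sqrt (f \<omega> + g \<omega>))) \<in> L2 lborel" if z: "z \<in> B_form_domain T f g" for z
  proof -
    have zL: "fourier T z \<in> L2 lborel" using z fourier_L2_space[OF T] by (simp add: B_form_domain_def)
    note [measurable] = L2_measurable[OF zL]
    have "(\<integral>\<^sup>+\<omega>. ennreal ((cmod (fourier T z \<omega> / of_real (sqrt (f \<omega> + g \<omega>))))\<^sup>2) \<partial>lborel) =
        (\<integral>\<^sup>+\<omega>. ennreal ((cmod (fourier T z \<omega>))\<^sup>2) / ennreal (f \<omega> + g \<omega>) \<partial>lborel)"
    proof (rule nn_integral_cong_AE)
      show "AE \<omega> in lborel. ennreal ((cmod (fourier T z \<omega> / of_real (sqrt (f \<omega> + g \<omega>))))\<^sup>2) =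
          ennreal ((cmod (fourier T z \<omega>))\<^sup>2) / ennreal (f \<omega> + g \<omega>)"
        using pos by eventually_elim (simp add: norm_divide power_divide divide_ennreal)
    qed
    also have "\<dots> < \<infinity>" using z by (simp add: B_form_domain_def)
    finally have "integrable lborel (\<lambda>\<omega>. (cmod (fourier T z \<omega> / of_real (sqrt (f \<omega> + g \<omega>))))\<^sup>2)"
      by (intro integrableI_bounded) auto
    then show ?thesis by (simp add: L2_def)
  qed
  have CK_ae: "AE \<omega> in lborel. ?C \<omega> / of_real (sqrt (f \<omega> + g \<omega>)) * cnj (?K \<omega> / of_real (sqrt (f \<omega> + g \<omega>))) =
      ?C \<omega> * cnj (?K \<omega>) / of_real (f \<omega> + g \<omega>)"
    using pos
  proof eventually_elim
    case (elim \<omega>)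
    have "complex_of_real (sqrt (f \<omega> + g \<omega>)) * complex_of_real (sqrt (f \<omega> + g \<omega>)) = of_real (f \<omega> + g \<omega>)"
      using elim by (simp only: of_real_mult[symmetric] real_sqrt_mult_self) simp
    then show ?case by (simp del: of_real_add)
  qed
  have int1: "integrable lborel (\<lambda>\<omega>. ?C \<omega> * cnj (?K \<omega>) / of_real (f \<omega> + g \<omega>))"
    using L2_mult_integrable(2)[OF weighted[OF x] weighted[OF k]]
    by (rule integrable_cong_AE_imp) (use CK_ae in auto)
  have int2: "integrable lborel (\<lambda>\<omega>. X \<omega> * cnj (?K \<omega>))"
    by (rule L2_mult_integrable(2)[OF XL KL(1)])
  have kF: "fourier_L2 (ext_by_zero T k) ?K" "ext_by_zero T k \<in> L2 lborel"
    using fourier_fourier_L2[OF T kL] kL by (simp_all add: L2_restrict_iff[OF T])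
  have "1 / (2 * complex_of_real pi) * (\<integral>\<omega>. ?C \<omega> * cnj (?K \<omega>) / of_real (f \<omega> + g \<omega>) \<partial>lborel)
      = L2_inner (restrict_space lborel T) ?y k"
    by (rule bspec[OF graph[unfolded B_graph_def, THEN conjunct2, THEN conjunct2] k])
  also have "\<dots> = (\<integral>t. ext_by_zero T ?y t * cnj (ext_by_zero T k t) \<partial>lborel)"
    unfolding L2_inner_def by (rule integral_restrict_ext[OF T])
  also have "\<dots> = (\<integral>t. 1 / (2 * complex_of_real pi) * (F (- t) * cnj (ext_by_zero T k t)) \<partial>lborel)"
    by (intro Bochner_Integration.integral_cong) (auto simp: ext_by_zero_def y)
  also have "\<dots> = 1 / (2 * complex_of_real pi) * (\<integral>t. F (- t) * cnj (ext_by_zero T k t) \<partial>lborel)"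
    by (rule integral_mult_right_zero)
  also have "(\<integral>t. F (- t) * cnj (ext_by_zero T k t) \<partial>lborel) = (\<integral>\<omega>. X \<omega> * cnj (?K \<omega>) \<partial>lborel)"
    by (rule fourier_L2_multiplication[OF XL kF(2) F kF(1)])
  finally have eq: "(\<integral>\<omega>. ?C \<omega> * cnj (?K \<omega>) / of_real (f \<omega> + g \<omega>) \<partial>lborel) = (\<integral>\<omega>. X \<omega> * cnj (?K \<omega>) \<partial>lborel)"
    by simp
  have "(\<integral>\<omega>. (wiener A f g \<omega> - ?C \<omega> / of_real (f \<omega> + g \<omega>)) * cnj (?K \<omega>) \<partial>lborel) =
      (\<integral>\<omega>. X \<omega> * cnj (?K \<omega>) - ?C \<omega> * cnj (?K \<omega>) / of_real (f \<omega> + g \<omega>) \<partial>lborel)"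
  proof (rule integral_cong_AE)
    show "AE \<omega> in lborel. (wiener A f g \<omega> - ?C \<omega> / of_real (f \<omega> + g \<omega>)) * cnj (?K \<omega>) =
        X \<omega> * cnj (?K \<omega>) - ?C \<omega> * cnj (?K \<omega>) / of_real (f \<omega> + g \<omega>)"
      using A(2) by eventually_elim (simp add: X_def wiener_def left_diff_distrib del: of_real_add)
  qed (unfold wiener_def, measurable)
  also have "\<dots> = 0"
    unfolding Bochner_Integration.integral_diff[OF int2 int1] eq by simp
  finally show "(\<integral>\<omega>. (wiener A f g \<omega> - ?C \<omega> / of_real (f \<omega> + g \<omega>)) * cnj (?K \<omega>) \<partial>lborel) = 0" .
qed

text \<open>By the Bessel inequality, closeness in L2(T) is inherited by the transforms, and pairing
  with a fixed L2 function is continuous.\<close>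

lemma orthogonal_if_orthogonal_dense:
  assumes T: "T \<in> sets borel" and h: "h \<in> L2 lborel"
    and sub: "E \<subseteq> L2 (restrict_space lborel T)"
    and dense: "\<And>y e. y \<in> L2 (restrict_space lborel T) \<Longrightarrow> 0 < e \<Longrightarrow>
      \<exists>x\<in>E. (\<integral>t. (cmod (y t - x t))\<^sup>2 \<partial>restrict_space lborel T) < e"
    and orth: "\<And>x. x \<in> E \<Longrightarrow> (\<integral>\<omega>. h \<omega> * cnj (fourier T x \<omega>) \<partial>lborel) = 0"
    and k: "k \<in> L2 (restrict_space lborel T)"
  shows "(\<integral>\<omega>. h \<omega> * cnj (fourier T k \<omega>) \<partial>lborel) = 0"
proof -
  let ?I = "\<integral>\<omega>. h \<omega> * cnj (fourier T k \<omega>) \<partial>lborel"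
  \<comment> \<open>The summand 1 keeps \<open>B\<close> positive when \<open>h\<close> has norm
    0.\<close>
  define B where "B = L2_norm lborel h * sqrt (2 * pi) + 1"
  have B: "0 < B" unfolding B_def by (intro add_nonneg_pos mult_nonneg_nonneg) auto
  have "cmod ?I \<le> 0 + e" if e: "0 < e" for e
  proof -
    obtain x where x: "x \<in> E" and close: "(\<integral>t. (cmod (k t - x t))\<^sup>2 \<partial>restrict_space lborel T) < (e / B)\<^sup>2"
      using dense[OF k, of "(e / B)\<^sup>2"] e B by auto
    have xL: "x \<in> L2 (restrict_space lborel T)" using x sub by auto
    have KL: "fourier T k \<in> L2 lborel" "fourier T x \<in> L2 lborel"
      using fourier_L2_space[OF T] k xL by auto
    have ext: "ext_by_zero T k \<in> L2 lborel" "ext_by_zero T x \<in> L2 lborel"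
      using k xL by (simp_all add: L2_restrict_iff[OF T])
    have "(L2_norm (restrict_space lborel T) (\<lambda>t. k t - x t))\<^sup>2 < (e / B)\<^sup>2"
      using close by (simp add: L2_norm_square)
    from power_less_imp_less_base[OF this]
    have nd: "L2_norm (restrict_space lborel T) (\<lambda>t. k t - x t) < e / B"
      using e B by simp
    have "ext_by_zero T (\<lambda>t. k t - x t) = (\<lambda>t. ext_by_zero T k t - ext_by_zero T x t)"
      by (auto simp: ext_by_zero_def)
    then have nd': "L2_norm lborel (\<lambda>t. ext_by_zero T k t - ext_by_zero T x t) < e / B"
      using nd by (simp add: L2_norm_restrict[OF T])
    have "L2_norm lborel (\<lambda>\<omega>. fourier T k \<omega> - fourier T x \<omega>) \<le> sqrt (2 * pi) * L2_norm lborel (\<lambda>t. ext_by_zero T k t - ext_by_zero T x t)"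
      by (intro fourier_L2_bessel fourier_L2_diff L2_diff ext fourier_fourier_L2 T k xL)
    also have "\<dots> \<le> sqrt (2 * pi) * (e / B)" using nd' by (intro mult_left_mono) auto
    finally have le: "L2_norm lborel (\<lambda>\<omega>. fourier T k \<omega> - fourier T x \<omega>) \<le> sqrt (2 * pi) * (e / B)" .
    have "?I = (\<integral>\<omega>. h \<omega> * cnj (fourier T k \<omega> - fourier T x \<omega>) \<partial>lborel)"
      using orth[OF x] L2_mult_integrable(2)[OF h KL(1)] L2_mult_integrable(2)[OF h KL(2)]
      by (simp add: right_diff_distrib)
    then have "cmod ?I \<le> L2_norm lborel h * L2_norm lborel (\<lambda>\<omega>. fourier T k \<omega> - fourier T x \<omega>)"
      using L2_Cauchy_Schwarz[OF h L2_diff[OF KL]] by simp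
    also have "\<dots> \<le> L2_norm lborel h * (sqrt (2 * pi) * (e / B))"
      using le by (intro mult_left_mono) auto
    also have "\<dots> = (B - 1) * (e / B)" by (simp add: B_def)
    also have "\<dots> \<le> B * (e / B)" using e B by (intro mult_right_mono) auto
    also have "\<dots> = e" using B by simp
    finally show ?thesis by simp
  qed
  then have "cmod ?I \<le> 0" by (rule field_le_epsilon)
  then show ?thesis by simp
qed


section \<open>The saddle point\<close>

lemma T_set_borel: "T_set s N K \<in> sets borel"
  unfolding T_set_def S_set_def by (intro sets.Un sets.finite_UN) auto

lemma closed_T_set: "closed (T_set s N K)"
  unfolding T_set_def S_set_def by (intro closed_Un closed_UN) auto

lemma obs_set_eq: "obs_set s N K = - T_set s N K"
  by (auto simp: obs_set_def T_set_def)

text \<open>In the expansion of the square of \<open>f - f1\<close> around \<open>f0\<close>, the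
  square of \<open>f - f0\<close> is dropped; the cross term is then bounded by a difference of
  squares whose integral is nonpositive, because \<open>f0\<close> lies on the boundary of the ball.
  Convexity thus does the work of a multiplier theorem, with \<open>\<alpha>\<close> as
  multiplier.\<close>

lemma saddle_inequality:
  assumes f0: "f0 \<in> L2_neighbourhood f1 \<epsilon>" and f: "f \<in> L2_neighbourhood f1 \<epsilon>"
    and norm: "1 / (2 * pi) * (\<integral>\<omega>. \<bar>f0 \<omega> - f1 \<omega>\<bar>\<^sup>2 \<partial>lborel) = \<epsilon>"
    and eq: "AE \<omega> in lborel. u \<omega> = (f0 \<omega> - f1 \<omega>) * \<alpha>" and \<alpha>: "0 \<le> \<alpha>"
    and i: "integrable lborel (\<lambda>\<omega>. u \<omega> * f \<omega>)" "integrable lborel (\<lambda>\<omega>. u \<omega> * f0 \<omega>)"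
  shows "(\<integral>\<omega>. u \<omega> * f \<omega> \<partial>lborel) \<le> (\<integral>\<omega>. u \<omega> * f0 \<omega> \<partial>lborel)"
proof -
  have sq: "integrable lborel (\<lambda>\<omega>. \<bar>f0 \<omega> - f1 \<omega>\<bar>\<^sup>2)" "integrable lborel (\<lambda>\<omega>. \<bar>f \<omega> - f1 \<omega>\<bar>\<^sup>2)"
    and le: "1 / (2 * pi) * (\<integral>\<omega>. \<bar>f \<omega> - f1 \<omega>\<bar>\<^sup>2 \<partial>lborel) \<le> \<epsilon>"
    using f0 f by (auto simp: L2_neighbourhood_def)
  have "(\<integral>\<omega>. u \<omega> * f \<omega> \<partial>lborel) - (\<integral>\<omega>. u \<omega> * f0 \<omega> \<partial>lborel) = (\<integral>\<omega>. u \<omega> * f \<omega> - u \<omega> * f0 \<omega> \<partial>lborel)"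
    using i by simp
  also have "\<dots> \<le> (\<integral>\<omega>. \<alpha> / 2 * (\<bar>f \<omega> - f1 \<omega>\<bar>\<^sup>2 - \<bar>f0 \<omega> - f1 \<omega>\<bar>\<^sup>2) \<partial>lborel)"
  proof (rule integral_mono_AE)
    show "AE \<omega> in lborel. u \<omega> * f \<omega> - u \<omega> * f0 \<omega> \<le> \<alpha> / 2 * (\<bar>f \<omega> - f1 \<omega>\<bar>\<^sup>2 - \<bar>f0 \<omega> - f1 \<omega>\<bar>\<^sup>2)"
      using eq
    proof eventually_elim
      case (elim \<omega>)
      have "2 * ((f0 \<omega> - f1 \<omega>) * (f \<omega> - f0 \<omega>)) \<le> \<bar>f \<omega> - f1 \<omega>\<bar>\<^sup>2 - \<bar>f0 \<omega> - f1 \<omega>\<bar>\<^sup>2"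
        using zero_le_power2[of "f \<omega> - f0 \<omega>"] by (simp add: power2_eq_square algebra_simps)
      then have "\<alpha> / 2 * (2 * ((f0 \<omega> - f1 \<omega>) * (f \<omega> - f0 \<omega>))) \<le> \<alpha> / 2 * (\<bar>f \<omega> - f1 \<omega>\<bar>\<^sup>2 - \<bar>f0 \<omega> - f1 \<omega>\<bar>\<^sup>2)"
        using \<alpha> by (intro mult_left_mono) auto
      then show ?case unfolding elim by (simp add: algebra_simps)
    qed
  qed (use i sq in auto)
  also have "\<dots> = \<alpha> / 2 * ((\<integral>\<omega>. \<bar>f \<omega> - f1 \<omega>\<bar>\<^sup>2 \<partial>lborel) - (\<integral>\<omega>. \<bar>f0 \<omega> - f1 \<omega>\<bar>\<^sup>2 \<partial>lborel))"
    using sq by simp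
  also have "\<dots> \<le> 0"
    using le norm \<alpha> by (intro mult_nonneg_nonpos) (auto simp: divide_le_cancel)
  finally show ?thesis by simp
qed

text \<open>
  Writing \<open>h\<close> for the optimal characteristic, the functions \<open>h_f\<close> and \<open>h_g\<close> of the statement are
  \<open>|A - h|\<^sup>2\<close> and \<open>|h|\<^sup>2\<close>: the weights with which \<open>f\<close> and \<open>g\<close> enter the mean-square error of \<open>h\<close>.
\<close>

lemma optimal_characteristic_quotients:
  fixes A C :: complex and f g :: real
  assumes "f + g \<noteq> 0"
  shows "(cmod (A - (A * of_real (f / (f + g)) - C / of_real (f + g))))\<^sup>2 =
      (cmod (A * of_real g + C))\<^sup>2 / (f + g)\<^sup>2"
    and "(cmod (A * of_real (f / (f + g)) - C / of_real (f + g)))\<^sup>2 =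
      (cmod (A * of_real f - C))\<^sup>2 / (f + g)\<^sup>2"
  using assms
  by (simp_all add: cmod_power2 Re_divide Im_divide field_simps)
     (simp_all add: eval_nat_numeral algebra_simps)

theorem theorem4p2:
  fixes s :: nat and N K :: "nat \<Rightarrow> real"
    and T U R :: "real set"
    and a C0 h0 :: "real \<Rightarrow> complex"
    and f1 g1 f0 g0 :: "real \<Rightarrow> real"
    and \<epsilon>1 \<epsilon>2 \<alpha>1 \<alpha>2 :: real
    and D :: "((real \<Rightarrow> real) \<times> (real \<Rightarrow> real)) set"
  assumes sets: "admissible_intervals s N K"
    and T: "T = T_set s N K"
    and U: "U = obs_set s N K"
    and R: "R = R_set s N K"
    and weight: "admissible_weight T R a"
    and f1: "spectral_density f1" and g1: "spectral_density g1"
    and eps: "\<epsilon>1 > 0" "\<epsilon>2 > 0"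
    and D: "D = L2_neighbourhood f1 \<epsilon>1 \<times> L2_neighbourhood g1 \<epsilon>2"
    and f0: "f0 \<in> L2_neighbourhood f1 \<epsilon>1" and g0: "g0 \<in> L2_neighbourhood g1 \<epsilon>2"
    and minimal: "minimality f0 g0"
    and invertible: "B_invertible T f0 g0"
    and C0: "C0 = C_fun T R a f0 g0"
    and h_f_bounded: "\<exists>c. AE \<omega> in lborel.
          (cmod (A_fun R a \<omega> * g0 \<omega> + C0 \<omega>))\<^sup>2 / (f0 \<omega> + g0 \<omega>)\<^sup>2 \<le> c"
    and h_g_bounded: "\<exists>c. AE \<omega> in lborel.
          (cmod (A_fun R a \<omega> * f0 \<omega> - C0 \<omega>))\<^sup>2 / (f0 \<omega> + g0 \<omega>)\<^sup>2 \<le> c"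
    and alpha: "\<alpha>1 \<ge> 0" "\<alpha>2 \<ge> 0"
    and eq_f: "AE \<omega> in lborel. (cmod (A_fun R a \<omega> * g0 \<omega> + C0 \<omega>))\<^sup>2 =
          (f0 \<omega> + g0 \<omega>)\<^sup>2 * (f0 \<omega> - f1 \<omega>) * \<alpha>1"
    and eq_g: "AE \<omega> in lborel. (cmod (A_fun R a \<omega> * f0 \<omega> - C0 \<omega>))\<^sup>2 =
          (f0 \<omega> + g0 \<omega>)\<^sup>2 * (g0 \<omega> - g1 \<omega>) * \<alpha>2"
    and optimal: "\<forall>(f, g)\<in>D. error_value T U R a f g \<le> Re (operator_value T R a f0 g0)"
    and norm_f: "1 / (2 * pi) * (\<integral>\<omega>. \<bar>f0 \<omega> - f1 \<omega>\<bar>\<^sup>2 \<partial>lborel) = \<epsilon>1"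
    and norm_g: "1 / (2 * pi) * (\<integral>\<omega>. \<bar>g0 \<omega> - g1 \<omega>\<bar>\<^sup>2 \<partial>lborel) = \<epsilon>2"
    and h0: "h0 = (\<lambda>\<omega>. A_fun R a \<omega> * (f0 \<omega> / (f0 \<omega> + g0 \<omega>)) - C0 \<omega> / (f0 \<omega> + g0 \<omega>))"
  shows "least_favorable U R a D f0 g0 \<and> minimax_robust U R a D h0"
proof -
  have fD: "spectral_density f" if "f \<in> L2_neighbourhood f1 \<epsilon>1" for f
    using that by (simp add: L2_neighbourhood_def)
  have gD: "spectral_density g" if "g \<in> L2_neighbourhood g1 \<epsilon>2" for g
    using that by (simp add: L2_neighbourhood_def)
  note fg0 = fD[OF f0] gD[OF g0]
  have Tb: "T \<in> sets borel" and UT: "U = - T" and openU: "open U"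
    unfolding T U by (rule T_set_borel, rule obs_set_eq) (simp add: obs_set_eq closed_T_set open_Compl)
  have RT: "R \<subseteq> T" unfolding R T by (auto simp: R_set_def T_set_def)
  have pos: "AE \<omega> in lborel. 0 < f0 \<omega> + g0 \<omega>"
    by (rule minimality_imp_positive[OF fg0 minimal])

  \<comment> \<open>The extended weight and its transform\<close>
  define b where "b = ext_by_zero R a"
  have ib: "integrable lborel b"
    using weight by (simp add: b_def ext_by_zero_indicator admissible_weight_def set_integrable_def)
  have bT: "b \<in> L2 (restrict_space lborel T)"
    using weight by (simp add: b_def admissible_weight_def)
  have ext_b: "ext_by_zero T b = b" using RT by (auto simp: b_def ext_by_zero_def fun_eq_iff)
  have bL: "b \<in> L2 lborel" using bT by (simp add: L2_restrict_iff[OF Tb] ext_b)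
  define A where "A = A_fun R a"
  have A_eq: "A \<omega> = FT b (- \<omega>)" for \<omega>
    unfolding A_def A_fun_def FT_def set_lebesgue_integral_def b_def
    by (intro Bochner_Integration.integral_cong) (auto simp: ext_by_zero_def indicator_def)
  note [measurable] = borel_measurable_integrable[OF ib] fg0[THEN spectral_density_measurable]
  have Am[measurable]: "A \<in> borel_measurable borel" unfolding A_eq[abs_def] by measurable
  have Ab: "cmod (A \<omega>) \<le> (\<integral>u. cmod (b u) \<partial>lborel)" for \<omega> unfolding A_eq by (rule FT_bound)
  have four_b: "AE \<omega> in lborel. fourier T b (- \<omega>) = A \<omega>"
  proof -
    have [measurable]: "fourier T b \<in> borel_measurable borel"
      using L2_measurable[OF fourier_L2_space[OF Tb bT]] by simp
    have "AE \<omega> in lborel. fourier T b \<omega> = FT b \<omega>"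
      using fourier_L2_unique[OF bL fourier_fourier_L2[OF Tb bT, unfolded ext_b] fourier_L2_FT[OF ib bL]] .
    \<comment> \<open>Reflection preserves null sets, so the almost-everywhere identity may be
      evaluated at the negated frequency.\<close>
    from AE_borel_affine[OF _ _ this, of "-1" 0] show ?thesis by (simp add: A_eq)
  qed

  \<comment> \<open>The solution of the operator equation and its transform\<close>
  define x where "x = B_inv T f0 g0 (R_op T f0 g0 b)"
  have C0x: "C0 = fourier T x" by (simp add: C0 C_fun_def x_def b_def)
  have "\<exists>x. B_graph T f0 g0 x (R_op T f0 g0 b)"
    using invertible B_graph_orthogonal(1)[OF fg0 pos Tb bT Am four_b] unfolding B_invertible_def by metis
  then have graph: "B_graph T f0 g0 x (R_op T f0 g0 b)"
    unfolding x_def B_inv_def by (rule someI_ex)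
  then have xT: "x \<in> L2 (restrict_space lborel T)" by (simp add: B_graph_def B_form_domain_def)
  have C0L: "C0 \<in> L2 lborel" unfolding C0x by (rule fourier_L2_space[OF Tb xT])
  note [measurable] = L2_measurable[OF C0L]
  have h0_wiener: "h0 = (\<lambda>\<omega>. wiener A f0 g0 \<omega> - C0 \<omega> / of_real (f0 \<omega> + g0 \<omega>))"
    by (simp add: h0 wiener_def A_def)
  have h0m[measurable]: "h0 \<in> borel_measurable borel" unfolding h0_wiener wiener_def by measurable

  \<comment> \<open>The two error weights of \<open>h0\<close> expressed through the
    densities\<close>
  have h0_sq: "AE \<omega> in lborel. (cmod (h0 \<omega>))\<^sup>2 = (g0 \<omega> - g1 \<omega>) * \<alpha>2"
    and h0_quot: "AE \<omega> in lborel. (cmod (h0 \<omega>))\<^sup>2 = (cmod (A \<omega> * f0 \<omega> - C0 \<omega>))\<^sup>2 / (f0 \<omega> + g0 \<omega>)\<^sup>2"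
    and A_h0_sq: "AE \<omega> in lborel. (cmod (A \<omega> - h0 \<omega>))\<^sup>2 = (f0 \<omega> - f1 \<omega>) * \<alpha>1"
  proof -
    \<comment> \<open>Valid at every frequency: where the densities sum to 0, both sides are 0 by
      the convention for division.\<close>
    have h0_div: "h0 \<omega> = (A \<omega> * f0 \<omega> - C0 \<omega>) / of_real (f0 \<omega> + g0 \<omega>)" for \<omega>
      by (simp add: h0_wiener wiener_def diff_divide_distrib)
    have sq: "(cmod (z / of_real w))\<^sup>2 = (cmod z)\<^sup>2 / w\<^sup>2" for z w
      by (simp add: norm_divide power_divide)
    show quot: "AE \<omega> in lborel. (cmod (h0 \<omega>))\<^sup>2 = (cmod (A \<omega> * f0 \<omega> - C0 \<omega>))\<^sup>2 / (f0 \<omega> + g0 \<omega>)\<^sup>2"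
      unfolding h0_div sq by simp
    show "AE \<omega> in lborel. (cmod (h0 \<omega>))\<^sup>2 = (g0 \<omega> - g1 \<omega>) * \<alpha>2"
      using quot pos eq_g unfolding A_def[symmetric] by eventually_elim simp
    show "AE \<omega> in lborel. (cmod (A \<omega> - h0 \<omega>))\<^sup>2 = (f0 \<omega> - f1 \<omega>) * \<alpha>1"
      using pos eq_f unfolding A_def[symmetric]
    proof eventually_elim
      case (elim \<omega>)
      have "complex_of_real (f0 \<omega> + g0 \<omega>) \<noteq> 0" using elim(1) by (simp del: of_real_add)
      then have "A \<omega> - h0 \<omega> = (A \<omega> * g0 \<omega> + C0 \<omega>) / of_real (f0 \<omega> + g0 \<omega>)"
        unfolding h0_div by (simp add: field_simps)
      then show ?case using elim by (simp only: sq) simp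
    qed
  qed

  \<comment> \<open>Square integrability and boundedness of \<open>h0\<close>\<close>
  have h0L: "h0 \<in> L2 lborel"
  proof -
    have "integrable lborel (\<lambda>\<omega>. (cmod (h0 \<omega>))\<^sup>2)"
    proof (rule Bochner_Integration.integrable_bound[where f="\<lambda>\<omega>. g0 \<omega> * \<alpha>2"])
      show "AE \<omega> in lborel. norm ((cmod (h0 \<omega>))\<^sup>2) \<le> norm (g0 \<omega> * \<alpha>2)"
        using h0_sq
      proof eventually_elim
        case (elim \<omega>)
        have "(g0 \<omega> - g1 \<omega>) * \<alpha>2 \<le> g0 \<omega> * \<alpha>2"
          using spectral_density_nonneg[OF g1] alpha(2) by (intro mult_right_mono) auto
        then have "(cmod (h0 \<omega>))\<^sup>2 \<le> g0 \<omega> * \<alpha>2" unfolding elim .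
        then show ?case using abs_ge_self[of "g0 \<omega> * \<alpha>2"] by simp
      qed
    qed (use spectral_density_integrable[OF fg0(2)] in auto)
    then show ?thesis by (simp add: L2_def)
  qed
  obtain c where c: "AE \<omega> in lborel. cmod (h0 \<omega>) \<le> c"
  proof -
    obtain c where "AE \<omega> in lborel. (cmod (A \<omega> * f0 \<omega> - C0 \<omega>))\<^sup>2 / (f0 \<omega> + g0 \<omega>)\<^sup>2 \<le> c"
      using h_g_bounded unfolding A_def by blast
    with h0_quot have "AE \<omega> in lborel. cmod (h0 \<omega>) \<le> sqrt c"
      by eventually_elim (simp add: real_le_rsqrt)
    then show thesis by (rule that)
  qed

  \<comment> \<open>Orthogonality to all transforms from L2(T), and membership for every
    pair\<close>
  have orth: "(\<integral>\<omega>. h0 \<omega> * cnj (fourier T k \<omega>) \<partial>lborel) = 0" if "k \<in> L2 (restrict_space lborel T)" for k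
  proof (rule orthogonal_if_orthogonal_dense[OF Tb h0L _ _ _ that])
    show "B_form_domain T f0 g0 \<subseteq> L2 (restrict_space lborel T)" by (auto simp: B_form_domain_def)
    show "\<exists>x\<in>B_form_domain T f0 g0. (\<integral>t. (cmod (y t - x t))\<^sup>2 \<partial>restrict_space lborel T) < e"
      if "y \<in> L2 (restrict_space lborel T)" "0 < e" for y e
      using invertible that unfolding B_invertible_def by metis
    show "(\<integral>\<omega>. h0 \<omega> * cnj (fourier T k \<omega>) \<partial>lborel) = 0" if "k \<in> B_form_domain T f0 g0" for k
      using B_graph_orthogonal(2)[OF fg0 pos Tb bT Am four_b graph that] by (simp only: h0_wiener C0x)
  qed

  have h0_mem: "h0 \<in> L2s U f g" if "spectral_density f" "spectral_density g" for f g
    by (rule L2s_memI[OF that Tb UT h0m c orth])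

  \<comment> \<open>Normal equations at the pair \<open>(f0, g0)\<close>\<close>
  note A' = Am[unfolded A_def] Ab[unfolded A_def]
  have h0_min: "mse R a f0 g0 h0 \<le> mse R a f0 g0 h" if "h \<in> L2s U f0 g0" for h
  proof (rule mse_minimal_if_orthogonal[OF fg0 A' h0_mem[OF fg0] _ that])
    fix t assume "t \<in> U"
    then obtain r where r: "0 < r" "ball t r \<subseteq> U" using openU by (auto simp: open_contains_ball)
    have C0_ae: "AE \<omega> in lborel. (f0 \<omega> + g0 \<omega>) *\<^sub>R (wiener A f0 g0 \<omega> - h0 \<omega>) = C0 \<omega>"
      using pos by eventually_elim (simp add: h0_wiener scaleR_conv_of_real del: of_real_add)
    \<comment> \<open>\<open>C0\<close> is so far known only to be square integrable. As the product
      of \<open>f0 + g0\<close> with an element of L2(f0 + g0) it is also integrable, which the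
      pointwise inversion requires.\<close>
    have "(\<lambda>\<omega>. wiener A f0 g0 \<omega> - h0 \<omega>) \<in> L2 (spectral_measure f0 g0)"
      by (intro L2_diff wiener_L2[OF fg0 Am Ab] L2_spectral_bounded[OF fg0 h0m c])
    moreover have "(\<lambda>_. 1) \<in> L2 (spectral_measure f0 g0)"
      by (rule L2_spectral_bounded[OF fg0, where c=1]) auto
    ultimately have "integrable (spectral_measure f0 g0) (\<lambda>\<omega>. (wiener A f0 g0 \<omega> - h0 \<omega>) * 1)"
      by (rule L2_mult_integrable(1))
    then have "integrable lborel (\<lambda>\<omega>. (f0 \<omega> + g0 \<omega>) *\<^sub>R (wiener A f0 g0 \<omega> - h0 \<omega>))"
      by (subst (asm) integrable_spectral_measure[OF fg0]) (auto simp: wiener_def)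
    then have iC0: "integrable lborel C0"
      by (rule integrable_cong_AE_imp) (use C0_ae in auto)
    have "(\<integral>\<omega>. cis (t * \<omega>) * cnj (wiener A f0 g0 \<omega> - h0 \<omega>) \<partial>spectral_measure f0 g0) =
        (\<integral>\<omega>. (f0 \<omega> + g0 \<omega>) *\<^sub>R (cis (t * \<omega>) * cnj (wiener A f0 g0 \<omega> - h0 \<omega>)) \<partial>lborel)"
      by (rule integral_spectral_measure[OF fg0]) (simp add: wiener_def)
    also have "\<dots> = (\<integral>\<omega>. cnj (C0 \<omega> * cnj (cis (t * \<omega>))) \<partial>lborel)"
    proof (rule integral_cong_AE)
      show "AE \<omega> in lborel. (f0 \<omega> + g0 \<omega>) *\<^sub>R (cis (t * \<omega>) * cnj (wiener A f0 g0 \<omega> - h0 \<omega>)) =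
          cnj (C0 \<omega> * cnj (cis (t * \<omega>)))"
        using C0_ae
      proof eventually_elim
        case (elim \<omega>)
        show ?case unfolding elim[symmetric] by (simp add: scaleR_conv_of_real mult_ac)
      qed
    qed (simp_all add: wiener_def)
    also have "\<dots> = cnj (\<integral>\<omega>. C0 \<omega> * cnj (cis (t * \<omega>)) \<partial>lborel)"
      by (rule Bochner_Integration.integral_cnj)
    also have "(\<integral>\<omega>. C0 \<omega> * cnj (cis (t * \<omega>)) \<partial>lborel) = 0"
    proof (rule fourier_L2_vanishing[OF _ _ iC0 r(1)])
      show "ext_by_zero T x \<in> L2 lborel" using xT by (simp add: L2_restrict_iff[OF Tb])
      show "fourier_L2 (ext_by_zero T x) C0" unfolding C0x by (rule fourier_fourier_L2[OF Tb xT])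
      show "ext_by_zero T x u = 0" if "\<bar>u - t\<bar> < r" for u
        using r(2) that UT by (auto simp: ext_by_zero_def dist_real_def abs_minus_commute subset_iff)
    qed
    finally show "(\<integral>\<omega>. cis (t * \<omega>) * cnj (wiener (A_fun R a) f0 g0 \<omega> - h0 \<omega>) \<partial>spectral_measure f0 g0) = 0"
      by (simp add: A_def)
  qed

  \<comment> \<open>Maximization of a linear functional over the product of two balls\<close>
  have saddle: "mse R a f g h0 \<le> mse R a f0 g0 h0"
    if f: "f \<in> L2_neighbourhood f1 \<epsilon>1" and g: "g \<in> L2_neighbourhood g1 \<epsilon>2" for f g
  proof -
    note h0_sp = L2_spectral_bounded[OF _ _ h0m c]
    note i = mse_integrable[OF fD[OF f] gD[OF g] A' h0_sp[OF fD[OF f] gD[OF g]]]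
      and i0 = mse_integrable[OF fg0 A' h0_sp[OF fg0]]
    show ?thesis
      unfolding mse_def
      by (intro add_mono mult_left_mono
          saddle_inequality[OF f0 f norm_f A_h0_sq[unfolded A_def] alpha(1) i(1) i0(1)]
          saddle_inequality[OF g0 g norm_g h0_sq alpha(2) i(2) i0(2)]) auto
  qed

  \<comment> \<open>Consequences of the saddle point\<close>
  have opt0: "mse R a f0 g0 h0 \<le> opt_mse U R a f0 g0"
    unfolding opt_mse_def by (rule h0_min[OF opt_mse_le(2)[OF fg0 A']])
  have "least_favorable U R a D f0 g0"
    unfolding least_favorable_def D
  proof (intro conjI ballI)
    show "(f0, g0) \<in> L2_neighbourhood f1 \<epsilon>1 \<times> L2_neighbourhood g1 \<epsilon>2" using f0 g0 by simp
    fix fg assume "fg \<in> L2_neighbourhood f1 \<epsilon>1 \<times> L2_neighbourhood g1 \<epsilon>2"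
    then obtain f g where fg: "fg = (f, g)" "f \<in> L2_neighbourhood f1 \<epsilon>1" "g \<in> L2_neighbourhood g1 \<epsilon>2" by auto
    \<comment> \<open>Here \<open>h0\<close> has to be admissible for an arbitrary pair of the
      class: its error then bounds the optimal one.\<close>
    have "opt_mse U R a f g \<le> mse R a f g h0"
      by (rule opt_mse_le(1)[OF fD[OF fg(2)] gD[OF fg(3)] A' h0_mem[OF fD[OF fg(2)] gD[OF fg(3)]]])
    also have "\<dots> \<le> mse R a f0 g0 h0" by (rule saddle[OF fg(2,3)])
    also note opt0
    finally show "case fg of (f, g) \<Rightarrow> opt_mse U R a f g \<le> opt_mse U R a f0 g0" by (simp add: fg(1))
  qed
  moreover have "minimax_robust U R a D h0"
    unfolding minimax_robust_def
  proof (intro conjI ballI)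
    show "h0 \<in> H_class U D" unfolding H_class_def D using h0_mem fD gD by auto
    fix h assume h: "h \<in> H_class U D"
    then have hL: "h \<in> L2s U f0 g0" unfolding H_class_def D using f0 g0 by auto
    \<comment> \<open>Any competitor in \<open>H_class U D\<close> is in particular admissible for
      \<open>(f0, g0)\<close>, so the error at that single pair separates the two suprema.\<close>
    have "max_mse R a D h0 \<le> ereal (mse R a f0 g0 h0)"
      unfolding max_mse_def D by (rule SUP_least) (use saddle in auto)
    also have "\<dots> \<le> ereal (mse R a f0 g0 h)" using h0_min[OF hL] by simp
    also have "\<dots> \<le> max_mse R a D h"
      unfolding max_mse_def D by (rule SUP_upper2[of "(f0, g0)"]) (use f0 g0 in auto)
    finally show "max_mse R a D h0 \<le> max_mse R a D h" .
  qed
  ultimately show ?thesis ..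
qed

end
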